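(* Let $G$ be a locally Roelcke precompact (LRPC) group and let $\zeta\colon\mathcal{N}_G^{\mathrm{RPC}}\to\mathrm{SN}_{\mathrm{RPC}}(G)$ be a function. There is a compact Hausdorff topology $\tau$ on $\mathrm{WT}_\zeta(G)$, uniquely determined by the property that whenever $\langle X_i:i\in I\rangle$ is a tuple of $\zeta$-Urysohn $G$-flows and $\mathcal{U}\in\beta I$, we have $$\tau\text{-}\lim_{i\to\mathcal{U}}\mathrm{tp}_G(X_i)=\mathrm{tp}_G(\Sigma_{\mathcal{U}}^GX_i).$$ Furthermore, when $G$ is separable and metrizable, this topology on $\mathrm{WT}_\zeta(G)$ is metrizable.
   Context: All groups and spaces are Hausdorff. $G$ is a topological group with identity $e_G$ and $\mathcal{N}(G)$ is a fixed base of symmetric open neighborhoods of $e_G$. A $G$-flow is a compact space with a continuous left $G$-action. Ultracoproducts. For a $G$-space $X$, $\mathrm{C}_G(X)$ is the algebra of bounded continuous $p\colon X\to\mathbb{C}$ such that $g\mapsto pg$ is sup-norm continuous, where $(pg)(x)=p(gx)$; $\alpha_G(X)$ is its Gelfand space, a $G$-flow. For an infinite set $I$, $G$-flows $\langle X_i:i\in I\rangle$ and $\mathcal{U}\in\beta I$, the space $\bigsqcup_iX_i$ embeds in $\alpha_G(\bigsqcup_i X_i)$, the map $\bigsqcup_iX_i\to\beta I$ sending $X_i$ to $i$ extends continuously to $\pi_I\colon\alpha_G(\bigsqcup_iX_i)\to\beta I$, and the ultracoproduct is the $G$-flow $\Sigma_{\mathcal{U}}^GX_i:=\pi_I^{-1}(\{\mathcal{U}\})$.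 LRPC groups. $S\subseteq G$ is Roelcke precompact (RPC) if for every $V\in\mathcal{N}(G)$ there is a finite $F\subseteq G$ with $S\subseteq VFV$. $G$ is LRPC if some $U\in\mathcal{N}(G)$ is RPC. $\mathcal{N}_G^{\mathrm{RPC}}$ is the set of RPC members of $\mathcal{N}(G)$. A semi-norm on $G$ is a bounded continuous $\sigma\colon G\to\mathbb{R}^{\ge0}$ with $\sigma(e_G)=0$, $\sigma(g^{-1})=\sigma(g)$, $\sigma(gh)\le\sigma(g)+\sigma(h)$; $\mathrm{SN}_{\mathrm{RPC}}(G)$ is the set of semi-norms $\sigma$ such that $\{g:\sigma(g)<1\}$ is RPC. Urysohn flows. For a $G$-flow $X$ and $U\in\mathcal{N}(G)$, $R_U^X:=\overline{\{(x,gx):x\in X,g\in U\}}\subseteq X^2$. For $\sigma\in \mathrm{SN}_{\mathrm{RPC}}(G)$, $X$ is $(U,\sigma)$-Urysohn if whenever $K,L\subseteq X$ are non-empty closed with $(K\times L)\cap R_U^X=\emptyset$, then for every $0<c<1$ there is a continuous $p\colon X\to[0,1]$ with $\|pg-p\|\le\sigma(g)$ for all $g\in G$, $p|_K\equiv0$ and $p|_L\equiv c$. Given $\zeta\colon\mathcal{N}_G^{\mathrm{RPC}}\to\mathrm{SN}_{\mathrm{RPC}}(G)$, $X$ is $\zeta$-Urysohn if it is $(U,\zeta(U))$-Urysohn for every $U\in\mathcal{N}_G^{\mathrm{RPC}}$. (Ultracoproducts of $\zeta$-Urysohn $G$-flows are $\zeta$-Urysohn.) Weak types. For finite $F\subseteq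 G$ and finite $N\subseteq\mathcal{N}_G^{\mathrm{RPC}}$, $\mathcal{L}_{F,N}$ is the relational language $\{E_{g,U}:g\in F,U\in N\}\cup\{C_n:1\le n<\omega\}$ with $E_{g,U}$ binary and $C_n$ $n$-ary. $\mathrm{Str}(F,N)$ is the set of $\mathcal{L}_{F,N}$-structures with vertex set $n=\{0,\dots,n-1\}$ for some $n\in\mathbb{N}$, and $\mathrm{Str}(G,\mathcal{N}_G^{\mathrm{RPC}})$ is the union of these over all finite $F\subseteq G$, $N\subseteq\mathcal{N}_G^{\mathrm{RPC}}$. For a $G$-flow $X$ and a finite set $\mathcal{O}$ of non-empty open subsets of $X$, $\mathbf{Str}(\mathcal{O},F,N)$ is the $\mathcal{L}_{F,N}$-structure with vertex set $\mathcal{O}$ in which $E_{g,U}(A,B)$ holds iff $(\overline{gA}\times\overline{B})\cap R_U^X=\emptyset$, and $C_n(A_0,\dots,A_{n-1})$ holds iff $\bigcup_{m<n}A_m=X$. $X$ realizes $\mathbf{M}\in\mathrm{Str}(F,N)$ if for some finite set $\mathcal{O}$ of non-empty open subsets of $X$ there is a bijection $e\colon\mathbf{M}\to\mathbf{Str}(\mathcal{O},F,N)$ such that images of related tuples are related. The weak type $\mathrm{tp}_G(X)$ is the set of all $\mathbf{M}\in\mathrm{Str}(G,\mathcal{N}_G^{\mathrm{RPC}})$ realized by $X$. $\mathrm{WT}_\zeta(G)$ is the set of weak types $\mathrm{tp}_G(X)$ of $\zeta$-Urysohn $G$-flows $X$. *)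

theory Defs
  imports "HOL-Analysis.Analysis"
begin

text \<open>
  A topological group is a type of sort \<open>{topological_group_add, t2_space}\<close>. The class
  \<open>topological_group_add\<close> does not assume commutativity: \<open>g + h\<close>, \<open>0\<close>, \<open>- g\<close> stand for
  \<open>gh\<close>, \<open>e\<^sub>G\<close>, \<open>g\<^sup>-\<^sup>1\<close>, and \<open>A + B\<close> is the product set \<open>AB\<close>.
\<close>

subsection \<open>Locally Roelcke precompact groups\<close>

definition symmetric_open_base :: "'g::topological_group_add set set \<Rightarrow> bool" where
  "symmetric_open_base \<N> \<longleftrightarrow>
     (\<forall>U\<in>\<N>. open U \<and> 0 \<in> U \<and> uminus ` U = U) \<and>
     (\<forall>W. open W \<longrightarrow> 0 \<in> W \<longrightarrow> (\<exists>U\<in>\<N>. U \<subseteq> W))"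

definition RPC :: "'g::topological_group_add set set \<Rightarrow> 'g set \<Rightarrow> bool" where
  "RPC \<N> S \<longleftrightarrow> (\<forall>V\<in>\<N>. \<exists>F. finite F \<and> S \<subseteq> V + F + V)"

definition LRPC :: "'g::topological_group_add set set \<Rightarrow> bool" where
  "LRPC \<N> \<longleftrightarrow> (\<exists>U\<in>\<N>. RPC \<N> U)"

definition N_RPC :: "'g::topological_group_add set set \<Rightarrow> 'g set set" where
  "N_RPC \<N> = {U\<in>\<N>. RPC \<N> U}"

definition seminorm :: "('g::topological_group_add \<Rightarrow> real) \<Rightarrow> bool" where
  "seminorm \<sigma> \<longleftrightarrow>
     bounded (range \<sigma>) \<and> continuous_on UNIV \<sigma> \<and> (\<forall>g. 0 \<le> \<sigma> g) \<and> \<sigma> 0 = 0 \<and>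
     (\<forall>g. \<sigma> (- g) = \<sigma> g) \<and> (\<forall>g h. \<sigma> (g + h) \<le> \<sigma> g + \<sigma> h)"

definition SN_RPC :: "'g::topological_group_add set set \<Rightarrow> ('g \<Rightarrow> real) set" where
  "SN_RPC \<N> = {\<sigma>. seminorm \<sigma> \<and> RPC \<N> {g. \<sigma> g < 1}}"


subsection \<open>Flows\<close>

record ('g, 'x) gspace =
  topol :: "'x topology"
  act :: "'g \<Rightarrow> 'x \<Rightarrow> 'x"

abbreviation pts :: "('g, 'x) gspace \<Rightarrow> 'x set" where
  "pts X \<equiv> topspace (topol X)"

definition gflow :: "('g::topological_group_add, 'x) gspace \<Rightarrow> bool" where
  "gflow X \<longleftrightarrow>
     compact_space (topol X) \<and> Hausdorff_space (topol X) \<and>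
     (\<forall>x\<in>pts X. act X 0 x = x) \<and>
     (\<forall>g h. \<forall>x\<in>pts X. act X (g + h) x = act X g (act X h x)) \<and>
     continuous_map (prod_topology euclidean (topol X)) (topol X) (\<lambda>(g, x). act X g x)"


subsection \<open>Ultracoproducts\<close>

text \<open>Functions on the points of \<open>X\<close> are represented by \<open>extensional\<close> functions on the type.\<close>

definition C_G :: "('g::topological_group_add, 'x) gspace \<Rightarrow> ('x \<Rightarrow> complex) set" where
  "C_G X = {p \<in> extensional (pts X).
     continuous_map (topol X) euclidean p \<and> bounded (p ` pts X) \<and>
     (\<forall>g\<^sub>0. uniform_limit (pts X) (\<lambda>g x. p (act X g x)) (\<lambda>x. p (act X g\<^sub>0 x)) (at g\<^sub>0))}"

definition translate :: "('g, 'x) gspace \<Rightarrow> ('x \<Rightarrow> complex) \<Rightarrow> 'g \<Rightarrow> 'x \<Rightarrow> complex" where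
  "translate X p g = (\<lambda>x\<in>pts X. p (act X g x))"

definition characters ::
    "('g::topological_group_add, 'x) gspace \<Rightarrow> (('x \<Rightarrow> complex) \<Rightarrow> complex) set" where
  "characters X = {\<phi> \<in> extensional (C_G X).
     \<phi> (\<lambda>x\<in>pts X. 1) = 1 \<and>
     (\<forall>c. \<forall>p\<in>C_G X. \<phi> (\<lambda>x\<in>pts X. c * p x) = c * \<phi> p) \<and>
     (\<forall>p\<in>C_G X. \<forall>q\<in>C_G X. \<phi> (\<lambda>x\<in>pts X. p x + q x) = \<phi> p + \<phi> q) \<and>
     (\<forall>p\<in>C_G X. \<forall>q\<in>C_G X. \<phi> (\<lambda>x\<in>pts X. p x * q x) = \<phi> p * \<phi> q)}"

text \<open>The Gelfand space carries the topology of pointwise convergence (the weak-* topology).\<close>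

definition alpha_G ::
    "('g::topological_group_add, 'x) gspace \<Rightarrow> ('g, ('x \<Rightarrow> complex) \<Rightarrow> complex) gspace" where
  "alpha_G X =
     \<lparr>topol = subtopology (product_topology (\<lambda>_. euclidean) (C_G X)) (characters X),
      act = (\<lambda>g \<phi>. \<lambda>p\<in>C_G X. \<phi> (translate X p g))\<rparr>"

definition point_eval ::
    "('g::topological_group_add, 'x) gspace \<Rightarrow> 'x \<Rightarrow> ('x \<Rightarrow> complex) \<Rightarrow> complex" where
  "point_eval X x = (\<lambda>p\<in>C_G X. p x)"

definition disjoint_union ::
    "'i set \<Rightarrow> ('i \<Rightarrow> ('g, 'x) gspace) \<Rightarrow> ('g, 'i \<times> 'x) gspace" where
  "disjoint_union I X =
     \<lparr>topol = sum_topology (\<lambda>i. topol (X i)) I, act = (\<lambda>g (i, x). (i, act (X i) g x))\<rparr>"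

text \<open>An ultrafilter on \<open>I\<close> is represented by a filter on the index type that contains \<open>I\<close>;
  the point \<open>i\<close> of \<open>I\<close> is identified with \<open>principal {i}\<close>.\<close>

definition ultrafilters :: "'i set \<Rightarrow> 'i filter set" where
  "ultrafilters I = {\<U>. \<U> \<noteq> bot \<and> eventually (\<lambda>i. i \<in> I) \<U> \<and>
     (\<forall>P. eventually P \<U> \<or> eventually (\<lambda>i. \<not> P i) \<U>)}"

definition beta_space :: "'i set \<Rightarrow> 'i filter topology" where
  "beta_space I = topology_generated_by {{\<U> \<in> ultrafilters I. eventually (\<lambda>i. i \<in> A) \<U>} |A. A \<subseteq> I}"

definition pi_I ::
    "'i set \<Rightarrow> ('i \<Rightarrow> ('g::topological_group_add, 'x) gspace) \<Rightarrow>
     (('i \<times> 'x \<Rightarrow> complex) \<Rightarrow> complex) \<Rightarrow> 'i filter" where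
  "pi_I I X = (THE \<pi>.
     \<pi> \<in> extensional (pts (alpha_G (disjoint_union I X))) \<and>
     continuous_map (topol (alpha_G (disjoint_union I X))) (beta_space I) \<pi> \<and>
     (\<forall>i\<in>I. \<forall>x\<in>pts (X i). \<pi> (point_eval (disjoint_union I X) (i, x)) = principal {i}))"

definition ultracoproduct ::
    "'i set \<Rightarrow> ('i \<Rightarrow> ('g::topological_group_add, 'x) gspace) \<Rightarrow> 'i filter \<Rightarrow>
     ('g, ('i \<times> 'x \<Rightarrow> complex) \<Rightarrow> complex) gspace" where
  "ultracoproduct I X \<U> = (let A = alpha_G (disjoint_union I X) in
     \<lparr>topol = subtopology (topol A) {\<phi> \<in> pts A. pi_I I X \<phi> = \<U>}, act = act A\<rparr>)"


subsection \<open>Urysohn flows\<close>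

definition R_rel :: "('g, 'x) gspace \<Rightarrow> 'g set \<Rightarrow> ('x \<times> 'x) set" where
  "R_rel X U = prod_topology (topol X) (topol X) closure_of {(x, act X g x) |x g. x \<in> pts X \<and> g \<in> U}"

definition Urysohn :: "('g, 'x) gspace \<Rightarrow> 'g set \<Rightarrow> ('g \<Rightarrow> real) \<Rightarrow> bool" where
  "Urysohn X U \<sigma> \<longleftrightarrow>
     (\<forall>K L. closedin (topol X) K \<longrightarrow> closedin (topol X) L \<longrightarrow> K \<noteq> {} \<longrightarrow> L \<noteq> {} \<longrightarrow>
        (K \<times> L) \<inter> R_rel X U = {} \<longrightarrow>
        (\<forall>c::real. 0 < c \<longrightarrow> c < 1 \<longrightarrow>
          (\<exists>p. continuous_map (topol X) (top_of_set {0..1}) p \<and>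
               (\<forall>g. \<forall>x\<in>pts X. \<bar>p (act X g x) - p x\<bar> \<le> \<sigma> g) \<and>
               (\<forall>x\<in>K. p x = 0) \<and> (\<forall>x\<in>L. p x = c))))"

definition zeta_Urysohn ::
    "'g::topological_group_add set set \<Rightarrow> ('g set \<Rightarrow> 'g \<Rightarrow> real) \<Rightarrow> ('g, 'x) gspace \<Rightarrow> bool" where
  "zeta_Urysohn \<N> \<zeta> X \<longleftrightarrow> (\<forall>U\<in>N_RPC \<N>. Urysohn X U (\<zeta> U))"


subsection \<open>Weak types\<close>

datatype 'g symbol = Edge 'g "'g set" | Cover nat

fun arity :: "'g symbol \<Rightarrow> nat" where
  "arity (Edge g U) = 2"
| "arity (Cover n) = n"

definition language :: "'g set \<Rightarrow> 'g set set \<Rightarrow> 'g symbol set" where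
  "language F N = {Edge g U |g U. g \<in> F \<and> U \<in> N} \<union> {Cover n |n. 1 \<le> n}"

record ('g, 'v) relstr =
  lang :: "'g symbol set"
  verts :: "'v set"
  interp :: "'g symbol \<Rightarrow> 'v list set"

text \<open>Symbols outside the language are interpreted by the empty set, so that equality of
  records is equality of structures.\<close>

definition Str :: "'g set \<Rightarrow> 'g set set \<Rightarrow> ('g, nat) relstr set" where
  "Str F N = {M. lang M = language F N \<and> (\<exists>n. verts M = {..<n}) \<and>
     (\<forall>s\<in>language F N. interp M s \<subseteq> {xs. length xs = arity s \<and> set xs \<subseteq> verts M}) \<and>
     (\<forall>s. s \<notin> language F N \<longrightarrow> interp M s = {})}"

definition Str_of ::
    "('g, 'x) gspace \<Rightarrow> 'x set set \<Rightarrow> 'g set \<Rightarrow> 'g set set \<Rightarrow> ('g, 'x set) relstr" where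
  "Str_of X \<O> F N =
     \<lparr>lang = language F N, verts = \<O>,
      interp = (\<lambda>s. if s \<notin> language F N then {} else
        (case s of
           Edge g U \<Rightarrow> {[A, B] |A B. A \<in> \<O> \<and> B \<in> \<O> \<and>
             ((topol X closure_of (act X g ` A)) \<times> (topol X closure_of B)) \<inter> R_rel X U = {}}
         | Cover n \<Rightarrow> {As. length As = n \<and> set As \<subseteq> \<O> \<and> \<Union>(set As) = pts X}))\<rparr>"

definition realizes :: "('g, 'x) gspace \<Rightarrow> 'g set \<Rightarrow> 'g set set \<Rightarrow> ('g, nat) relstr \<Rightarrow> bool" where
  "realizes X F N M \<longleftrightarrow>
     (\<exists>\<O>. finite \<O> \<and> (\<forall>A\<in>\<O>. openin (topol X) A \<and> A \<noteq> {}) \<and>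
       (\<exists>e. bij_betw e (verts M) (verts (Str_of X \<O> F N)) \<and>
         (\<forall>s\<in>language F N. \<forall>xs\<in>interp M s. map e xs \<in> interp (Str_of X \<O> F N) s)))"

type_synonym 'g wtype = "('g, nat) relstr set"

definition tp_G :: "'g::topological_group_add set set \<Rightarrow> ('g, 'x) gspace \<Rightarrow> 'g wtype" where
  "tp_G \<N> X = {M. \<exists>F N. finite F \<and> finite N \<and> N \<subseteq> N_RPC \<N> \<and> M \<in> Str F N \<and> realizes X F N M}"

text \<open>
  HOL cannot quantify over all carrier types inside a formula, so weak types are collected from
  flows on one fixed large type. No weak type is lost: every \<open>\<zeta>\<close>-Urysohn flow has
  a \<open>\<zeta>\<close>-Urysohn factor with the same weak type whose topology is generated by at most
  \<open>max(\<aleph>\<^sub>0, card (Pow G))\<close> many real functions (close a suitable set of functions under the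
  \<open>G\<close>-action and under witnesses for the Urysohn property), and such a factor embeds in a power
  of the reals indexed by \<open>'g set \<times> nat\<close>.
\<close>

type_synonym 'g universe = "'g set \<times> nat \<Rightarrow> real"

definition WT ::
    "'g::topological_group_add set set \<Rightarrow> ('g set \<Rightarrow> 'g \<Rightarrow> real) \<Rightarrow> 'g wtype set" where
  "WT \<N> \<zeta> = {tp_G \<N> X |X :: ('g, 'g universe) gspace. gflow X \<and> zeta_Urysohn \<N> \<zeta> X}"

text \<open>The limit property, for index sets in the type \<open>'i\<close> and flows on the type \<open>'x\<close>.\<close>

definition ultralimit_property ::
    "'i itself \<Rightarrow> 'x itself \<Rightarrow> 'g::topological_group_add set set \<Rightarrow> ('g set \<Rightarrow> 'g \<Rightarrow> real) \<Rightarrow>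
     'g wtype topology \<Rightarrow> bool" where
  "ultralimit_property TYPE('i) TYPE('x) \<N> \<zeta> \<tau> \<longleftrightarrow>
     (\<forall>(I :: 'i set) (X :: 'i \<Rightarrow> ('g, 'x) gspace) \<U>.
        infinite I \<longrightarrow> (\<forall>i\<in>I. gflow (X i) \<and> zeta_Urysohn \<N> \<zeta> (X i)) \<longrightarrow> \<U> \<in> ultrafilters I \<longrightarrow>
        limitin \<tau> (\<lambda>i. tp_G \<N> (X i)) (tp_G \<N> (ultracoproduct I X \<U>)) \<U>)"

definition compact_Hausdorff_on :: "'a set \<Rightarrow> 'a topology \<Rightarrow> bool" where
  "compact_Hausdorff_on S \<tau> \<longleftrightarrow> topspace \<tau> = S \<and> compact_space \<tau> \<and> Hausdorff_space \<tau>"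

end

theory Submission
  imports Defs
begin

text \<open>
  Realizations of a finite structure are described by continuous functions, and these can be moved
  between flows \<open>X\<^sub>i\<close> and their ultracoproduct \<open>\<Sigma>\<close>, whose points are limits of evaluations at
  points of the \<open>X\<^sub>i\<close>. If \<open>M\<close> is in the type of \<open>\<Sigma>\<close>, then it is in the type of \<open>X\<^sub>i\<close> for most
  \<open>i\<close>: Roelcke precompactness of the neighborhoods named by \<open>M\<close> makes group elements that depend on
  \<open>i\<close> constant along the ultrafilter, up to small displacements. The converse holds with a loss. A
  refinement of \<open>M\<close> describes a fine cell decomposition and records which cells are not close to each
  other; if a refinement is realized in most \<open>X\<^sub>i\<close>, the Urysohn property yields functions on the \<open>X\<^sub>i\<close>
  that are equicontinuous uniformly in \<open>i\<close>, and these realize \<open>M\<close> in \<open>\<Sigma>\<close>. Every member of a weak type has a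
  refinement in the same type. Hence \<open>M\<close> is in the type of \<open>\<Sigma>\<close> iff some refinement of \<open>M\<close> is in
  most of the types of the \<open>X\<^sub>i\<close>: the limit depends only on the image ultrafilter on the set of weak types. The
  resulting limit operation for ultrafilters is associative, so it is the convergence of a compact Hausdorff
  topology, and such a topology is determined by its convergent ultrafilters. If \<open>G\<close> is separable
  and metrizable, countably many refinements suffice, and Urysohn functions separating them embed
  the space of weak types in a countable power of the reals.
\<close>

subsection \<open>Ultrafilters and compactness\<close>

text \<open>An edge demands that two closures avoid the closed relation of \<open>U\<close>. In the
  ultracoproduct such a gap is robust, because counterexamples in the factors would converge to one
  there. Gaps in the single factors carry no common lower bound and may close in the limit; the
  Urysohn property restores uniformity, since \<open>\<zeta> U\<close> bounds the moduli of its
  functions for all flows at once. So membership of \<open>M\<close> yields only an open condition,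
  and the other basic open sets have to be complements of sets of limits.

  Open sets do not move between factors and ultracoproduct, but functions do: an element of
  \<open>C_G\<close> of the disjoint union lives on every factor and on the ultracoproduct. The gaps
  between the thresholds 0, 1/4, 1/2 and 1 pay for limits, closures and displacements.

  Carriers are a further obstacle: weak types are collected on one fixed type, and an ultracoproduct
  lives on another. It is brought back through a factor whose coordinates are functions named by a
  syntax that is coded into the index type.\<close>

definition ultra :: "'a filter \<Rightarrow> bool" where
  "ultra U \<longleftrightarrow> U \<noteq> bot \<and> (\<forall>P. eventually P U \<or> eventually (\<lambda>x. \<not> P x) U)"

lemma ultra_not: "ultra U \<Longrightarrow> \<not> eventually P U \<longleftrightarrow> eventually (\<lambda>x. \<not> P x) U"
  unfolding ultra_def using eventually_conj[of P U "\<lambda>x. \<not> P x"] by auto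

lemma ultra_disj:
  assumes "ultra U" "eventually (\<lambda>x. P x \<or> Q x) U"
  shows "eventually P U \<or> eventually Q U"
proof (rule ccontr)
  assume "\<not> ?thesis"
  then have "eventually (\<lambda>x. \<not> P x) U" "eventually (\<lambda>x. \<not> Q x) U"
    using ultra_not[OF assms(1)] by blast+
  with assms(2) have "eventually (\<lambda>x. False) U"
    by eventually_elim auto
  with assms(1) show False by (simp add: ultra_def)
qed

lemma ultra_finite_bex:
  assumes "ultra U" "finite A" "eventually (\<lambda>x. \<exists>a\<in>A. P a x) U"
  shows "\<exists>a\<in>A. eventually (P a) U"
  using assms(2,3)
proof (induction A rule: finite_induct)
  case empty
  then show ?case using assms(1) by (simp add: ultra_def)
next
  case (insert a A)
  from insert.prems have "eventually (\<lambda>x. P a x \<or> (\<exists>a\<in>A. P a x)) U" by simp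
  from ultra_disj[OF assms(1) this] insert.IH show ?case by blast
qed

lemma ultra_ex_of_ev: "ultra U \<Longrightarrow> eventually P U \<Longrightarrow> \<exists>x. P x"
  unfolding ultra_def using eventually_happens by blast

lemma ultra_filtermap: "ultra U \<Longrightarrow> ultra (filtermap f U)"
  by (simp add: ultra_def filtermap_bot_iff eventually_filtermap)

lemma ultra_principal: "ultra (principal {x})"
  by (auto simp: ultra_def eventually_principal principal_eq_bot_iff)

text \<open>Ultrafilters are maximal among proper filters, so one inclusion suffices.\<close>

lemma ultra_eqI:
  assumes "ultra U" "V \<noteq> bot" "\<And>P. eventually P U \<Longrightarrow> eventually P V"
  shows "U = V"
proof (rule filter_eq_iff[THEN iffD2], intro allI iffI)
  fix P assume "eventually P V"
  show "eventually P U"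
  proof (rule ccontr)
    assume "\<not> eventually P U"
    then have "eventually (\<lambda>x. \<not> P x) V" using ultra_not assms by blast
    with \<open>eventually P V\<close> have "eventually (\<lambda>x. False) V" by eventually_elim auto
    with assms(2) show False by simp
  qed
qed (use assms in auto)

text \<open>Zorn on the proper filters below \<open>F\<close>, finer ones being larger. The infimum
  of a chain is proper because an eventually false predicate would already be false along one
  member.\<close>

lemma ultra_exists:
  assumes "F \<noteq> bot"
  shows "\<exists>U\<le>F. ultra U"
proof -
  let ?A = "{G. G \<le> F \<and> G \<noteq> bot}"
  let ?P = "\<lambda>a u :: 'a filter. u \<le> a"
  have po: "partial_order_on ?A (relation_of ?P ?A)"
    by (auto simp: partial_order_on_def preorder_on_def refl_on_def trans_def antisym_def relation_of_def)
  have ch: "\<exists>u\<in>?A. \<forall>a\<in>C. ?P a u" if C: "C \<in> Chains (relation_of ?P ?A)" for C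
  proof (cases "C = {}")
    case True
    then show ?thesis using assms by auto
  next
    case False
    have CA: "C \<subseteq> ?A" and comp: "\<And>a b. a \<in> C \<Longrightarrow> b \<in> C \<Longrightarrow> a \<le> b \<or> b \<le> a"
      using C by (fastforce simp: Chains_def relation_of_def)+
    have "eventually (\<lambda>_. False) (Inf C) \<longleftrightarrow> (\<exists>b\<in>C. eventually (\<lambda>_. False) b)"
    proof (rule eventually_Inf_base)
      show "\<exists>x\<in>C. x \<le> inf F G" if "F \<in> C" "G \<in> C" for F G
        using comp[OF that] that by (metis inf.absorb1 inf.absorb2 order_refl)
    qed (use False in simp)
    then have "Inf C \<noteq> bot" using CA by (auto simp: trivial_limit_def)
    moreover have "Inf C \<le> F" using False CA by (metis (mono_tags, lifting) Inf_lower2 equals0I mem_Collect_eq subsetD)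
    ultimately show ?thesis by (auto intro!: bexI[of _ "Inf C"] Inf_lower)
  qed
  obtain m where m: "m \<in> ?A" "\<And>a. a \<in> ?A \<Longrightarrow> a \<le> m \<Longrightarrow> a = m"
    using predicate_Zorn[OF po ch] by auto
  have "eventually P m \<or> eventually (\<lambda>x. \<not> P x) m" for P
  proof (cases "inf m (principal {x. P x}) = bot")
    case True
    then have "eventually (\<lambda>x. \<not> P x) m"
      by (simp add: trivial_limit_def eventually_inf_principal)
    then show ?thesis by simp
  next
    case False
    with m have "inf m (principal {x. P x}) = m"
      by (simp add: le_infI1)
    then have "m \<le> principal {x. P x}" by (simp add: inf.absorb_iff1)
    then show ?thesis by (simp add: le_principal)
  qed
  with m(1) show ?thesis by (auto simp: ultra_def)
qed

section \<open>Ultralimits and compactness\<close>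

lemma ultra_limit_compact:
  fixes f :: "'a \<Rightarrow> 'b::topological_space"
  assumes "ultra U" "compact K" "eventually (\<lambda>x. f x \<in> K) U"
  shows "\<exists>l\<in>K. (f \<longlongrightarrow> l) U"
proof -
  have "filtermap f U \<noteq> bot" "filtermap f U \<le> principal K"
    using assms by (auto simp: ultra_def filtermap_bot_iff le_principal eventually_filtermap)
  then have "\<exists>l\<in>K. inf (nhds l) (filtermap f U) \<noteq> bot"
    using assms(2)[unfolded compact_filter, rule_format, of "filtermap f U"]
    by (simp add: le_principal)
  then obtain l where l: "l \<in> K" "inf (nhds l) (filtermap f U) \<noteq> bot"
    by blast
  have "eventually (\<lambda>x. f x \<in> S) U" if "open S" "l \<in> S" for S
  proof (rule ccontr)
    assume "\<not> ?thesis"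
    then have "eventually (\<lambda>x. f x \<notin> S) U" using ultra_not[OF assms(1)] by blast
    then have "eventually (\<lambda>y. y \<notin> S) (filtermap f U)" by (simp add: eventually_filtermap)
    moreover have "eventually (\<lambda>y. y \<in> S) (nhds l)" using that by (simp add: eventually_nhds) blast
    ultimately have "eventually (\<lambda>_. False) (inf (nhds l) (filtermap f U))"
      unfolding eventually_inf by (intro exI[of _ "\<lambda>y. y \<in> S"] exI[of _ "\<lambda>y. y \<notin> S"]) auto
    with l show False by simp
  qed
  then show ?thesis using l(1) by (intro bexI[of _ l]) (auto intro: topological_tendstoI)
qed

text \<open>A family of closed sets with the finite intersection property lies in an ultrafilter,
  whose limit belongs to all of them. This form suits the spaces below, where only limits of
  ultrafilters are at hand.\<close>

lemma compact_space_ultraI: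
  assumes "\<And>U. ultra U \<Longrightarrow> eventually (\<lambda>x. x \<in> topspace T) U \<Longrightarrow>
     \<exists>l\<in>topspace T. \<forall>W. openin T W \<longrightarrow> l \<in> W \<longrightarrow> eventually (\<lambda>x. x \<in> W) U"
  shows "compact_space T"
  unfolding compact_space_fip
proof (intro allI impI, elim conjE)
  fix \<C> assume cl: "\<forall>C\<in>\<C>. closedin T C" and fip: "\<forall>\<F>. finite \<F> \<and> \<F> \<subseteq> \<C> \<longrightarrow> \<Inter>\<F> \<noteq> {}"
  show "\<Inter>\<C> \<noteq> {}"
  proof (cases "\<C> = {}")
    case True then show ?thesis by simp
  next
    case False
    have "(INF C\<in>\<C>. principal C) \<noteq> bot"
    proof (rule INF_filter_not_bot)
      fix X assume "X \<subseteq> \<C>" "finite X"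
      then show "(INF b\<in>X. principal b) \<noteq> bot"
        using fip by (simp add: INF_principal_finite principal_eq_bot_iff)
    qed
    then obtain U where U: "U \<le> (INF C\<in>\<C>. principal C)" "ultra U" using ultra_exists by blast
    have inC: "eventually (\<lambda>x. x \<in> C) U" if "C \<in> \<C>" for C
    proof -
      have "U \<le> principal C" using U(1) INF_lower[OF that, of principal] by (rule order_trans)
      then show ?thesis by (simp add: le_principal)
    qed
    obtain C0 where "C0 \<in> \<C>" using False by blast
    then have "eventually (\<lambda>x. x \<in> topspace T) U"
      using inC[of C0] cl closedin_subset[of T C0] by (auto elim!: eventually_mono)
    then obtain l where l: "l \<in> topspace T" "\<And>W. openin T W \<Longrightarrow> l \<in> W \<Longrightarrow> eventually (\<lambda>x. x \<in> W) U"
      using assms[OF U(2)] by blast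
    have "l \<in> C" if "C \<in> \<C>" for C
    proof (rule ccontr)
      assume "l \<notin> C"
      then have "eventually (\<lambda>x. x \<in> topspace T - C) U"
        using l cl that by (intro l(2)) (auto simp: openin_diff)
      with inC[OF that] have "eventually (\<lambda>x. False) U" by eventually_elim auto
      with U(2) show False by (simp add: ultra_def)
    qed
    then show ?thesis by blast
  qed
qed

section \<open>Joint continuity, finite subcovers, shrinking and separation\<close>

lemma joint_continuity:
  fixes h :: "'a::topological_space \<Rightarrow> 'z \<Rightarrow> 'c::metric_space"
  assumes cont: "\<And>g. continuous_map Z euclidean (h g)"
    and unif: "\<And>g0 e. e > 0 \<Longrightarrow> eventually (\<lambda>g. \<forall>z\<in>topspace Z. dist (h g z) (h g0 z) < e) (nhds g0)"
  shows "continuous_map (prod_topology euclidean Z) euclidean (\<lambda>(g, z). h g z)"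
  unfolding continuous_map_eq_topcontinuous_at topcontinuous_at_def
proof (intro ballI conjI allI impI)
  fix p :: "'a \<times> 'z" assume p: "p \<in> topspace (prod_topology euclidean Z)"
  then obtain g0 z0 where p0: "p = (g0, z0)" "z0 \<in> topspace Z" by (cases p) auto
  show "p \<in> topspace (prod_topology euclidean Z)" by fact
  show "(\<lambda>(g, z). h g z) \<in> topspace (prod_topology euclidean Z) \<rightarrow> topspace (euclidean :: 'c topology)" by simp
  fix V :: "'c set" assume "openin euclidean V \<and> (case p of (g, z) \<Rightarrow> h g z) \<in> V"
  then obtain e where e: "e > 0" "ball (h g0 z0) e \<subseteq> V"
    using p0 by (metis (mono_tags, lifting) case_prod_conv open_contains_ball open_openin)
  obtain S where S: "open S" "g0 \<in> S" "\<And>g z. g \<in> S \<Longrightarrow> z \<in> topspace Z \<Longrightarrow> dist (h g z) (h g0 z) < e/2"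
    using unif[of "e/2" g0] e(1) unfolding eventually_nhds by auto
  let ?T = "{z \<in> topspace Z. h g0 z \<in> ball (h g0 z0) (e/2)}"
  have "openin Z ?T"
    using cont[of g0] openin_continuous_map_preimage[of Z euclidean "h g0" "ball (h g0 z0) (e/2)"] by simp
  moreover have "h g z \<in> V" if "g \<in> S" "z \<in> ?T" for g z
  proof -
    have "dist (h g0 z0) (h g z) < e"
      using S(3)[of g z] that dist_triangle_half_r[of "h g0 z" "h g0 z0" e "h g z"]
      by (auto simp: dist_commute)
    with e show ?thesis by auto
  qed
  ultimately show "\<exists>U. openin (prod_topology euclidean Z) U \<and> p \<in> U \<and> (\<forall>y\<in>U. (case y of (g, z) \<Rightarrow> h g z) \<in> V)"
    using S(1,2) e(1) p0
    by (intro exI[of _ "S \<times> ?T"]) (auto simp: openin_prod_Times_iff)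
qed

lemma compactin_finite_subcover:
  assumes "compactin T K" "\<And>z. z \<in> A \<Longrightarrow> openin T (W z)" "K \<subseteq> \<Union>(W ` A)"
  obtains E where "finite E" "E \<subseteq> A" "K \<subseteq> \<Union>(W ` E)"
proof -
  obtain \<F> where F: "finite \<F>" "\<F> \<subseteq> W ` A" "K \<subseteq> \<Union>\<F>"
    using compactinD[OF assms(1), of "W ` A"] assms(2,3) by auto
  from finite_subset_image[OF F(1,2)] obtain E where "E \<subseteq> A" "finite E" "\<F> = W ` E" by blast
  with F(3) that show thesis by blast
qed

text \<open>The last clause shrinks all covers at the same time: if some of the \<open>A v\<close>
  cover the space, one of them contains \<open>x\<close>, and then the corresponding
  \<open>K v\<close> contains \<open>y\<close>. The finite set \<open>D\<close> protects points that
  witness non-emptiness or distinctness.\<close>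

lemma shrink_finite:
  assumes Z: "compact_space Z" "Hausdorff_space Z"
    and V: "finite V" "\<And>v. v \<in> V \<Longrightarrow> openin Z (A v)"
    and D: "finite D" "D \<subseteq> topspace Z"
  shows "\<exists>K. (\<forall>v\<in>V. closedin Z (K v) \<and> K v \<subseteq> A v \<and> D \<inter> A v \<subseteq> K v) \<and>
    (\<forall>y\<in>topspace Z. \<exists>x\<in>topspace Z. \<forall>v\<in>V. x \<in> A v \<longrightarrow> y \<in> K v)"
proof -
  have reg: "regular_space Z" using Z compact_Hausdorff_imp_regular_space by blast
  have "\<exists>N C. openin Z N \<and> closedin Z C \<and> x \<in> N \<and> N \<subseteq> C \<and> (\<forall>v\<in>V. x \<in> A v \<longrightarrow> C \<subseteq> A v)"
    if x: "x \<in> topspace Z" for x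
  proof -
    let ?W = "topspace Z \<inter> \<Inter>{A v |v. v \<in> V \<and> x \<in> A v}"
    have "openin Z ?W"
      using V by (intro openin_Int_Inter) auto
    moreover have "x \<in> ?W" using x by auto
    ultimately obtain N C where "openin Z N" "closedin Z C" "x \<in> N" "N \<subseteq> C" "C \<subseteq> ?W"
      using reg[folded neighbourhood_base_of_closedin, unfolded neighbourhood_base_of, rule_format, of ?W x]
      by blast
    moreover from \<open>C \<subseteq> ?W\<close> have "\<forall>v\<in>V. x \<in> A v \<longrightarrow> C \<subseteq> A v" by blast
    ultimately show ?thesis by blast
  qed
  then obtain N C where NC: "\<And>x. x \<in> topspace Z \<Longrightarrow> openin Z (N x) \<and> closedin Z (C x) \<and> x \<in> N x \<and> N x \<subseteq> C x
      \<and> (\<forall>v\<in>V. x \<in> A v \<longrightarrow> C x \<subseteq> A v)"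
    by metis
  obtain E where E: "finite E" "E \<subseteq> topspace Z" "topspace Z \<subseteq> \<Union>(N ` E)"
  proof (rule compactin_finite_subcover[where T = Z and W = N and A = "topspace Z" and K = "topspace Z"])
    show "compactin Z (topspace Z)" using Z(1) by (simp add: compact_space_def)
    show "\<And>z. z \<in> topspace Z \<Longrightarrow> openin Z (N z)" using NC by blast
    show "topspace Z \<subseteq> \<Union>(N ` topspace Z)" using NC by blast
  qed
  define K where "K v = \<Union>{C x |x. x \<in> E \<union> D \<and> x \<in> A v}" for v
  show ?thesis
  proof (intro exI[of _ K] conjI ballI)
    fix v assume v: "v \<in> V"
    have "finite {C x |x. x \<in> E \<union> D \<and> x \<in> A v}" using E D by auto
    then show "closedin Z (K v)" unfolding K_def using NC E D by (intro closedin_Union) blast+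
    show "K v \<subseteq> A v" unfolding K_def using NC E D v by blast
    have "x \<in> K v" if "x \<in> D" "x \<in> A v" for x
      unfolding K_def using NC[of x] D that by blast
    then show "D \<inter> A v \<subseteq> K v" by blast
  next
    fix y assume "y \<in> topspace Z"
    then obtain x where x: "x \<in> E" "y \<in> N x" using E by blast
    then have "\<forall>v\<in>V. x \<in> A v \<longrightarrow> y \<in> K v" unfolding K_def using NC[of x] E by blast
    then show "\<exists>x\<in>topspace Z. \<forall>v\<in>V. x \<in> A v \<longrightarrow> y \<in> K v" using x E by blast
  qed
qed

text \<open>A lattice substitute for the Stone-Weierstrass theorem.\<close>

lemma lattice_separation:
  fixes I :: "'k set" and S :: "('k \<Rightarrow> 'b::topological_space) set"
  defines "T \<equiv> subtopology (product_topology (\<lambda>_. euclidean) I) S"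
  assumes comp: "compact_space T"
    and cont: "\<And>f. f \<in> \<F> \<Longrightarrow> continuous_map T euclideanreal f"
    and zero: "\<exists>f\<in>\<F>. \<forall>z\<in>topspace T. f z = 0"
    and one: "\<exists>f\<in>\<F>. \<forall>z\<in>topspace T. f z = 1"
    and max: "\<And>f h. f \<in> \<F> \<Longrightarrow> h \<in> \<F> \<Longrightarrow> \<exists>k\<in>\<F>. \<forall>z\<in>topspace T. k z = max (f z) (h z)"
    and min: "\<And>f h. f \<in> \<F> \<Longrightarrow> h \<in> \<F> \<Longrightarrow> \<exists>k\<in>\<F>. \<forall>z\<in>topspace T. k z = min (f z) (h z)"
    and dbl: "\<And>f. f \<in> \<F> \<Longrightarrow> \<exists>k\<in>\<F>. \<forall>z\<in>topspace T. k z = min 1 (2 * f z)"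
    and range: "\<And>f z. f \<in> \<F> \<Longrightarrow> z \<in> topspace T \<Longrightarrow> f z \<in> {0..1}"
    and bump: "\<And>k z W. k \<in> I \<Longrightarrow> z \<in> topspace T \<Longrightarrow> open W \<Longrightarrow> z k \<in> W \<Longrightarrow>
       \<exists>f\<in>\<F>. f z > 1/2 \<and> (\<forall>z'\<in>topspace T. z' k \<notin> W \<longrightarrow> f z' = 0)"
    and K: "closedin T K" and D: "openin T D" and KD: "K \<subseteq> D"
  shows "\<exists>f\<in>\<F>. (\<forall>z\<in>K. f z = 1) \<and> (\<forall>z\<in>topspace T - D. f z = 0)"
proof -
  \<comment> \<open>A basic neighborhood of \<open>z\<close> constrains finitely many coordinates;
    the minimum of their bumps vanishes off it.\<close>
  have loc: "\<exists>f\<in>\<F>. f z > 1/2 \<and> (\<forall>z'\<in>topspace T - D. f z' = 0)" if z: "z \<in> D" for z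
  proof -
    have zT: "z \<in> topspace T" using D z openin_subset by blast
    from D obtain D' where D': "openin (product_topology (\<lambda>_. euclidean) I) D'" "D = D' \<inter> S"
      unfolding T_def openin_subtopology by blast
    with z have "z \<in> D'" by blast
    with D'(1) obtain W where W: "finite {i \<in> I. W i \<noteq> UNIV}" "\<And>i. i \<in> I \<Longrightarrow> open (W i)"
        "z \<in> Pi\<^sub>E I W" "Pi\<^sub>E I W \<subseteq> D'"
      unfolding openin_product_topology_alt by (auto simp: )
    have "\<exists>f\<in>\<F>. f z > 1/2 \<and> (\<forall>z'\<in>topspace T. (\<exists>k\<in>J. z' k \<notin> W k) \<longrightarrow> f z' = 0)"
      if "finite J" "J \<subseteq> I" for J
      using that
    proof (induction J rule: finite_induct)
      case empty
      then show ?case using one zT by force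
    next
      case (insert k J)
      then obtain f where f: "f \<in> \<F>" "f z > 1/2" "\<forall>z'\<in>topspace T. (\<exists>k\<in>J. z' k \<notin> W k) \<longrightarrow> f z' = 0" by auto
      obtain h where h: "h \<in> \<F>" "h z > 1/2" "\<forall>z'\<in>topspace T. z' k \<notin> W k \<longrightarrow> h z' = 0"
        using bump[of k z "W k"] insert.prems zT W by (auto simp: PiE_iff)
      obtain l where l: "l \<in> \<F>" "\<forall>z\<in>topspace T. l z = min (f z) (h z)" using min[OF f(1) h(1)] by blast
      have "l z' = 0" if "z' \<in> topspace T" "\<exists>k\<in>insert k J. z' k \<notin> W k" for z'
        using that l(2) f h range[OF f(1) that(1)] range[OF h(1) that(1)] by (auto simp: min_def)
      then show ?case using l f h zT by (intro bexI[of _ l]) auto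
    qed
    from this[OF W(1)] obtain f where f: "f \<in> \<F>" "f z > 1/2"
        "\<And>z'. z' \<in> topspace T \<Longrightarrow> (\<exists>k\<in>{i \<in> I. W i \<noteq> UNIV}. z' k \<notin> W k) \<Longrightarrow> f z' = 0" by auto
    have "f z' = 0" if "z' \<in> topspace T - D" for z'
    proof (rule f(3))
      show "z' \<in> topspace T" using that by simp
      have "z' \<in> S" "z' \<in> extensional I" using that by (auto simp: T_def PiE_iff)
      with that D' W(4) have "z' \<notin> Pi\<^sub>E I W" by auto
      then obtain k where "k \<in> I" "z' k \<notin> W k" using \<open>z' \<in> extensional I\<close> by (auto simp: PiE_iff)
      then show "\<exists>k\<in>{i \<in> I. W i \<noteq> UNIV}. z' k \<notin> W k" by force
    qed
    with f show ?thesis by blast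
  qed
  then obtain F where F: "\<And>z. z \<in> D \<Longrightarrow> F z \<in> \<F> \<and> F z z > 1/2 \<and> (\<forall>z'\<in>topspace T - D. F z z' = 0)" by metis
  have KT: "K \<subseteq> topspace T" using K closedin_subset by blast
  have comK: "compactin T K" using K comp closedin_compact_space by blast
  let ?O = "\<lambda>z. {z'\<in>topspace T. F z z' \<in> {1/2<..}}"
  obtain E where E: "finite E" "E \<subseteq> K" "K \<subseteq> \<Union>(?O ` E)"
  proof (rule compactin_finite_subcover[OF comK])
    fix z assume "z \<in> K"
    then show "openin T (?O z)" using F KD cont openin_continuous_map_preimage[of T euclideanreal _ "{1/2<..}"] by auto
  next
    show "K \<subseteq> \<Union>(?O ` K)" using F KD KT by fastforce
  qed

  have "\<exists>f\<in>\<F>. (\<forall>z\<in>\<Union>(?O ` J). f z > 1/2) \<and> (\<forall>z\<in>topspace T - D. f z = 0)" if "finite J" "J \<subseteq> K" for J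
    using that
  proof (induction J rule: finite_induct)
    case empty
    then show ?case using zero by auto
  next
    case (insert y J)
    then obtain f where f: "f \<in> \<F>" "\<forall>z\<in>\<Union>(?O ` J). f z > 1/2" "\<forall>z\<in>topspace T - D. f z = 0" by auto
    have y: "F y \<in> \<F>" "\<forall>z'\<in>topspace T - D. F y z' = 0" using F insert.prems KD by auto
    obtain l where l: "l \<in> \<F>" "\<forall>z\<in>topspace T. l z = max (f z) (F y z)" using max[OF f(1) y(1)] by blast
    show ?case
    proof (intro bexI[OF _ l(1)] conjI ballI)
      fix z assume "z \<in> \<Union>(?O ` insert y J)"
      then show "l z > 1/2" using l(2) f(2) by fastforce
    next
      fix z assume "z \<in> topspace T - D"
      then show "l z = 0" using l(2) f(3) y(2) by simp
    qed
  qed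
  from this[OF E(1,2)] obtain f where f: "f \<in> \<F>" "\<forall>z\<in>\<Union>(?O ` E). f z > 1/2" "\<forall>z\<in>topspace T - D. f z = 0" by blast
  \<comment> \<open>The finite maximum exceeds 1/2 on \<open>K\<close>; doubling and cutting off at
    1 makes it exactly 1 there and keeps the zeros.\<close>
  obtain l where l: "l \<in> \<F>" "\<forall>z\<in>topspace T. l z = min 1 (2 * f z)" using dbl[OF f(1)] by blast
  have "l z = 1" if "z \<in> K" for z
  proof -
    have "z \<in> \<Union>(?O ` E)" using that E(3) by blast
    then have "f z > 1/2" using f(2) by blast
    then show ?thesis using l(2) KT that by auto
  qed
  then show ?thesis using l f(3) by (intro bexI[of _ l]) auto
qed

subsection \<open>Flows and functional realizations\<close>

text \<open>\<open>\<N>\<^sub>0\<close> and \<open>G\<^sub>0\<close> can be chosen countable when \<open>G\<close> is separable and metrizable; this is only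
  needed for metrizability.\<close>

locale lrpc_setup =
  fixes \<N> :: "'g::topological_group_add set set"
    and \<N>\<^sub>0 :: "'g set set" and G\<^sub>0 :: "'g set" and \<zeta> :: "'g set \<Rightarrow> 'g \<Rightarrow> real"
  assumes base: "symmetric_open_base \<N>"
    and N0_sub: "\<N>\<^sub>0 \<subseteq> N_RPC \<N>"
    and N0_base: "\<And>V. open V \<Longrightarrow> 0 \<in> V \<Longrightarrow> \<exists>W\<in>\<N>\<^sub>0. W \<subseteq> V"
    and G0_dense: "\<And>V. open V \<Longrightarrow> V \<noteq> {} \<Longrightarrow> \<exists>g\<in>G\<^sub>0. g \<in> V"
    and G0_zero: "0 \<in> G\<^sub>0"
    and zeta: "\<zeta> \<in> N_RPC \<N> \<rightarrow> SN_RPC \<N>"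
begin

section \<open>Small neighborhoods and Roelcke covers\<close>

lemma N_RPC_D:
  assumes "W \<in> N_RPC \<N>"
  shows "W \<in> \<N>" "open W" "0 \<in> W" "a \<in> W \<Longrightarrow> - a \<in> W" "RPC \<N> W"
proof -
  show W: "W \<in> \<N>" "RPC \<N> W" using assms by (auto simp: N_RPC_def)
  then show "open W" "0 \<in> W" "a \<in> W \<Longrightarrow> - a \<in> W"
    using base unfolding symmetric_open_base_def by blast+
qed

lemma N0_D:
  assumes "W \<in> \<N>\<^sub>0"
  shows "W \<in> N_RPC \<N>" "open W" "0 \<in> W" "a \<in> W \<Longrightarrow> - a \<in> W"
  using assms N0_sub N_RPC_D by blast+

lemma N0_add:
  assumes "open V" "0 \<in> V"
  shows "\<exists>W\<in>\<N>\<^sub>0. \<forall>a\<in>W. \<forall>b\<in>W. a + b \<in> V"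
proof -
  have "filterlim (\<lambda>x. fst x + snd x) (nhds (0 + 0 :: 'g)) (nhds 0 \<times>\<^sub>F nhds 0)"
    by (rule tendsto_add_Pair)
  then have "eventually (\<lambda>x. fst x + snd x \<in> V) (nhds (0::'g) \<times>\<^sub>F nhds 0)"
    using eventually_nhds_in_open[OF assms] by (simp add: filterlim_iff[THEN iffD1, rule_format, of _ _ _ "\<lambda>y. y \<in> V"])
  then obtain P Q where PQ: "eventually P (nhds (0::'g))" "eventually Q (nhds (0::'g))"
      "\<And>x y. P x \<Longrightarrow> Q y \<Longrightarrow> x + y \<in> V"
    unfolding eventually_prod_filter by auto
  obtain A B where AB: "open A" "0 \<in> A" "\<forall>x\<in>A. P x" "open B" "0 \<in> B" "\<forall>x\<in>B. Q x"
    using PQ(1,2) unfolding eventually_nhds by blast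
  then obtain W where "W \<in> \<N>\<^sub>0" "W \<subseteq> A \<inter> B" using N0_base[of "A \<inter> B"] by (auto intro: open_Int)
  with PQ(3) AB(3,6) show ?thesis by blast
qed

lemma open_conj:
  assumes "open V"
  shows "open {x::'g. g + x + h \<in> V}"
proof -
  have "continuous_on UNIV (\<lambda>x. g + x + h)"
    by (intro continuous_intros)
  from open_vimage[OF assms this] show ?thesis by (simp add: vimage_def)
qed

text \<open>The first property replaces \<open>u + g\<close> by one of finitely many
  \<open>f\<close>. The second says that each \<open>f\<close> is itself near some
  \<open>u + g\<close> with \<open>u \<in> U\<close>, so that what is known about \<open>U\<close>
  can be applied to \<open>f\<close>. The elements of the Roelcke cover that do not come near
  \<open>U\<close> are discarded for this purpose, and the others are moved into
  \<open>G\<^sub>0\<close> by density.\<close>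

lemma RPC_cover:
  assumes U: "U \<in> N_RPC \<N>" and W: "W \<in> \<N>\<^sub>0" and V0: "open V\<^sub>0" "0 \<in> V\<^sub>0"
  shows "\<exists>F. finite F \<and> F \<subseteq> G\<^sub>0 \<and> (\<forall>u\<in>U. \<exists>a\<in>W. \<exists>f\<in>F. \<exists>b\<in>W. u + g = a + f + b) \<and>
    (\<forall>f\<in>F. \<exists>a\<in>V\<^sub>0. \<exists>u\<in>U. \<exists>b\<in>V\<^sub>0. f = a + u + g + b)"
proof -
  obtain V1 where V1: "V1 \<in> \<N>\<^sub>0" "\<And>a b. a \<in> V1 \<Longrightarrow> b \<in> V1 \<Longrightarrow> a + b \<in> W \<inter> V\<^sub>0"
    using N0_add[of "W \<inter> V\<^sub>0"] V0 N0_D[OF W] by (metis IntI open_Int)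
  \<comment> \<open>Moving the right error \<open>b\<close> past \<open>g\<close> turns it into its
    conjugate \<open>- g + b + g\<close>, which has to be small as well.\<close>
  let ?C = "{x. - g + x + g \<in> V1}"
  have C: "open ?C" "0 \<in> ?C" using open_conj N0_D[OF V1(1)] by auto
  obtain V where V: "V \<in> \<N>\<^sub>0" "V \<subseteq> V1 \<inter> ?C"
    using N0_base[of "V1 \<inter> ?C"] C N0_D[OF V1(1)] by (metis IntI open_Int)
  have "V \<in> \<N>" "RPC \<N> U" using N_RPC_D[OF U] N_RPC_D[OF N0_D(1)[OF V(1)]] by auto
  then obtain F where F: "finite F" "U \<subseteq> V + F + V" unfolding RPC_def by blast
  define F1 where "F1 = {f \<in> F. \<exists>a\<in>V. \<exists>b\<in>V. a + f + b \<in> U}"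
  have V_V0: "V1 \<subseteq> V\<^sub>0" using V1(2)[of _ 0] N0_D(3)[OF V1(1)] by auto
  have "\<exists>f0\<in>G\<^sub>0. - f0 + (f + g) \<in> V1" for f
  proof -

    have "open {x. - (f + g) + x + 0 \<in> V1}" by (rule open_conj) (rule N0_D[OF V1(1)])
    moreover have "f + g \<in> {x. - (f + g) + x + 0 \<in> V1}" using N0_D(3)[OF V1(1)] by simp
    ultimately have "\<exists>f0\<in>G\<^sub>0. f0 \<in> {x. - (f + g) + x + 0 \<in> V1}" by (intro G0_dense) blast+
    then obtain f0 where "f0 \<in> G\<^sub>0" "- (f + g) + f0 \<in> V1" by auto
    then have "- (- (f + g) + f0) \<in> V1" using N0_D(4)[OF V1(1)] by blast
    then have "- f0 + (f + g) \<in> V1" by (simp add: minus_add)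
    then show ?thesis using \<open>f0 \<in> G\<^sub>0\<close> by blast
  qed
  then obtain r where r: "\<And>f. r f \<in> G\<^sub>0" "\<And>f. - r f + (f + g) \<in> V1" by metis
  show ?thesis
  proof (intro exI conjI ballI)
    show "finite (r ` F1)" using F by (simp add: F1_def)
    show "r ` F1 \<subseteq> G\<^sub>0" using r by auto
  next
    fix u assume u: "u \<in> U"
    then obtain a f b where afb: "a \<in> V" "f \<in> F" "b \<in> V" "u = a + f + b"
      using F(2) by (auto simp: set_plus_def)
    then have "f \<in> F1" using u unfolding F1_def by blast
    moreover have "a \<in> W" using V1(2)[of a 0] afb(1) V(2) N0_D(3)[OF V1(1)] by auto
    moreover have "(- r f + (f + g)) + (- g + b + g) \<in> W" using V1(2) r(2) afb(3) V(2) by blast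
    moreover have "u + g = a + r f + ((- r f + (f + g)) + (- g + b + g))"
      by (simp add: afb(4) add.assoc)
    ultimately show "\<exists>a\<in>W. \<exists>f\<in>r ` F1. \<exists>b\<in>W. u + g = a + f + b" by blast
  next
    fix f0 assume "f0 \<in> r ` F1"
    then obtain f a b where f: "f0 = r f" "a \<in> V" "b \<in> V" "a + f + b \<in> U" unfolding F1_def by blast
    have "- a \<in> V\<^sub>0" using N0_D(4)[OF V(1) f(2)] V(2) V_V0 by blast
    moreover have "- g + - b + g \<in> V1" using N0_D(4)[OF V(1) f(3)] V(2) by blast
    then have "(- g + - b + g) + - (- r f + (f + g)) \<in> V\<^sub>0"
      using V1(2) r(2)[of f] N0_D(4)[OF V1(1)] by blast
    moreover have "f0 = - a + (a + f + b) + g + ((- g + - b + g) + - (- r f + (f + g)))"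
      by (simp add: f(1) add.assoc minus_add diff_conv_add_uminus del: add_uminus_conv_diff)
    ultimately show "\<exists>a\<in>V\<^sub>0. \<exists>u\<in>U. \<exists>b\<in>V\<^sub>0. f0 = a + u + g + b" using f(4) by blast
  qed
qed

end

section \<open>Actions of flows and the relations \<open>R_rel\<close>\<close>

lemma gflowD:
  assumes "gflow X"
  shows "compact_space (topol X)" "Hausdorff_space (topol X)"
    "x \<in> pts X \<Longrightarrow> act X 0 x = x"
    "x \<in> pts X \<Longrightarrow> act X (g + h) x = act X g (act X h x)"
    "continuous_map (prod_topology euclidean (topol X)) (topol X) (\<lambda>(g, x). act X g x)"
  using assms unfolding gflow_def by auto

lemma act_in:
  assumes "gflow X" "x \<in> pts X"
  shows "act X g x \<in> pts X"
  using continuous_map_image_subset_topspace[OF gflowD(5)[OF assms(1)]] assms(2)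
  by (force simp: image_subset_iff)

lemma act_minus:
  assumes "gflow X" "x \<in> pts X"
  shows "act X (- g) (act X g x) = x" "act X g (act X (- g) x) = x"
  using gflowD(4)[OF assms, of "- g" g] gflowD(4)[OF assms, of g "- g"] gflowD(3)[OF assms] by simp_all

lemma act_continuous:
  assumes "gflow X"
  shows "continuous_map (topol X) (topol X) (act X g)"
proof -
  have "continuous_map (topol X) (prod_topology euclidean (topol X)) (\<lambda>x. (g, x))"
    by (intro continuous_map_pairedI continuous_map_const[THEN iffD2] continuous_map_id[unfolded id_def]) auto
  from continuous_map_compose[OF this gflowD(5)[OF assms]] show ?thesis by (simp add: o_def)
qed

lemma compose_act_continuous:
  assumes "gflow X" "continuous_map (topol X) T f"
  shows "continuous_map (topol X) T (\<lambda>x. f (act X g x))"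
  using continuous_map_compose[OF act_continuous[OF assms(1)] assms(2)] by (simp add: o_def)

text \<open>The tube lemma around \<open>pts X \<times> {0}\<close>: compactness makes the
  neighborhood of the identity independent of the point.\<close>

lemma flow_equicontinuous:
  fixes X :: "('g::topological_group_add, 'x) gspace" and f :: "'x \<Rightarrow> real"
  assumes X: "gflow X" and f: "continuous_map (topol X) euclideanreal f" and e: "e > 0"
  shows "\<exists>V. open V \<and> 0 \<in> V \<and> (\<forall>a\<in>V. \<forall>x\<in>pts X. \<bar>f (act X a x) - f x\<bar> < e)"
proof -
  let ?T = "prod_topology (topol X) (euclidean :: 'g topology)"
  have sw: "continuous_map ?T (prod_topology euclidean (topol X)) (\<lambda>(x, g). (g, x))"
    unfolding case_prod_unfold by (intro continuous_map_pairedI continuous_map_fst continuous_map_snd)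
  have "continuous_map ?T euclideanreal (f \<circ> ((\<lambda>(g, x). act X g x) \<circ> (\<lambda>(x, g). (g, x))))"
    by (intro continuous_map_compose[OF _ f] continuous_map_compose[OF sw] gflowD(5)[OF X])
  moreover have "continuous_map ?T euclideanreal (f \<circ> fst)"
    by (intro continuous_map_compose[OF _ f] continuous_map_fst)
  ultimately have c: "continuous_map ?T euclideanreal (\<lambda>p. (f \<circ> ((\<lambda>(g, x). act X g x) \<circ> (\<lambda>(x, g). (g, x)))) p - (f \<circ> fst) p)"
    by (rule continuous_map_diff)
  let ?W = "{p \<in> topspace ?T. (f \<circ> ((\<lambda>(g, x). act X g x) \<circ> (\<lambda>(x, g). (g, x)))) p - (f \<circ> fst) p \<in> {- e <..< e}}"
  have W: "openin ?T ?W" using openin_continuous_map_preimage[OF c, of "{- e<..<e}"] by simp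
  have "\<exists>U V. openin (topol X) U \<and> openin (euclidean :: 'g topology) V \<and> pts X \<subseteq> U \<and> 0 \<in> V \<and> U \<times> V \<subseteq> ?W"
  proof (rule tube_lemma_left[OF W])
    show "compactin (topol X) (pts X)" using gflowD(1)[OF X] by (simp add: compact_space_def)
    show "pts X \<times> {0} \<subseteq> ?W" using gflowD(3)[OF X] e by auto
  qed simp
  then obtain U V where UV: "open V" "0 \<in> V" "pts X \<subseteq> U" "U \<times> V \<subseteq> ?W" by auto
  have "\<bar>f (act X a x) - f x\<bar> < e" if "a \<in> V" "x \<in> pts X" for a x
  proof -
    have "(x, a) \<in> ?W" using UV(3,4) that by blast
    then show ?thesis by auto
  qed
  with UV(1,2) show ?thesis by blast
qed

lemma R_rel_subset: "(a, b) \<in> R_rel X U \<Longrightarrow> a \<in> pts X \<and> b \<in> pts X"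
  using closure_of_subset_topspace[of "prod_topology (topol X) (topol X)"] unfolding R_rel_def by fastforce

lemma R_relI:
  assumes "gflow X" "x \<in> pts X" "u \<in> U"
  shows "(x, act X u x) \<in> R_rel X U"
proof -
  have "{(x, act X g x) |x g. x \<in> pts X \<and> g \<in> U} \<subseteq> topspace (prod_topology (topol X) (topol X))"
    using act_in[OF assms(1)] by auto
  from closure_of_subset[OF this] show ?thesis using assms(2,3) unfolding R_rel_def by blast
qed

text \<open>Strict inequalities are open conditions, so they pass from a point of the closure to an
  actual pair \<open>(x, act X u x)\<close>. The weakened conclusion never mentions closures, which
  is why edges can be handled by functions.\<close>

lemma R_rel_approx:
  fixes f h :: "'x \<Rightarrow> real"
  assumes "(a, b) \<in> R_rel X U" "continuous_map (topol X) euclideanreal f"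
    "continuous_map (topol X) euclideanreal h" "f a > s" "h b > t"
  shows "\<exists>x\<in>pts X. \<exists>u\<in>U. f x > s \<and> h (act X u x) > t"
proof -
  let ?A = "{x \<in> pts X. f x \<in> {s<..}}" and ?B = "{x \<in> pts X. h x \<in> {t<..}}"
  have "openin (prod_topology (topol X) (topol X)) (?A \<times> ?B)"
    unfolding openin_prod_Times_iff
    using openin_continuous_map_preimage[OF assms(2), of "{s<..}"] openin_continuous_map_preimage[OF assms(3), of "{t<..}"]
    by simp
  moreover have "(a, b) \<in> ?A \<times> ?B" using R_rel_subset[OF assms(1)] assms(4,5) by auto
  moreover have "\<And>T. (a, b) \<in> T \<and> openin (prod_topology (topol X) (topol X)) T \<Longrightarrow>
      \<exists>y. y \<in> {(x, act X g x) |x g. x \<in> pts X \<and> g \<in> U} \<and> y \<in> T"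
    using assms(1) unfolding R_rel_def in_closure_of by blast
  ultimately obtain y where "y \<in> {(x, act X g x) |x g. x \<in> pts X \<and> g \<in> U}" "y \<in> ?A \<times> ?B" by meson
  then show ?thesis by auto
qed

lemma R_rel_separation:
  assumes X: "gflow X" and K: "closedin (topol X) K" and L: "closedin (topol X) L"
    and KL: "K \<times> L \<inter> R_rel X U = {}"
  shows "\<exists>D D'. openin (topol X) D \<and> openin (topol X) D' \<and> K \<subseteq> D \<and> L \<subseteq> D' \<and> D \<times> D' \<inter> R_rel X U = {}"
proof -
  let ?T = "prod_topology (topol X) (topol X)"
  have "closedin ?T (R_rel X U)" unfolding R_rel_def by (rule closedin_closure_of)
  then have op: "openin ?T (topspace ?T - R_rel X U)" by (rule openin_diff[OF openin_topspace])
  have sub: "K \<times> L \<subseteq> topspace ?T - R_rel X U" using KL closedin_subset[OF K] closedin_subset[OF L] by auto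
  have "compactin (topol X) K" "compactin (topol X) L"
    using K L closedin_compact_space[OF gflowD(1)[OF X]] by auto
  from Wallace_theorem_prod_topology[OF this op sub] obtain D D' where "openin (topol X) D" "openin (topol X) D'"
      "K \<subseteq> D" "L \<subseteq> D'" "D \<times> D' \<subseteq> topspace ?T - R_rel X U" by auto
  then show ?thesis by (intro exI[of _ D] exI[of _ D']) auto
qed

lemma closure_ge:
  fixes f :: "'x \<Rightarrow> real"
  assumes "continuous_map T euclideanreal f" "\<And>x. x \<in> S \<Longrightarrow> f x \<ge> t" "S \<subseteq> topspace T" "a \<in> T closure_of S"
  shows "f a \<ge> t"
proof -
  have "closedin T {x \<in> topspace T. f x \<in> {t..}}"
    using closedin_continuous_map_preimage[OF assms(1), of "{t..}"] by simp
  then have "T closure_of S \<subseteq> {x \<in> topspace T. f x \<in> {t..}}"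
    using assms(2,3) by (intro closure_of_minimal) auto
  then show ?thesis using assms(4) by auto
qed

text \<open>Both predicates say that the sets \<open>{x. f v x > 1/2}\<close> realize a structure with vertex set \<open>V\<close>,
  edges \<open>E\<close> and covers \<open>C\<close>. Every realization can be brought into the form \<open>sdata\<close>, whose extreme
  values leave room for perturbations; \<open>wdata\<close> suffices for a realization.\<close>

definition sdata ::
    "('g::topological_group_add, 'x) gspace \<Rightarrow> nat set \<Rightarrow> ('g \<times> 'g set \<times> nat \<times> nat) set \<Rightarrow> nat set set \<Rightarrow>
     (nat \<Rightarrow> 'x \<Rightarrow> real) \<Rightarrow> bool" where
  "sdata X V E C f \<longleftrightarrow>
     (\<forall>v\<in>V. continuous_map (topol X) euclideanreal (f v) \<and> (\<forall>x\<in>pts X. f v x \<in> {0..1})) \<and>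
     (\<forall>v\<in>V. \<exists>x\<in>pts X. f v x = 1) \<and>
     (\<forall>v\<in>V. \<forall>w\<in>V. v \<noteq> w \<longrightarrow> (\<exists>x\<in>pts X. f v x = 1 \<and> f w x = 0 \<or> f w x = 1 \<and> f v x = 0)) \<and>
     (\<forall>c\<in>C. \<forall>x\<in>pts X. \<exists>v\<in>c. f v x = 1) \<and>
     (\<forall>(g, U, v, w)\<in>E. \<forall>x\<in>pts X. \<forall>u\<in>U. \<not> (f v x > 0 \<and> f w (act X (u + g) x) > 0))"

definition wdata ::
    "('g::topological_group_add, 'x) gspace \<Rightarrow> nat set \<Rightarrow> ('g \<times> 'g set \<times> nat \<times> nat) set \<Rightarrow> nat set set \<Rightarrow>
     (nat \<Rightarrow> 'x \<Rightarrow> real) \<Rightarrow> bool" where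
  "wdata X V E C f \<longleftrightarrow>
     (\<forall>v\<in>V. continuous_map (topol X) euclideanreal (f v)) \<and>
     (\<forall>v\<in>V. \<exists>x\<in>pts X. f v x > 1/2) \<and>
     (\<forall>v\<in>V. \<forall>w\<in>V. v \<noteq> w \<longrightarrow> (\<exists>x\<in>pts X. f v x > 1/2 \<and> f w x \<le> 1/2 \<or> f w x > 1/2 \<and> f v x \<le> 1/2)) \<and>
     (\<forall>c\<in>C. \<forall>x\<in>pts X. \<exists>v\<in>c. f v x > 1/2) \<and>
     (\<forall>(g, U, v, w)\<in>E. \<forall>x\<in>pts X. \<forall>u\<in>U. \<not> (f v x > 1/4 \<and> f w (act X (u + g) x) > 1/4))"

lemma sdataD:
  assumes "sdata X V E C f"
  shows "v \<in> V \<Longrightarrow> continuous_map (topol X) euclideanreal (f v)"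
    "v \<in> V \<Longrightarrow> x \<in> pts X \<Longrightarrow> f v x \<in> {0..1}"
    "v \<in> V \<Longrightarrow> \<exists>x\<in>pts X. f v x = 1"
    "v \<in> V \<Longrightarrow> w \<in> V \<Longrightarrow> v \<noteq> w \<Longrightarrow> \<exists>x\<in>pts X. f v x = 1 \<and> f w x = 0 \<or> f w x = 1 \<and> f v x = 0"
    "c \<in> C \<Longrightarrow> x \<in> pts X \<Longrightarrow> \<exists>v\<in>c. f v x = 1"
    "(g, U, v, w) \<in> E \<Longrightarrow> x \<in> pts X \<Longrightarrow> u \<in> U \<Longrightarrow> \<not> (f v x > 0 \<and> f w (act X (u + g) x) > 0)"
proof -
  note a = assms[unfolded sdata_def]
  note a1 = conjunct1[OF a] note b1 = conjunct2[OF a]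
  note a2 = conjunct1[OF b1] note b2 = conjunct2[OF b1]
  note a3 = conjunct1[OF b2] note b3 = conjunct2[OF b2]
  note a4 = conjunct1[OF b3] note a5 = conjunct2[OF b3]
  show "v \<in> V \<Longrightarrow> continuous_map (topol X) euclideanreal (f v)" using a1 by blast
  show "v \<in> V \<Longrightarrow> x \<in> pts X \<Longrightarrow> f v x \<in> {0..1}" using a1 by blast
  show "v \<in> V \<Longrightarrow> \<exists>x\<in>pts X. f v x = 1" using a2 by blast
  show "v \<in> V \<Longrightarrow> w \<in> V \<Longrightarrow> v \<noteq> w \<Longrightarrow> \<exists>x\<in>pts X. f v x = 1 \<and> f w x = 0 \<or> f w x = 1 \<and> f v x = 0"
    using a3 by blast
  show "c \<in> C \<Longrightarrow> x \<in> pts X \<Longrightarrow> \<exists>v\<in>c. f v x = 1" using a4 by blast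
  show "(g, U, v, w) \<in> E \<Longrightarrow> x \<in> pts X \<Longrightarrow> u \<in> U \<Longrightarrow> \<not> (f v x > 0 \<and> f w (act X (u + g) x) > 0)"
    using a5 by blast
qed

lemma wdataD:
  assumes "wdata X V E C f"
  shows "v \<in> V \<Longrightarrow> continuous_map (topol X) euclideanreal (f v)"
    "v \<in> V \<Longrightarrow> \<exists>x\<in>pts X. f v x > 1/2"
    "v \<in> V \<Longrightarrow> w \<in> V \<Longrightarrow> v \<noteq> w \<Longrightarrow>
       \<exists>x\<in>pts X. f v x > 1/2 \<and> f w x \<le> 1/2 \<or> f w x > 1/2 \<and> f v x \<le> 1/2"
    "c \<in> C \<Longrightarrow> x \<in> pts X \<Longrightarrow> \<exists>v\<in>c. f v x > 1/2"
    "(g, U, v, w) \<in> E \<Longrightarrow> x \<in> pts X \<Longrightarrow> u \<in> U \<Longrightarrow> \<not> (f v x > 1/4 \<and> f w (act X (u + g) x) > 1/4)"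
proof -
  note a = assms[unfolded wdata_def]
  note a1 = conjunct1[OF a] note b1 = conjunct2[OF a]
  note a2 = conjunct1[OF b1] note b2 = conjunct2[OF b1]
  note a3 = conjunct1[OF b2] note b3 = conjunct2[OF b2]
  note a4 = conjunct1[OF b3] note a5 = conjunct2[OF b3]
  show "v \<in> V \<Longrightarrow> continuous_map (topol X) euclideanreal (f v)" using a1 by blast
  show "v \<in> V \<Longrightarrow> \<exists>x\<in>pts X. f v x > 1/2" using a2 by blast
  show "v \<in> V \<Longrightarrow> w \<in> V \<Longrightarrow> v \<noteq> w \<Longrightarrow>
       \<exists>x\<in>pts X. f v x > 1/2 \<and> f w x \<le> 1/2 \<or> f w x > 1/2 \<and> f v x \<le> 1/2"
    using a3 by blast
  show "c \<in> C \<Longrightarrow> x \<in> pts X \<Longrightarrow> \<exists>v\<in>c. f v x > 1/2" using a4 by blast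
  show "(g, U, v, w) \<in> E \<Longrightarrow> x \<in> pts X \<Longrightarrow> u \<in> U \<Longrightarrow> \<not> (f v x > 1/4 \<and> f w (act X (u + g) x) > 1/4)"
    using a5 by blast
qed

lemma sdata_imp_wdata: "sdata X V E C f \<Longrightarrow> wdata X V E C f"
proof -
  assume s: "sdata X V E C f"
  have w2: "\<exists>x\<in>pts X. f v x > 1/2" if h: "v \<in> V" for v
  proof -
    obtain x where "x \<in> pts X" "f v x = 1" using sdataD(3)[OF s h] by blast
    then show ?thesis by (intro bexI[of _ x]) auto
  qed
  have w3: "\<exists>x\<in>pts X. f v x > 1/2 \<and> f w x \<le> 1/2 \<or> f w x > 1/2 \<and> f v x \<le> 1/2"
    if vw: "v \<in> V" "w \<in> V" "v \<noteq> w" for v w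
  proof -
    obtain x where "x \<in> pts X" "f v x = 1 \<and> f w x = 0 \<or> f w x = 1 \<and> f v x = 0"
      using sdataD(4)[OF s vw] by blast
    then show ?thesis by (intro bexI[of _ x]) auto
  qed
  have w4: "\<exists>v\<in>c. f v x > 1/2" if cx: "c \<in> C" "x \<in> pts X" for c x
  proof -
    obtain v where "v \<in> c" "f v x = 1" using sdataD(5)[OF s cx] by blast
    then show ?thesis by (intro bexI[of _ v]) auto
  qed
  have w5: "\<not> (f v x > 1/4 \<and> f w (act X (u + g) x) > 1/4)"
    if h: "(g, U, v, w) \<in> E" "x \<in> pts X" "u \<in> U" for g U v w x u
    using sdataD(6)[OF s h] by linarith
  show ?thesis
    unfolding wdata_def
  proof (intro conjI ballI impI)
    fix p x assume "p \<in> E"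
    then show "case p of (g, U, v, w) \<Rightarrow> \<forall>x\<in>pts X. \<forall>u\<in>U. \<not> (f v x > 1/4 \<and> f w (act X (u + g) x) > 1/4)"
      using w5 by (cases p) simp
  qed (fact sdataD(1)[OF s] w2 w3 w4)+
qed

section \<open>Realizations by open sets versus realizations by functions\<close>

definition edges_of :: "('g, nat) relstr \<Rightarrow> ('g \<times> 'g set \<times> nat \<times> nat) set" where
  "edges_of M = {(g, U, v, w). [v, w] \<in> interp M (Edge g U)}"

definition covers_of :: "('g, nat) relstr \<Rightarrow> nat set set" where
  "covers_of M = {set xs |xs. \<exists>n\<ge>1. xs \<in> interp M (Cover n)}"

lemma Str_interp:
  assumes "M \<in> Str F N" "xs \<in> interp M s"
  shows "s \<in> language F N" "length xs = arity s" "set xs \<subseteq> verts M"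
  using assms unfolding Str_def by blast+

lemma StrE_edge:
  assumes "M \<in> Str F N" "(g, U, v, w) \<in> edges_of M"
  shows "g \<in> F" "U \<in> N" "v \<in> verts M" "w \<in> verts M"
  using Str_interp[OF assms(1), of "[v, w]" "Edge g U"] assms(2) by (auto simp: edges_of_def language_def)

lemma StrE_cover:
  assumes "M \<in> Str F N" "c \<in> covers_of M"
  shows "c \<subseteq> verts M"
  using Str_interp(3)[OF assms(1)] assms(2) unfolding covers_of_def by blast

lemma Str_finite:
  assumes "M \<in> Str F N" "finite F" "finite N"
  shows "finite (verts M)" "finite (edges_of M)" "finite (covers_of M)"
proof -
  show fin: "finite (verts M)" using assms(1) by (auto simp: Str_def)
  have "edges_of M \<subseteq> F \<times> N \<times> verts M \<times> verts M" using StrE_edge[OF assms(1)] by auto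
  then show "finite (edges_of M)" using fin assms by (meson finite_SigmaI finite_subset)
  have "covers_of M \<subseteq> Pow (verts M)" using StrE_cover[OF assms(1)] by auto
  then show "finite (covers_of M)" using fin by (meson finite_Pow_iff finite_subset)
qed

text \<open>The vertices are the sets where \<open>f v\<close> exceeds 1/2. On their closures the
  value is still at least 1/2, and a pair in the closed relation is approximated by actual pairs
  with values above 1/4, which the edge condition of \<open>wdata\<close> forbids.\<close>

lemma realizes_of_wdata:
  fixes X :: "('g::topological_group_add, 'x) gspace"
  assumes X: "gflow X" and M: "M \<in> Str F N" and f: "wdata X (verts M) (edges_of M) (covers_of M) f"
  shows "realizes X F N M"
proof -
  define e where "e v = {x \<in> pts X. f v x \<in> {1/2<..}}" for v
  have fc: "continuous_map (topol X) euclideanreal (f v)" if "v \<in> verts M" for v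
    using wdataD(1)[OF f that] .
  have op: "openin (topol X) (e v)" if "v \<in> verts M" for v
    unfolding e_def using openin_continuous_map_preimage[OF fc[OF that], of "{1/2<..}"] by simp
  have ne: "e v \<noteq> {}" if "v \<in> verts M" for v
    using wdataD(2)[OF f that] unfolding e_def by auto
  have inj: "inj_on e (verts M)"
  proof (rule inj_onI, rule ccontr)
    fix v w assume "v \<in> verts M" "w \<in> verts M" "e v = e w" "v \<noteq> w"
    then obtain x where "x \<in> pts X" "f v x > 1/2 \<and> f w x \<le> 1/2 \<or> f w x > 1/2 \<and> f v x \<le> 1/2"
      using wdataD(3)[OF f] by blast
    then have "x \<in> e v \<longleftrightarrow> x \<notin> e w" unfolding e_def by auto
    with \<open>e v = e w\<close> show False by simp
  qed
  have rel: "map e xs \<in> interp (Str_of X (e ` verts M) F N) s" if s: "s \<in> language F N" and xs: "xs \<in> interp M s" for s xs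
  proof (cases s)
    case (Edge g U)
    obtain v w where vw: "xs = [v, w]" "v \<in> verts M" "w \<in> verts M"
      using Str_interp[OF M xs] Edge by (auto simp: length_Suc_conv numeral_2_eq_2)
    have edge: "\<not> (f v x > 1/4 \<and> f w (act X (u + g) x) > 1/4)" if "x \<in> pts X" "u \<in> U" for x u
  proof -
    have "(g, U, v, w) \<in> edges_of M" using xs by (simp add: edges_of_def vw(1) Edge)
    from wdataD(5)[OF f this that] show ?thesis .
  qed
    have "(a, b) \<notin> R_rel X U" if a: "a \<in> topol X closure_of (act X g ` e v)" and b: "b \<in> topol X closure_of e w" for a b
    proof
      assume ab: "(a, b) \<in> R_rel X U"
      have "f v (act X (- g) a) \<ge> 1/2"
        by (rule closure_ge[OF compose_act_continuous[OF X fc[OF vw(2)]] _ _ a])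
          (auto simp: e_def act_minus[OF X] act_in[OF X])
      moreover have "f w b \<ge> 1/2"
        by (rule closure_ge[OF fc[OF vw(3)] _ _ b]) (auto simp: e_def)
      ultimately obtain x u where x: "x \<in> pts X" "u \<in> U" "f v (act X (- g) x) > 1/4" "f w (act X u x) > 1/4"
        using R_rel_approx[OF ab compose_act_continuous[OF X fc[OF vw(2)]] fc[OF vw(3)], of "1/4" "-g" "1/4"] by fastforce
      have "act X (u + g) (act X (- g) x) = act X u x"
        using gflowD(4)[OF X act_in[OF X x(1), of "- g"], of u g] act_minus[OF X x(1)] by simp
      then show False using edge[OF act_in[OF X x(1)] x(2), of "- g"] x(3,4) by simp
    qed
    then show ?thesis using s vw unfolding Edge by (auto simp: Str_of_def)
  next
    case (Cover n)
    then have n: "n \<ge> 1" using s by (auto simp: language_def)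
    then have "set xs \<in> covers_of M" using xs Cover unfolding covers_of_def by blast
    then have "\<forall>x\<in>pts X. \<exists>v\<in>set xs. f v x > 1/2" using wdataD(4)[OF f] by blast
    then have "\<Union>(set (map e xs)) = pts X" unfolding e_def by fastforce
    then show ?thesis using s Str_interp[OF M xs] unfolding Cover by (auto simp: Str_of_def)
  qed
  show ?thesis
    unfolding realizes_def
  proof (intro exI[of _ "e ` verts M"] conjI exI[of _ e] ballI)
    show "finite (e ` verts M)" using M by (auto simp: Str_def)
    show "bij_betw e (verts M) (verts (Str_of X (e ` verts M) F N))"
      using inj by (simp add: bij_betw_def Str_of_def)
  qed (use op ne rel in auto)
qed

text \<open>Urysohn's lemma needs closed sets inside the open ones on which to take the value 1, and
  these must still cover whatever the open sets cover and must keep points that witness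
  non-emptiness and distinctness; \<open>shrink_finite\<close> provides them.\<close>

lemma sdata_of_realizes:
  fixes X :: "('g::topological_group_add, 'x) gspace"
  assumes X: "gflow X" and M: "M \<in> Str F N" and r: "realizes X F N M"
  shows "\<exists>f. sdata X (verts M) (edges_of M) (covers_of M) f"
proof -
  let ?V = "verts M"
  have fin: "finite ?V" using M by (auto simp: Str_def)
  from r obtain \<O> e where O: "\<forall>A\<in>\<O>. openin (topol X) A \<and> A \<noteq> {}" "bij_betw e ?V \<O>"
      "\<And>s xs. s \<in> language F N \<Longrightarrow> xs \<in> interp M s \<Longrightarrow> map e xs \<in> interp (Str_of X \<O> F N) s"
    unfolding realizes_def by (auto simp: Str_of_def)
  have op: "openin (topol X) (e v)" "e v \<noteq> {}" "e v \<subseteq> pts X" if "v \<in> ?V" for v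
  proof -
    have "e v \<in> \<O>" using O(2) that by (rule bij_betw_apply)
    then show "openin (topol X) (e v)" "e v \<noteq> {}" using O(1) by auto
    then show "e v \<subseteq> pts X" by (simp add: openin_subset)
  qed
  have inj: "e v \<noteq> e w" if "v \<in> ?V" "w \<in> ?V" "v \<noteq> w" for v w
    using O(2) that by (auto simp: bij_betw_def inj_on_def)
  define z where "z v = (SOME x. x \<in> e v)" for v
  have z: "z v \<in> e v" if "v \<in> ?V" for v using op(2)[OF that] by (simp add: z_def some_in_eq)
  have "\<exists>y. v \<in> ?V \<and> w \<in> ?V \<and> v \<noteq> w \<longrightarrow> y \<in> (e v - e w) \<union> (e w - e v)" for v w
    using inj[of v w] by blast
  then obtain y where y: "\<And>v w. v \<in> ?V \<Longrightarrow> w \<in> ?V \<Longrightarrow> v \<noteq> w \<Longrightarrow> y v w \<in> (e v - e w) \<union> (e w - e v)" by metis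
  \<comment> \<open>\<open>z v\<close> shows that \<open>e v\<close> is non-empty, and
    \<open>y v w\<close> lies in exactly one of \<open>e v\<close> and \<open>e w\<close>.\<close>
  define D where "D = (z ` ?V \<union> (\<lambda>(v, w). y v w) ` (?V \<times> ?V)) \<inter> pts X"
  have D: "finite D" "D \<subseteq> pts X" using fin by (auto simp: D_def)
  obtain K where K0: "\<forall>v\<in>?V. closedin (topol X) (K v) \<and> K v \<subseteq> e v \<and> D \<inter> e v \<subseteq> K v"
    "\<forall>y\<in>pts X. \<exists>x\<in>pts X. \<forall>v\<in>?V. x \<in> e v \<longrightarrow> y \<in> K v"
    using shrink_finite[of "topol X" ?V e D, OF gflowD(1,2)[OF X] fin op(1) D] by auto
  have K: "\<And>v. v \<in> ?V \<Longrightarrow> closedin (topol X) (K v)" "\<And>v. v \<in> ?V \<Longrightarrow> K v \<subseteq> e v"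
    "\<And>v x. v \<in> ?V \<Longrightarrow> x \<in> D \<Longrightarrow> x \<in> e v \<Longrightarrow> x \<in> K v"
    "\<And>y. y \<in> pts X \<Longrightarrow> \<exists>x\<in>pts X. \<forall>v\<in>?V. x \<in> e v \<longrightarrow> y \<in> K v"
    using K0 by auto
  have norm: "normal_space (topol X)"
    using gflowD(1,2)[OF X] compact_Hausdorff_or_regular_imp_normal_space by blast
  have "\<exists>f. continuous_map (topol X) (top_of_set {0..1::real}) f \<and> f ` K v \<subseteq> {1} \<and> f ` (pts X - e v) \<subseteq> {0}"
    if v: "v \<in> ?V" for v
  proof -
    have "disjnt (pts X - e v) (K v)" using K(2)[OF v] by (auto simp: disjnt_def)
    moreover have "closedin (topol X) (pts X - e v)" using op(1)[OF v] by (simp add: closedin_diff)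
    ultimately obtain f where "continuous_map (topol X) (top_of_set {0..1::real}) f"
        "f ` (pts X - e v) \<subseteq> {0}" "f ` K v \<subseteq> {1}"
      using Urysohn_lemma[OF norm _ K(1)[OF v], of "pts X - e v" 0 1] by auto
    then show ?thesis by blast
  qed
  then obtain f where f: "\<And>v. v \<in> ?V \<Longrightarrow> continuous_map (topol X) (top_of_set {0..1::real}) (f v)"
      "\<And>v. v \<in> ?V \<Longrightarrow> f v ` K v \<subseteq> {1}" "\<And>v. v \<in> ?V \<Longrightarrow> f v ` (pts X - e v) \<subseteq> {0}"
    by metis
  have f1: "f v x = 1" if "v \<in> ?V" "x \<in> K v" for v x using f(2) that by blast
  have f0: "f v x = 0" if "v \<in> ?V" "x \<in> pts X" "x \<notin> e v" for v x using f(3) that by blast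
  have zD: "z v \<in> D" if "v \<in> ?V" for v using z[OF that] op(3)[OF that] that unfolding D_def by blast
  have yD: "y v w \<in> D" if "v \<in> ?V" "w \<in> ?V" "v \<noteq> w" for v w
    using y[OF that] op(3) that unfolding D_def by blast
  show ?thesis
    unfolding sdata_def
  proof (intro exI[of _ f] conjI ballI impI)
    fix v assume v: "v \<in> ?V"
    show "continuous_map (topol X) euclideanreal (f v)" using f(1)[OF v] by (simp add: continuous_map_in_subtopology)
    show "f v x \<in> {0..1}" if "x \<in> pts X" for x
      using f(1)[OF v] that by (auto simp: continuous_map_in_subtopology image_subset_iff Pi_iff)
    show "\<exists>x\<in>pts X. f v x = 1" using f1[OF v K(3)[OF v zD[OF v] z[OF v]]] op(3)[OF v] z[OF v] by blast
    fix w assume w: "w \<in> ?V" "v \<noteq> w"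
    have yp: "y v w \<in> pts X" using yD[OF v w] D by blast
    show "\<exists>x\<in>pts X. f v x = 1 \<and> f w x = 0 \<or> f w x = 1 \<and> f v x = 0"
    proof (rule bexI[OF _ yp])
      show "f v (y v w) = 1 \<and> f w (y v w) = 0 \<or> f w (y v w) = 1 \<and> f v (y v w) = 0"
        using y[OF v w] f1[OF v K(3)[OF v yD[OF v w]]] f1[OF w(1) K(3)[OF w(1) yD[OF v w]]]
          f0[OF v yp] f0[OF w(1) yp] by blast
    qed
  next
    fix c x assume "c \<in> covers_of M" and x: "x \<in> pts X"
    then obtain xs n where xs: "c = set xs" "n \<ge> 1" "xs \<in> interp M (Cover n)" by (auto simp: covers_of_def)
    obtain x' where x': "x' \<in> pts X" "\<forall>v\<in>?V. x' \<in> e v \<longrightarrow> x \<in> K v" using K(4)[OF x] by blast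
    have "Cover n \<in> language F N" using xs by (auto simp: language_def)
    from O(3)[OF this xs(3)] have "\<Union>(set (map e xs)) = pts X"
      using \<open>Cover n \<in> language F N\<close> by (auto simp: Str_of_def)
    with x' obtain v where "v \<in> set xs" "x' \<in> e v" by auto
    moreover have "v \<in> ?V" using \<open>v \<in> set xs\<close> Str_interp(3)[OF M xs(3)] by blast
    ultimately show "\<exists>v\<in>c. f v x = 1" using x'(2) f1 xs(1) by blast
  next
    fix E assume E: "E \<in> edges_of M"
    obtain g U v w where E': "E = (g, U, v, w)" by (cases E) auto
    note vw = StrE_edge[OF M E[unfolded E']]
    have lang: "Edge g U \<in> language F N" using vw by (auto simp: language_def)
    have "[v, w] \<in> interp M (Edge g U)" using E E' by (simp add: edges_of_def)
    from O(3)[OF lang this] have disj: "((topol X closure_of (act X g ` e v)) \<times> (topol X closure_of e w)) \<inter> R_rel X U = {}"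
      using lang by (auto simp: Str_of_def)
    have "\<not> (f v x > 0 \<and> f w (act X (u + g) x) > 0)" if x: "x \<in> pts X" and u: "u \<in> U" for x u
    proof
      assume "f v x > 0 \<and> f w (act X (u + g) x) > 0"
      then have 1: "x \<in> e v" "act X (u + g) x \<in> e w"
        using f0[OF vw(3) x] f0[OF vw(4) act_in[OF X x]] by fastforce+
      have "act X g ` e v \<subseteq> pts X" using op(3)[OF vw(3)] act_in[OF X] by blast
      then have "act X g x \<in> topol X closure_of (act X g ` e v)"
        using 1(1) closure_of_subset[of "act X g ` e v" "topol X"] by blast
      moreover have "act X (u + g) x \<in> topol X closure_of e w"
        using 1(2) closure_of_subset[OF op(3)[OF vw(4)]] by blast
      moreover have "(act X g x, act X (u + g) x) \<in> R_rel X U"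
        using R_relI[OF X act_in[OF X x] u, of g] gflowD(4)[OF X x] by simp
      ultimately show False using disj by blast
    qed
    then show "case E of (g, U, v, w) \<Rightarrow> \<forall>x\<in>pts X. \<forall>u\<in>U. \<not> (f v x > 0 \<and> f w (act X (u + g) x) > 0)"
      unfolding E' by auto
  qed
qed

definition good :: "'g::topological_group_add set set \<Rightarrow> ('g, nat) relstr \<Rightarrow> bool" where
  "good \<N> M \<longleftrightarrow> (\<exists>F N. finite F \<and> finite N \<and> N \<subseteq> N_RPC \<N> \<and> M \<in> Str F N)"

lemma tp_G_wdata:
  assumes "gflow X" "good \<N> M" "wdata X (verts M) (edges_of M) (covers_of M) f"
  shows "M \<in> tp_G \<N> X"
proof -
  obtain F N where "finite F" "finite N" "N \<subseteq> N_RPC \<N>" "M \<in> Str F N"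
    using assms(2) unfolding good_def by blast
  with realizes_of_wdata[OF assms(1) this(4) assms(3)] show ?thesis unfolding tp_G_def by auto
qed

lemma tp_G_sdata:
  assumes "gflow X" "M \<in> tp_G \<N> X"
  shows "good \<N> M" "\<exists>f. sdata X (verts M) (edges_of M) (covers_of M) f"
proof -
  obtain F N where FN: "finite F" "finite N" "N \<subseteq> N_RPC \<N>" "M \<in> Str F N" "realizes X F N M"
    using assms(2) unfolding tp_G_def by blast
  then show "good \<N> M" unfolding good_def by blast
  show "\<exists>f. sdata X (verts M) (edges_of M) (covers_of M) f"
    using sdata_of_realizes[OF assms(1) FN(4,5)] .
qed

lemma goodD:
  assumes "good \<N> M"
  shows "finite (verts M)" "finite (edges_of M)" "finite (covers_of M)"
    "(g, U, v, w) \<in> edges_of M \<Longrightarrow> U \<in> N_RPC \<N> \<and> v \<in> verts M \<and> w \<in> verts M"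
    "c \<in> covers_of M \<Longrightarrow> c \<subseteq> verts M"
proof -
  obtain F N where FN: "finite F" "finite N" "N \<subseteq> N_RPC \<N>" "M \<in> Str F N"
    using assms unfolding good_def by blast
  show "finite (verts M)" "finite (edges_of M)" "finite (covers_of M)"
    using Str_finite[OF FN(4,1,2)] .
  show "(g, U, v, w) \<in> edges_of M \<Longrightarrow> U \<in> N_RPC \<N> \<and> v \<in> verts M \<and> w \<in> verts M"
    using StrE_edge[OF FN(4)] FN(3) by blast
  show "c \<in> covers_of M \<Longrightarrow> c \<subseteq> verts M" using StrE_cover[OF FN(4)] .
qed

subsection \<open>Characters of the algebra of uniformly continuous functions\<close>

text \<open>An infinite disjoint union of non-empty flows is not compact and hence no flow.
  Continuity of each single translation is what is kept here; uniformity in the group variable is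
  enforced by membership in \<open>C_G\<close>.\<close>

locale gspace_action =
  fixes Y :: "('g::topological_group_add, 'y) gspace"
  assumes act_pts: "x \<in> pts Y \<Longrightarrow> act Y g x \<in> pts Y"
    and act_zero: "x \<in> pts Y \<Longrightarrow> act Y 0 x = x"
    and act_add: "x \<in> pts Y \<Longrightarrow> act Y (g + h) x = act Y g (act Y h x)"
    and act_cont: "continuous_map (topol Y) (topol Y) (act Y g)"
begin

lemma C_G_D:
  assumes "p \<in> C_G Y"
  shows "p \<in> extensional (pts Y)" "continuous_map (topol Y) euclidean p" "bounded (p ` pts Y)"
    "e > 0 \<Longrightarrow> eventually (\<lambda>g. \<forall>x\<in>pts Y. dist (p (act Y g x)) (p (act Y g\<^sub>0 x)) < e) (nhds g\<^sub>0)"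
proof -
  show "p \<in> extensional (pts Y)" "continuous_map (topol Y) euclidean p" "bounded (p ` pts Y)"
    using assms by (auto simp: C_G_def)
  assume e: "e > 0"
  have "uniform_limit (pts Y) (\<lambda>g x. p (act Y g x)) (\<lambda>x. p (act Y g\<^sub>0 x)) (at g\<^sub>0)"
    using assms by (auto simp: C_G_def)
  then have "eventually (\<lambda>g. \<forall>x\<in>pts Y. dist (p (act Y g x)) (p (act Y g\<^sub>0 x)) < e) (at g\<^sub>0)"
    using e unfolding uniform_limit_iff by blast
  then show "eventually (\<lambda>g. \<forall>x\<in>pts Y. dist (p (act Y g x)) (p (act Y g\<^sub>0 x)) < e) (nhds g\<^sub>0)"
    using e by (simp add: eventually_nhds_conv_at)
qed

lemma C_G_I:
  assumes "p \<in> extensional (pts Y)" "continuous_map (topol Y) euclidean p" "bounded (p ` pts Y)"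
    "\<And>e g\<^sub>0. e > 0 \<Longrightarrow> eventually (\<lambda>g. \<forall>x\<in>pts Y. dist (p (act Y g x)) (p (act Y g\<^sub>0 x)) < e) (nhds g\<^sub>0)"
  shows "p \<in> C_G Y"
  using assms unfolding C_G_def uniform_limit_iff by (auto simp: eventually_nhds_conv_at)

text \<open>Bounded functions take values in a compact set, where \<open>h\<close> is uniformly
  continuous; so it preserves boundedness and uniform continuity along the action.\<close>

lemma C_G_comp2:
  fixes h :: "complex \<times> complex \<Rightarrow> complex"
  assumes p: "p \<in> C_G Y" and q: "q \<in> C_G Y" and h: "continuous_on UNIV h"
  shows "(\<lambda>x\<in>pts Y. h (p x, q x)) \<in> C_G Y"
proof (rule C_G_I)
  obtain r where r: "\<And>x. x \<in> pts Y \<Longrightarrow> norm (p x) \<le> r" using C_G_D(3)[OF p] unfolding bounded_iff by auto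
  obtain s where s: "\<And>x. x \<in> pts Y \<Longrightarrow> norm (q x) \<le> s" using C_G_D(3)[OF q] unfolding bounded_iff by auto
  let ?K = "cball 0 r \<times> cball 0 s :: (complex \<times> complex) set"
  have K: "compact ?K" by (intro compact_Times compact_cball)
  have inK: "(p x, q x) \<in> ?K" if "x \<in> pts Y" for x using r[OF that] s[OF that] by (simp add: )
  have hK: "continuous_on ?K h" using h continuous_on_subset by blast
  show "(\<lambda>x\<in>pts Y. h (p x, q x)) \<in> extensional (pts Y)" by simp
  have "continuous_map (topol Y) (prod_topology euclidean euclidean) (\<lambda>x. (p x, q x))"
    by (intro continuous_map_pairedI C_G_D(2) p q)
  then have "continuous_map (topol Y) euclidean (\<lambda>x. (p x, q x))" by simp
  moreover have "continuous_map euclidean euclidean h" using h by simp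
  ultimately have "continuous_map (topol Y) euclidean (h \<circ> (\<lambda>x. (p x, q x)))" by (rule continuous_map_compose)
  then show "continuous_map (topol Y) euclidean (\<lambda>x\<in>pts Y. h (p x, q x))"
    by (rule continuous_map_eq) simp
  have "bounded (h ` ?K)" using compact_continuous_image[OF hK K] compact_imp_bounded by blast
  then show "bounded ((\<lambda>x\<in>pts Y. h (p x, q x)) ` pts Y)"
    by (rule bounded_subset) (use inK in auto)
  fix e :: real and g\<^sub>0 assume e: "e > 0"
  have "uniformly_continuous_on ?K h" using compact_uniformly_continuous[OF hK K] .
  then obtain d where d: "d > 0" "\<And>a b. a \<in> ?K \<Longrightarrow> b \<in> ?K \<Longrightarrow> dist b a < d \<Longrightarrow> dist (h b) (h a) < e"
    using e unfolding uniformly_continuous_on_def by meson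
  have "eventually (\<lambda>g. \<forall>x\<in>pts Y. dist (p (act Y g x)) (p (act Y g\<^sub>0 x)) < d/2) (nhds g\<^sub>0)"
    "eventually (\<lambda>g. \<forall>x\<in>pts Y. dist (q (act Y g x)) (q (act Y g\<^sub>0 x)) < d/2) (nhds g\<^sub>0)"
    using d(1) by (intro C_G_D(4) p q; simp)+
  then show "eventually (\<lambda>g. \<forall>x\<in>pts Y. dist ((\<lambda>x\<in>pts Y. h (p x, q x)) (act Y g x))
      ((\<lambda>x\<in>pts Y. h (p x, q x)) (act Y g\<^sub>0 x)) < e) (nhds g\<^sub>0)"
  proof eventually_elim
    case (elim g)
    show ?case
    proof
      fix x assume x: "x \<in> pts Y"
      have "dist (p (act Y g x), q (act Y g x)) (p (act Y g\<^sub>0 x), q (act Y g\<^sub>0 x)) < d"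
        using dist_Pair_Pair sqrt_sum_squares_le_sum_abs elim x
        by (smt (verit, best) field_sum_of_halves zero_le_dist abs_of_nonneg)
      then show "dist ((\<lambda>x\<in>pts Y. h (p x, q x)) (act Y g x)) ((\<lambda>x\<in>pts Y. h (p x, q x)) (act Y g\<^sub>0 x)) < e"
        using d(2)[OF inK inK] act_pts[OF x] by simp
    qed
  qed
qed

lemma C_G_const: "(\<lambda>x\<in>pts Y. c) \<in> C_G Y"
  by (rule C_G_I) (auto intro: continuous_map_eq[of _ _ "\<lambda>_. c"] simp: act_pts bounded_iff)

lemma C_G_comp1:
  fixes h :: "complex \<Rightarrow> complex"
  assumes "p \<in> C_G Y" "continuous_on UNIV h"
  shows "(\<lambda>x\<in>pts Y. h (p x)) \<in> C_G Y"
proof -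
  have "continuous_on UNIV (\<lambda>z :: complex \<times> complex. h (fst z))"
    by (rule continuous_on_compose2[OF assms(2)]) (auto intro!: continuous_intros)
  from C_G_comp2[OF assms(1,1) this] show ?thesis by simp
qed

lemma C_G_add: "p \<in> C_G Y \<Longrightarrow> q \<in> C_G Y \<Longrightarrow> (\<lambda>x\<in>pts Y. p x + q x) \<in> C_G Y"
  using C_G_comp2[of p q "\<lambda>z. fst z + snd z"] by (simp add: continuous_intros)

lemma C_G_mult: "p \<in> C_G Y \<Longrightarrow> q \<in> C_G Y \<Longrightarrow> (\<lambda>x\<in>pts Y. p x * q x) \<in> C_G Y"
  using C_G_comp2[of p q "\<lambda>z. fst z * snd z"] by (simp add: continuous_intros)

lemma C_G_scale: "p \<in> C_G Y \<Longrightarrow> (\<lambda>x\<in>pts Y. c * p x) \<in> C_G Y"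
  using C_G_comp1[of p "\<lambda>z. c * z"] by (simp add: continuous_intros)

lemma translate_C_G:
  assumes "p \<in> C_G Y"
  shows "translate Y p g \<in> C_G Y"
proof (rule C_G_I)
  show "translate Y p g \<in> extensional (pts Y)" by (simp add: translate_def)
  have "continuous_map (topol Y) euclidean (p \<circ> act Y g)"
    by (rule continuous_map_compose[OF act_cont C_G_D(2)[OF assms]])
  then show "continuous_map (topol Y) euclidean (translate Y p g)"
    unfolding translate_def by (rule continuous_map_eq) simp
  have "translate Y p g ` pts Y \<subseteq> p ` pts Y" using act_pts by (auto simp: translate_def)
  then show "bounded (translate Y p g ` pts Y)" using C_G_D(3)[OF assms] bounded_subset by blast
  fix e :: real and g\<^sub>0 assume e: "e > 0"
  have "filterlim (\<lambda>k. g + k) (nhds (g + g\<^sub>0)) (nhds g\<^sub>0)"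
    by (intro tendsto_intros filterlim_ident)
  from eventually_compose_filterlim[OF C_G_D(4)[OF assms e, of "g + g\<^sub>0"] this]
  show "eventually (\<lambda>k. \<forall>x\<in>pts Y. dist (translate Y p g (act Y k x)) (translate Y p g (act Y g\<^sub>0 x)) < e) (nhds g\<^sub>0)"
    by eventually_elim (simp add: translate_def act_pts act_add)
qed

section \<open>Characters as limits of evaluations\<close>

lemma characters_D:
  assumes "\<phi> \<in> characters Y"
  shows "\<phi> \<in> extensional (C_G Y)" "\<phi> (\<lambda>x\<in>pts Y. 1) = 1"
    "p \<in> C_G Y \<Longrightarrow> \<phi> (\<lambda>x\<in>pts Y. c * p x) = c * \<phi> p"
    "p \<in> C_G Y \<Longrightarrow> q \<in> C_G Y \<Longrightarrow> \<phi> (\<lambda>x\<in>pts Y. p x + q x) = \<phi> p + \<phi> q"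
    "p \<in> C_G Y \<Longrightarrow> q \<in> C_G Y \<Longrightarrow> \<phi> (\<lambda>x\<in>pts Y. p x * q x) = \<phi> p * \<phi> q"
  using assms by (auto simp: characters_def)

lemma characters_const:
  assumes "\<phi> \<in> characters Y"
  shows "\<phi> (\<lambda>x\<in>pts Y. c) = c"
proof -
  have "(\<lambda>x\<in>pts Y. c * (\<lambda>x\<in>pts Y. 1) x) = (\<lambda>x\<in>pts Y. c)" by (rule restrict_ext) simp
  with characters_D(3)[OF assms C_G_const, of c 1] characters_D(2)[OF assms] show ?thesis by simp
qed

text \<open>Density of the evaluations: otherwise the function \<open>\<Sum>p\<in>P. \<bar>p - \<phi> p\<bar>\<^sup>2\<close>, on which \<open>\<phi>\<close>
  vanishes, would be invertible in the algebra.\<close>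

lemma characters_approx:
  assumes phi: "\<phi> \<in> characters Y" and P: "finite P" "P \<subseteq> C_G Y" and e: "e > 0"
  shows "\<exists>x\<in>pts Y. \<forall>p\<in>P. dist (p x) (\<phi> p) < e"
proof (rule ccontr)
  assume neg: "\<not> ?thesis"
  have "\<exists>f\<in>C_G Y. \<phi> f = 0 \<and> (\<forall>x\<in>pts Y. f x = of_real (\<Sum>p\<in>P. (cmod (p x - \<phi> p))\<^sup>2))"
    using P
  proof (induction P rule: finite_induct)
    case empty
    show ?case
    proof (intro bexI[OF _ C_G_const[of 0]] conjI)
      show "\<phi> (\<lambda>x\<in>pts Y. 0) = 0" by (rule characters_const[OF phi])
    qed simp
  next
    case (insert p P)
    then obtain f where f: "f \<in> C_G Y" "\<phi> f = 0" "\<And>x. x \<in> pts Y \<Longrightarrow> f x = of_real (\<Sum>p\<in>P. (cmod (p x - \<phi> p))\<^sup>2)"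
      by auto
    have p: "p \<in> C_G Y" using insert.prems by simp
    define c where "c = (\<lambda>x\<in>pts Y. - \<phi> p)"
    have c: "c \<in> C_G Y" "\<phi> c = - \<phi> p" using C_G_const characters_const[OF phi] by (auto simp: c_def)
    define q where "q = (\<lambda>x\<in>pts Y. p x + c x)"
    have q: "q \<in> C_G Y" "\<phi> q = 0" using C_G_add[OF p c(1)] characters_D(4)[OF phi p c(1)] c(2) by (auto simp: q_def)
    \<comment> \<open>Multiplicativity alone gives \<open>\<phi> s = 0\<close> from
      \<open>\<phi> q = 0\<close>, whatever the value of \<open>\<phi>\<close> at the conjugate
      \<open>r\<close> is.\<close>
    define r where "r = (\<lambda>x\<in>pts Y. cnj (q x))"
    have r: "r \<in> C_G Y" using C_G_comp1[OF q(1), of cnj] by (simp add: r_def continuous_intros)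
    define s where "s = (\<lambda>x\<in>pts Y. q x * r x)"
    have s: "s \<in> C_G Y" "\<phi> s = 0" using C_G_mult[OF q(1) r] characters_D(5)[OF phi q(1) r] q(2) by (auto simp: s_def)
    define t where "t = (\<lambda>x\<in>pts Y. f x + s x)"
    have t: "t \<in> C_G Y" "\<phi> t = 0" using C_G_add[OF f(1) s(1)] characters_D(4)[OF phi f(1) s(1)] f(2) s(2) by (auto simp: t_def)
    have "t x = of_real (\<Sum>p\<in>insert p P. (cmod (p x - \<phi> p))\<^sup>2)" if "x \<in> pts Y" for x
    proof -
      have "s x = of_real ((cmod (p x - \<phi> p))\<^sup>2)"
        using that unfolding s_def r_def q_def c_def by (simp add: complex_norm_square del: of_real_power)
      then show ?thesis using that insert.hyps f(3)[OF that] by (simp add: t_def)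
    qed
    then show ?case using t by blast
  qed
  then obtain f where f: "f \<in> C_G Y" "\<phi> f = 0" "\<And>x. x \<in> pts Y \<Longrightarrow> f x = of_real (\<Sum>p\<in>P. (cmod (p x - \<phi> p))\<^sup>2)" by blast
  \<comment> \<open>By \<open>neg\<close> the sum is at least \<open>e\<^sup>2\<close> at every
    point. The cutoff at \<open>e\<^sup>2\<close> therefore changes no value and makes the inverse a
    continuous function on the whole plane.\<close>
  define g where "g = (\<lambda>x\<in>pts Y. inverse (complex_of_real (max (e\<^sup>2) (Re (f x)))))"
  have "continuous_on UNIV (\<lambda>z. inverse (complex_of_real (max (e\<^sup>2) (Re z))))"
    using e by (intro continuous_intros) (auto simp: max_def)
  then have g: "g \<in> C_G Y" unfolding g_def by (rule C_G_comp1[OF f(1)])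
  have "f x * g x = 1" if x: "x \<in> pts Y" for x
  proof -
    obtain p where p: "p \<in> P" "dist (p x) (\<phi> p) \<ge> e" using neg x by force
    then have "e\<^sup>2 \<le> (cmod (p x - \<phi> p))\<^sup>2" using e by (intro power_mono) (auto simp: dist_norm)
    also have "\<dots> \<le> (\<Sum>p\<in>P. (cmod (p x - \<phi> p))\<^sup>2)" using p(1) P(1) by (intro member_le_sum) auto
    finally have le: "e\<^sup>2 \<le> (\<Sum>p\<in>P. (cmod (p x - \<phi> p))\<^sup>2)" .
    then have "(\<Sum>p\<in>P. (cmod (p x - \<phi> p))\<^sup>2) \<noteq> 0" using e zero_less_power[OF e, of 2] by linarith
    moreover have "max (e\<^sup>2) (Re (f x)) = (\<Sum>p\<in>P. (cmod (p x - \<phi> p))\<^sup>2)"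
      using le f(3)[OF x] by (simp add: max_def del: of_real_sum)
    ultimately show ?thesis using x f(3)[OF x] unfolding g_def by (simp del: of_real_sum)
  qed
  then have "(\<lambda>x\<in>pts Y. f x * g x) = (\<lambda>x\<in>pts Y. 1)" by (intro restrict_ext) simp
  then show False using characters_D(5)[OF phi f(1) g] characters_D(2)[OF phi] f(2) by simp
qed

lemma characters_closed:
  assumes phi: "\<phi> \<in> characters Y" and p: "p \<in> C_G Y" and S: "closed S" "\<And>x. x \<in> pts Y \<Longrightarrow> p x \<in> S"
  shows "\<phi> p \<in> S"
proof (rule ccontr)
  assume "\<phi> p \<notin> S"
  then obtain e where e: "e > 0" "ball (\<phi> p) e \<subseteq> - S" using S(1) open_contains_ball[of "- S"] by auto
  obtain x where x: "x \<in> pts Y" "dist (p x) (\<phi> p) < e" using characters_approx[OF phi, of "{p}" e] p e by auto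
  then have "p x \<in> ball (\<phi> p) e" by (simp add: dist_commute)
  with e(2) S(2)[OF x(1)] show False by blast
qed

text \<open>True for evaluations, and one point approximates \<open>\<phi>\<close> at
  \<open>p\<close>, \<open>q\<close> and the composed function simultaneously.\<close>

lemma characters_comp2:
  fixes h :: "complex \<times> complex \<Rightarrow> complex"
  assumes phi: "\<phi> \<in> characters Y" and p: "p \<in> C_G Y" and q: "q \<in> C_G Y" and h: "continuous_on UNIV h"
  shows "\<phi> (\<lambda>x\<in>pts Y. h (p x, q x)) = h (\<phi> p, \<phi> q)"
proof -
  let ?r = "\<lambda>x\<in>pts Y. h (p x, q x)"
  have "dist (\<phi> ?r) (h (\<phi> p, \<phi> q)) < e" if e: "e > 0" for e
  proof -
    have "\<exists>d>0. \<forall>x'. dist x' (\<phi> p, \<phi> q) < d \<longrightarrow> dist (h x') (h (\<phi> p, \<phi> q)) < e/2"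
      using h[unfolded continuous_on_iff, rule_format, OF UNIV_I half_gt_zero[OF e], of "(\<phi> p, \<phi> q)"] by simp
    then obtain d where d: "d > 0" "\<And>x'. dist x' (\<phi> p, \<phi> q) < d \<Longrightarrow> dist (h x') (h (\<phi> p, \<phi> q)) < e/2" by blast
    obtain x where x: "x \<in> pts Y" "\<forall>s\<in>{p, q, ?r}. dist (s x) (\<phi> s) < min (d/2) (e/2)"
      using characters_approx[OF phi, of "{p, q, ?r}" "min (d/2) (e/2)"] p q C_G_comp2[OF p q h] d e by auto
    have "dist (p x, q x) (\<phi> p, \<phi> q) < d"
    proof -
      have "dist (p x, q x) (\<phi> p, \<phi> q) \<le> dist (p x) (\<phi> p) + dist (q x) (\<phi> q)"
        unfolding dist_Pair_Pair by (rule sqrt_sum_squares_le_sum) auto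
      also have "\<dots> < d" using x(2) by auto
      finally show ?thesis .
    qed
    from d(2)[OF this] have "dist (?r x) (h (\<phi> p, \<phi> q)) < e/2" using x(1) by simp
    moreover have "dist (?r x) (\<phi> ?r) < e/2" using x(2) by simp
    ultimately show ?thesis using dist_triangle_half_r by blast
  qed
  then have "\<not> 0 < dist (\<phi> ?r) (h (\<phi> p, \<phi> q))" by blast
  then show ?thesis by simp
qed

lemma characters_dist:
  assumes phi: "\<phi> \<in> characters Y" and p: "p \<in> C_G Y" and q: "q \<in> C_G Y"
    and d: "\<And>x. x \<in> pts Y \<Longrightarrow> dist (p x) (q x) \<le> e"
  shows "dist (\<phi> p) (\<phi> q) \<le> e"
proof -
  have "continuous_on UNIV (\<lambda>z :: complex \<times> complex. fst z - snd z)" by (intro continuous_intros)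
  note c = C_G_comp2[OF p q this] characters_comp2[OF phi p q this]
  have "\<phi> (\<lambda>x\<in>pts Y. fst (p x, q x) - snd (p x, q x)) \<in> cball 0 e"
    by (rule characters_closed[OF phi c(1)]) (use d in \<open>auto simp: dist_norm norm_minus_commute\<close>)
  then show ?thesis using c(2) by (simp add: dist_norm)
qed

lemma act_alpha: "p \<in> C_G Y \<Longrightarrow> act (alpha_G Y) g \<phi> p = \<phi> (translate Y p g)"
  by (simp add: alpha_G_def)

lemma act_alpha_characters:
  assumes phi: "\<phi> \<in> characters Y"
  shows "act (alpha_G Y) g \<phi> \<in> characters Y"
proof -
  have tr: "translate Y (\<lambda>x\<in>pts Y. f x) g = (\<lambda>x\<in>pts Y. f (act Y g x))" for f
    unfolding translate_def by (rule restrict_ext) (simp add: act_pts)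
  have tr2: "(\<lambda>x\<in>pts Y. F (p (act Y g x)) (q (act Y g x))) = (\<lambda>x\<in>pts Y. F (translate Y p g x) (translate Y q g x))" for F p q
    unfolding translate_def by (rule restrict_ext) simp
  show ?thesis
    unfolding characters_def
  proof (intro CollectI conjI allI ballI)
    show "act (alpha_G Y) g \<phi> \<in> extensional (C_G Y)" by (simp add: alpha_G_def)
    show "act (alpha_G Y) g \<phi> (\<lambda>x\<in>pts Y. 1) = 1"
      using characters_D(2)[OF phi] by (simp add: act_alpha C_G_const tr)
    fix p assume p: "p \<in> C_G Y"
    note tp = translate_C_G[OF p, of g]
    show "act (alpha_G Y) g \<phi> (\<lambda>x\<in>pts Y. c * p x) = c * act (alpha_G Y) g \<phi> p" for c
      using characters_D(3)[OF phi tp, of c] tr2[of "\<lambda>a b. c * a" p p] by (simp add: act_alpha C_G_scale[OF p] tr p)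
    fix q assume q: "q \<in> C_G Y"
    note tq = translate_C_G[OF q, of g]
    show "act (alpha_G Y) g \<phi> (\<lambda>x\<in>pts Y. p x + q x) = act (alpha_G Y) g \<phi> p + act (alpha_G Y) g \<phi> q"
      using characters_D(4)[OF phi tp tq] tr2[of "\<lambda>a b. a + b" p q] by (simp add: act_alpha C_G_add[OF p q] tr p q)
    show "act (alpha_G Y) g \<phi> (\<lambda>x\<in>pts Y. p x * q x) = act (alpha_G Y) g \<phi> p * act (alpha_G Y) g \<phi> q"
      using characters_D(5)[OF phi tp tq] tr2[of "\<lambda>a b. a * b" p q] by (simp add: act_alpha C_G_mult[OF p q] tr p q)
  qed
qed

lemma point_eval_characters: "y \<in> pts Y \<Longrightarrow> point_eval Y y \<in> characters Y"
  by (auto simp: characters_def point_eval_def C_G_const C_G_add C_G_mult C_G_scale)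

text \<open>The values at each \<open>p\<close> stay in a fixed disc, so pointwise ultralimits
  exist, and the algebraic identities pass to the limit.\<close>

lemma characters_limit:
  assumes U: "ultra U" and ev: "eventually (\<lambda>a. f a \<in> characters Y) U"
  shows "\<exists>\<phi>\<in>characters Y. \<forall>p\<in>C_G Y. ((\<lambda>a. f a p) \<longlongrightarrow> \<phi> p) U"
proof -
  have nb: "U \<noteq> bot" using U by (simp add: ultra_def)
  have "\<exists>l. ((\<lambda>a. f a p) \<longlongrightarrow> l) U" if p: "p \<in> C_G Y" for p
  proof -
    obtain r where r: "\<And>x. x \<in> pts Y \<Longrightarrow> norm (p x) \<le> r" using C_G_D(3)[OF p] unfolding bounded_iff by auto
    have "\<phi> p \<in> cball 0 r" if "\<phi> \<in> characters Y" for \<phi>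
      by (rule characters_closed[OF that p]) (auto simp: r)
    then have "eventually (\<lambda>a. f a p \<in> cball 0 r) U" using ev by (auto elim: eventually_mono)
    from ultra_limit_compact[OF U compact_cball this] show ?thesis by blast
  qed
  then obtain L where L: "\<And>p. p \<in> C_G Y \<Longrightarrow> ((\<lambda>a. f a p) \<longlongrightarrow> L p) U" by metis
  define \<phi> where "\<phi> = (\<lambda>p\<in>C_G Y. L p)"
  have lim: "((\<lambda>a. f a p) \<longlongrightarrow> \<phi> p) U" if "p \<in> C_G Y" for p using L[OF that] that by (simp add: \<phi>_def)
  have uniq: "\<phi> p = l"
    if "p \<in> C_G Y" "((\<lambda>a. h (f a)) \<longlongrightarrow> l) U" "\<And>\<psi>. \<psi> \<in> characters Y \<Longrightarrow> \<psi> p = h \<psi>" for p l h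
  proof -
    have "eventually (\<lambda>a. f a p = h (f a)) U" using ev by eventually_elim (rule that(3))
    from tendsto_cong[OF this] that(2) have "((\<lambda>a. f a p) \<longlongrightarrow> l) U" by simp
    with lim[OF that(1)] show ?thesis using tendsto_unique[OF nb] by blast
  qed
  have "\<phi> \<in> characters Y"
    unfolding characters_def
  proof (intro CollectI conjI allI ballI)
    show "\<phi> \<in> extensional (C_G Y)" by (simp add: \<phi>_def)
    show "\<phi> (\<lambda>x\<in>pts Y. 1) = 1"
      by (rule uniq[OF C_G_const, where h = "\<lambda>_. 1"]) (auto intro: characters_D(2))
    fix p assume p: "p \<in> C_G Y"
    show "\<phi> (\<lambda>x\<in>pts Y. c * p x) = c * \<phi> p" for c
      by (rule uniq[OF C_G_scale[OF p], where h = "\<lambda>\<psi>. c * \<psi> p"])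
        (intro tendsto_intros lim p, rule characters_D(3)[OF _ p])
    fix q assume q: "q \<in> C_G Y"
    show "\<phi> (\<lambda>x\<in>pts Y. p x + q x) = \<phi> p + \<phi> q"
      by (rule uniq[OF C_G_add[OF p q], where h = "\<lambda>\<psi>. \<psi> p + \<psi> q"])
        (intro tendsto_intros lim p q, rule characters_D(4)[OF _ p q])
    show "\<phi> (\<lambda>x\<in>pts Y. p x * q x) = \<phi> p * \<phi> q"
      by (rule uniq[OF C_G_mult[OF p q], where h = "\<lambda>\<psi>. \<psi> p * \<psi> q"])
        (intro tendsto_intros lim p q, rule characters_D(5)[OF _ p q])
  qed
  with lim show ?thesis by blast
qed

lemma topspace_alpha: "pts (alpha_G Y) = characters Y"
  using characters_D(1) by (auto simp: alpha_G_def PiE_def)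

text \<open>A basic open set of the product topology constrains finitely many functions, and
  \<open>characters_approx\<close> treats these together.\<close>

lemma point_eval_dense:
  assumes W: "openin (topol (alpha_G Y)) W" "W \<noteq> {}"
  shows "\<exists>y\<in>pts Y. point_eval Y y \<in> W"
proof -
  obtain \<phi> where phi: "\<phi> \<in> W" using W(2) by blast
  then have ch: "\<phi> \<in> characters Y" using openin_subset[OF W(1)] topspace_alpha by blast
  obtain W' where W': "openin (product_topology (\<lambda>_. euclidean) (C_G Y)) W'" "W = W' \<inter> characters Y"
    using W(1) unfolding alpha_G_def by (auto simp: openin_subtopology)
  with phi have "\<phi> \<in> W'" by blast
  with W'(1) obtain Q where O: "finite {p \<in> C_G Y. Q p \<noteq> UNIV}" "\<And>p. p \<in> C_G Y \<Longrightarrow> open (Q p)"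
      "\<phi> \<in> Pi\<^sub>E (C_G Y) Q" "Pi\<^sub>E (C_G Y) Q \<subseteq> W'"
    unfolding openin_product_topology_alt by auto
  let ?P = "{p \<in> C_G Y. Q p \<noteq> UNIV}"
  have "\<exists>e>0. ball (\<phi> p) e \<subseteq> Q p" if "p \<in> C_G Y" for p
    using O(2)[OF that] O(3) that by (auto simp: open_contains_ball PiE_iff)
  then obtain e where e: "\<And>p. p \<in> C_G Y \<Longrightarrow> e p > 0 \<and> ball (\<phi> p) (e p) \<subseteq> Q p" by metis
  define d where "d = Min (insert (1::real) (e ` ?P))"
  have d: "d > 0" "\<And>p. p \<in> ?P \<Longrightarrow> d \<le> e p"
    using O(1) e by (auto simp: d_def)
  obtain y where y: "y \<in> pts Y" "\<And>p. p \<in> ?P \<Longrightarrow> dist (p y) (\<phi> p) < d"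
    using characters_approx[OF ch O(1) _ d(1)] by auto
  have "point_eval Y y \<in> Pi\<^sub>E (C_G Y) Q"
  proof (rule PiE_I)
    fix p assume p: "p \<in> C_G Y"
    show "point_eval Y y p \<in> Q p"
    proof (cases "Q p = UNIV")
      case False
      then have "dist (\<phi> p) (p y) < e p" using y(2)[of p] d(2)[of p] p by (simp add: dist_commute)
      then show ?thesis using e[OF p] p by (auto simp: point_eval_def)
    qed simp
  qed (simp add: point_eval_def)
  then show ?thesis using O(4) W'(2) point_eval_characters[OF y(1)] y(1) by blast
qed

end

subsection \<open>The ultracoproduct as a flow\<close>

lemma continuous_map_from_sum:
  assumes "\<And>i. i \<in> I \<Longrightarrow> continuous_map (T i) Z (\<lambda>x. f (i, x))"
  shows "continuous_map (sum_topology T I) Z f"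
  unfolding continuous_map_def
proof (intro conjI allI impI)
  show "f \<in> topspace (sum_topology T I) \<rightarrow> topspace Z"
    using assms by (auto simp: continuous_map_def Pi_iff)
  fix W assume W: "openin Z W"
  have "openin (T i) {x \<in> topspace (T i). f (i, x) \<in> W}" if "i \<in> I" for i
    using assms[OF that] W by (simp add: continuous_map_def)
  moreover have "{x. (i, x) \<in> {y \<in> topspace (sum_topology T I). f y \<in> W}} = {x \<in> topspace (T i). f (i, x) \<in> W}"
    if "i \<in> I" for i using that by auto
  ultimately show "openin (sum_topology T I) {y \<in> topspace (sum_topology T I). f y \<in> W}"
    by (auto simp: openin_sum_topology)
qed

locale flow_family =
  fixes I :: "'i set" and X :: "'i \<Rightarrow> ('g::topological_group_add, 'x) gspace" and \<U> :: "'i filter"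
  assumes flows: "i \<in> I \<Longrightarrow> gflow (X i)"
    and ultrafilter: "\<U> \<in> ultrafilters I"
begin

abbreviation Y :: "('g, 'i \<times> 'x) gspace" where
  "Y \<equiv> disjoint_union I X"

lemma pts_Y: "(i, x) \<in> pts Y \<longleftrightarrow> i \<in> I \<and> x \<in> pts (X i)"
  by (simp add: disjoint_union_def)

lemma act_Y: "act Y g (i, x) = (i, act (X i) g x)"
  by (simp add: disjoint_union_def)

sublocale gspace_action Y
proof
  fix y :: "'i \<times> 'x" and g h :: 'g
  assume "y \<in> pts Y"
  then obtain i x where y: "y = (i, x)" "i \<in> I" "x \<in> pts (X i)" using pts_Y by (cases y) auto
  note f = flows[OF y(2)]
  show "act Y g y \<in> pts Y" "act Y 0 y = y" "act Y (g + h) y = act Y g (act Y h y)"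
    using act_in[OF f y(3)] gflowD(3,4)[OF f y(3)] y by (simp_all add: pts_Y act_Y)
next
  fix g :: 'g
  have "continuous_map (topol (X i)) (topol Y) (\<lambda>x. act Y g (i, x))" if "i \<in> I" for i
  proof -
    have inj: "continuous_map (topol (X i)) (topol Y) (Pair i)"
      unfolding disjoint_union_def gspace.simps
      using continuous_map_component_injection[of i I "\<lambda>i. topol (X i)"] that by simp
    have "continuous_map (topol (X i)) (topol Y) (Pair i \<circ> act (X i) g)"
      by (rule continuous_map_compose[OF act_continuous[OF flows[OF that]] inj])
    then show ?thesis by (simp add: o_def act_Y)
  qed
  then show "continuous_map (topol Y) (topol Y) (act Y g)"
    unfolding disjoint_union_def gspace.simps by (rule continuous_map_from_sum)
qed

lemma ultra_U: "ultra \<U>" and U_in_I: "eventually (\<lambda>i. i \<in> I) \<U>"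
  using ultrafilter by (auto simp: ultrafilters_def ultra_def)

text \<open>Functions on the factors belong to the algebra of the disjoint union once their bounds
  and their moduli along the action do not depend on \<open>i\<close>.\<close>

lemma C_G_glue:
  assumes cont: "\<And>i. i \<in> I \<Longrightarrow> continuous_map (topol (X i)) euclidean (r i)"
    and bd: "\<And>i x. i \<in> I \<Longrightarrow> x \<in> pts (X i) \<Longrightarrow> cmod (r i x) \<le> B"
    and eq: "\<And>g\<^sub>0 e. e > 0 \<Longrightarrow> eventually (\<lambda>g. \<forall>i\<in>I. \<forall>x\<in>pts (X i).
        dist (r i (act (X i) g x)) (r i (act (X i) g\<^sub>0 x)) < e) (nhds g\<^sub>0)"
  shows "(\<lambda>y\<in>pts Y. r (fst y) (snd y)) \<in> C_G Y"
proof (rule C_G_I)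
  have "continuous_map (topol Y) euclidean (\<lambda>y. r (fst y) (snd y))"
    unfolding disjoint_union_def gspace.simps by (rule continuous_map_from_sum) (simp add: cont)
  then show "continuous_map (topol Y) euclidean (\<lambda>y\<in>pts Y. r (fst y) (snd y))"
    by (rule continuous_map_eq) simp
  show "bounded ((\<lambda>y\<in>pts Y. r (fst y) (snd y)) ` pts Y)"
    unfolding bounded_iff using bd by (intro exI[of _ B]) (auto simp: pts_Y)
  fix e :: real and g\<^sub>0 assume e: "e > 0"
  from eq[OF e, of g\<^sub>0] show "eventually (\<lambda>g. \<forall>y\<in>pts Y. dist ((\<lambda>y\<in>pts Y. r (fst y) (snd y)) (act Y g y))
      ((\<lambda>y\<in>pts Y. r (fst y) (snd y)) (act Y g\<^sub>0 y)) < e) (nhds g\<^sub>0)"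
  proof eventually_elim
    case (elim g)
    show ?case
    proof
      fix y assume y: "y \<in> pts Y"
      obtain i x where ix: "y = (i, x)" "i \<in> I" "x \<in> pts (X i)" using y pts_Y by (cases y) auto
      show "dist ((\<lambda>y\<in>pts Y. r (fst y) (snd y)) (act Y g y)) ((\<lambda>y\<in>pts Y. r (fst y) (snd y)) (act Y g\<^sub>0 y)) < e"
        using elim ix act_pts[OF y] by (simp add: act_Y)
    qed
  qed
qed simp

text \<open>The action preserves each summand, so these indicators are invariant and lie in
  \<open>C_G\<close>. As idempotents they take only the values 0 and 1 under a character, and
  through them a character sees the index set.\<close>

definition ind :: "'i set \<Rightarrow> 'i \<times> 'x \<Rightarrow> complex" where
  "ind A = (\<lambda>y\<in>pts Y. if fst y \<in> A then 1 else 0)"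

lemma ind_C_G: "ind A \<in> C_G Y"
  unfolding ind_def by (rule C_G_glue[where B = 1]) auto

lemma ind_01: "\<phi> \<in> characters Y \<Longrightarrow> \<phi> (ind A) = 0 \<or> \<phi> (ind A) = 1"
  using characters_closed[OF _ ind_C_G, of \<phi> "{0, 1}" A] by (auto simp: ind_def)

lemma ind_mult: "\<phi> \<in> characters Y \<Longrightarrow> \<phi> (ind (A \<inter> B)) = \<phi> (ind A) * \<phi> (ind B)"
proof -
  have "ind (A \<inter> B) = (\<lambda>y\<in>pts Y. ind A y * ind B y)"
    unfolding ind_def by (rule restrict_ext) simp
  then show "\<phi> \<in> characters Y \<Longrightarrow> ?thesis" using characters_D(5)[OF _ ind_C_G ind_C_G] by simp
qed

lemma ind_Compl: "\<phi> \<in> characters Y \<Longrightarrow> \<phi> (ind A) + \<phi> (ind (- A)) = 1"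
proof -
  have "(\<lambda>y\<in>pts Y. 1) = (\<lambda>y\<in>pts Y. ind A y + ind (- A) y)"
    unfolding ind_def by (rule restrict_ext) simp
  then show "\<phi> \<in> characters Y \<Longrightarrow> ?thesis"
    using characters_D(4)[OF _ ind_C_G ind_C_G, of \<phi> A "- A"] characters_D(2)[of \<phi>] by simp
qed

lemma ind_superset:
  assumes "\<phi> \<in> characters Y" "A \<inter> I \<subseteq> B" "\<phi> (ind A) = 1"
  shows "\<phi> (ind B) = 1"
proof -
  have "ind A = ind (A \<inter> B)" using assms(2) pts_Y unfolding ind_def by (intro restrict_ext) auto
  then show ?thesis using ind_mult[OF assms(1), of A B] assms(3) by simp
qed

lemma ind_I: "\<phi> \<in> characters Y \<Longrightarrow> \<phi> (ind I) = 1"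
proof -
  have "ind I = (\<lambda>y\<in>pts Y. 1)" using pts_Y unfolding ind_def by (intro restrict_ext) auto
  then show "\<phi> \<in> characters Y \<Longrightarrow> ?thesis" using characters_D(2) by simp
qed

text \<open>An explicit form of the projection to \<beta> I: the sets \<open>A\<close> to whose
  indicator the character gives the value 1 form an ultrafilter.\<close>

definition base_filter :: "(('i \<times> 'x \<Rightarrow> complex) \<Rightarrow> complex) \<Rightarrow> 'i filter" where
  "base_filter \<phi> = Abs_filter (\<lambda>P. \<phi> (ind {i. P i}) = 1)"

lemma eventually_base_filter:
  assumes phi: "\<phi> \<in> characters Y"
  shows "eventually P (base_filter \<phi>) \<longleftrightarrow> \<phi> (ind {i. P i}) = 1"
  unfolding base_filter_def
proof (rule eventually_Abs_filter, unfold_locales)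
  show "\<phi> (ind {i. True}) = 1" using ind_superset[OF phi _ ind_I[OF phi], of UNIV] by simp
  fix P Q :: "'i \<Rightarrow> bool"
  show "\<phi> (ind {i. P i}) = 1 \<Longrightarrow> \<phi> (ind {i. Q i}) = 1 \<Longrightarrow> \<phi> (ind {i. P i \<and> Q i}) = 1"
    using ind_mult[OF phi, of "{i. P i}" "{i. Q i}"] by (simp add: Collect_conj_eq)
  show "\<forall>x. P x \<longrightarrow> Q x \<Longrightarrow> \<phi> (ind {i. P i}) = 1 \<Longrightarrow> \<phi> (ind {i. Q i}) = 1"
    using ind_superset[OF phi, of "{i. P i}" "{i. Q i}"] by auto
qed

lemma base_filter_ultra:
  assumes phi: "\<phi> \<in> characters Y"
  shows "ultra (base_filter \<phi>)" "base_filter \<phi> \<in> ultrafilters I"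
proof -
  have 1: "base_filter \<phi> \<noteq> bot"
    using ind_Compl[OF phi, of UNIV] ind_superset[OF phi _ ind_I[OF phi], of UNIV]
    by (simp add: trivial_limit_def eventually_base_filter[OF phi])
  have 2: "eventually P (base_filter \<phi>) \<or> eventually (\<lambda>x. \<not> P x) (base_filter \<phi>)" for P
    using ind_Compl[OF phi, of "{i. P i}"] ind_01[OF phi, of "{i. P i}"]
    by (auto simp: eventually_base_filter[OF phi] Collect_neg_eq)
  show "ultra (base_filter \<phi>)" using 1 2 by (simp add: ultra_def)
  show "base_filter \<phi> \<in> ultrafilters I"
    using 1 2 ind_I[OF phi] by (auto simp: ultrafilters_def eventually_base_filter[OF phi])
qed

lemma topspace_beta: "topspace (beta_space I) = ultrafilters I"
  unfolding beta_space_def topology_generated_by_topspace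
  by (auto simp: ultrafilters_def)

lemma beta_basis_open: "A \<subseteq> I \<Longrightarrow> openin (beta_space I) {\<V> \<in> ultrafilters I. eventually (\<lambda>i. i \<in> A) \<V>}"
  unfolding beta_space_def by (rule topology_generated_by_Basis) blast

lemma base_filter_continuous:
  "continuous_map (topol (alpha_G Y)) (beta_space I) base_filter"
  unfolding beta_space_def continuous_on_generated_topo_iff
proof (intro conjI allI impI)
  fix S assume "S \<in> {{\<U> \<in> ultrafilters I. eventually (\<lambda>i. i \<in> A) \<U>} |A. A \<subseteq> I}"
  then obtain A where A: "S = {\<U> \<in> ultrafilters I. eventually (\<lambda>i. i \<in> A) \<U>}" "A \<subseteq> I" by blast
  have "continuous_map (topol (alpha_G Y)) euclidean (\<lambda>\<phi>. \<phi> (ind A))"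
    unfolding alpha_G_def gspace.simps
    by (intro continuous_map_from_subtopology continuous_map_product_projection ind_C_G)
  then have "openin (topol (alpha_G Y)) {\<phi> \<in> pts (alpha_G Y). \<phi> (ind A) \<in> ball 1 1}"
    by (rule openin_continuous_map_preimage) simp
  moreover have "{\<phi> \<in> pts (alpha_G Y). \<phi> (ind A) \<in> ball 1 1} = base_filter -` S \<inter> pts (alpha_G Y)"
  proof (intro set_eqI)
    fix \<phi>
    show "\<phi> \<in> {\<phi> \<in> pts (alpha_G Y). \<phi> (ind A) \<in> ball 1 1} \<longleftrightarrow> \<phi> \<in> base_filter -` S \<inter> pts (alpha_G Y)"
    proof (cases "\<phi> \<in> characters Y")
      case True
      show ?thesis using ind_01[OF True, of A] base_filter_ultra(2)[OF True] True
        by (auto simp: topspace_alpha A(1) eventually_base_filter[OF True])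
    qed (simp add: topspace_alpha)
  qed
  ultimately show "openin (topol (alpha_G Y)) (base_filter -` S \<inter> pts (alpha_G Y))" by simp
next
  show "base_filter ` pts (alpha_G Y) \<subseteq> \<Union>{{\<U> \<in> ultrafilters I. eventually (\<lambda>i. i \<in> A) \<U>} |A. A \<subseteq> I}"
  proof
    fix \<V> assume "\<V> \<in> base_filter ` pts (alpha_G Y)"
    then have "\<V> \<in> ultrafilters I" using base_filter_ultra(2) topspace_alpha by auto
    moreover have "\<Union>{{\<U> \<in> ultrafilters I. eventually (\<lambda>i. i \<in> A) \<U>} |A. A \<subseteq> I} = ultrafilters I"
      using topspace_beta unfolding beta_space_def topology_generated_by_topspace .
    ultimately show "\<V> \<in> \<Union>{{\<U> \<in> ultrafilters I. eventually (\<lambda>i. i \<in> A) \<U>} |A. A \<subseteq> I}" by simp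
  qed
qed

lemma base_filter_point_eval:
  assumes "i \<in> I" "x \<in> pts (X i)"
  shows "base_filter (point_eval Y (i, x)) = principal {i}"
proof -
  have y: "(i, x) \<in> pts Y" using assms pts_Y by blast
  have "eventually P (base_filter (point_eval Y (i, x))) \<longleftrightarrow> P i" for P
    unfolding eventually_base_filter[OF point_eval_characters[OF y]]
  proof -
    have "point_eval Y (i, x) (ind {i. P i}) = ind {i. P i} (i, x)"
      using ind_C_G by (simp add: point_eval_def)
    also have "\<dots> = (if P i then 1 else 0)" using y by (simp add: ind_def)
    finally show "point_eval Y (i, x) (ind {i. P i}) = 1 \<longleftrightarrow> P i" by simp
  qed
  then show ?thesis by (auto simp: filter_eq_iff eventually_principal)
qed

text \<open>The explicit map satisfies the specification of \<open>pi_I\<close>. Uniqueness is the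
  usual density argument: two ultrafilters that differ are separated by a set and its complement,
  and evaluations are dense.\<close>

lemma pi_I_eq: "pi_I I X = restrict base_filter (characters Y)"
  unfolding pi_I_def
proof (rule the_equality)
  have "continuous_map (topol (alpha_G Y)) (beta_space I) (restrict base_filter (characters Y))"
    using base_filter_continuous by (rule continuous_map_eq) (simp add: topspace_alpha)
  then show "restrict base_filter (characters Y) \<in> extensional (pts (alpha_G Y)) \<and>
      continuous_map (topol (alpha_G Y)) (beta_space I) (restrict base_filter (characters Y)) \<and>
      (\<forall>i\<in>I. \<forall>x\<in>pts (X i). restrict base_filter (characters Y) (point_eval Y (i, x)) = principal {i})"
    using base_filter_point_eval point_eval_characters pts_Y by (simp add: topspace_alpha)
next
  fix \<pi> assume "\<pi> \<in> extensional (pts (alpha_G Y)) \<and> continuous_map (topol (alpha_G Y)) (beta_space I) \<pi> \<and>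
      (\<forall>i\<in>I. \<forall>x\<in>pts (X i). \<pi> (point_eval Y (i, x)) = principal {i})"
  then have pi: "\<pi> \<in> extensional (characters Y)" "continuous_map (topol (alpha_G Y)) (beta_space I) \<pi>"
    "\<And>i x. i \<in> I \<Longrightarrow> x \<in> pts (X i) \<Longrightarrow> \<pi> (point_eval Y (i, x)) = principal {i}" by (auto simp: topspace_alpha)
  have "\<pi> \<phi> = base_filter \<phi>" if phi: "\<phi> \<in> characters Y" for \<phi>
  proof (rule sym, rule ultra_eqI[OF base_filter_ultra(1)[OF phi]])
    have piU: "\<pi> \<phi> \<in> ultrafilters I"
      using continuous_map_image_subset_topspace[OF pi(2)] phi topspace_alpha topspace_beta by auto
    then show "\<pi> \<phi> \<noteq> bot" by (simp add: ultrafilters_def)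
    fix P assume P: "eventually P (base_filter \<phi>)"
    show "eventually P (\<pi> \<phi>)"
    proof (rule ccontr)
      assume "\<not> eventually P (\<pi> \<phi>)"
      then have "eventually (\<lambda>i. \<not> P i \<and> i \<in> I) (\<pi> \<phi>)"
        using piU by (auto simp: ultrafilters_def intro: eventually_conj)
      then have nP: "eventually (\<lambda>i. i \<in> {i \<in> I. \<not> P i}) (\<pi> \<phi>)" by eventually_elim auto
      have "eventually (\<lambda>i. i \<in> I) (base_filter \<phi>)"
        using base_filter_ultra(2)[OF phi] by (simp add: ultrafilters_def)
      with P have P': "eventually (\<lambda>i. i \<in> {i \<in> I. P i}) (base_filter \<phi>)" by eventually_elim auto
      let ?B = "\<lambda>A. {\<V> \<in> ultrafilters I. eventually (\<lambda>i. i \<in> A) \<V>}"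
      \<comment> \<open>On this open set the two candidates contain complementary sets, while an
        evaluation at a point over \<open>i\<close> is sent to \<open>principal {i}\<close> by
        both.\<close>
      let ?W = "{\<psi> \<in> pts (alpha_G Y). \<pi> \<psi> \<in> ?B {i \<in> I. \<not> P i}} \<inter>
        {\<psi> \<in> pts (alpha_G Y). base_filter \<psi> \<in> ?B {i \<in> I. P i}}"
      have "openin (topol (alpha_G Y)) ?W"
        by (intro openin_Int openin_continuous_map_preimage[OF pi(2)]
            openin_continuous_map_preimage[OF base_filter_continuous] beta_basis_open) auto
      moreover have "\<phi> \<in> ?W" using phi nP P' piU base_filter_ultra(2)[OF phi] by (simp add: topspace_alpha)
      ultimately obtain y where y: "y \<in> pts Y" "point_eval Y y \<in> ?W" using point_eval_dense by blast
      obtain i x where ix: "y = (i, x)" "i \<in> I" "x \<in> pts (X i)" using y(1) pts_Y by (cases y) auto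
      show False
        using y(2) unfolding ix(1)
        by (auto simp: pi(3)[OF ix(2,3)] base_filter_point_eval[OF ix(2,3)] eventually_principal)
    qed
  qed
  then show "\<pi> = restrict base_filter (characters Y)"
    using pi(1) by (intro extensionalityI[of _ "characters Y"]) auto
qed

section \<open>The fibre over the ultrafilter as a flow\<close>

definition Sg :: "(('i \<times> 'x \<Rightarrow> complex) \<Rightarrow> complex) set" where
  "Sg = {\<phi> \<in> characters Y. \<forall>A. eventually (\<lambda>i. i \<in> A) \<U> \<longrightarrow> \<phi> (ind A) = 1}"

lemma SgD:
  assumes "\<phi> \<in> Sg"
  shows "\<phi> \<in> characters Y" "eventually P \<U> \<Longrightarrow> \<phi> (ind {i. P i}) = 1"
  using assms by (auto simp: Sg_def)

lemma ultracoproduct_eq: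
  "ultracoproduct I X \<U> =
     \<lparr>topol = subtopology (product_topology (\<lambda>_. euclidean) (C_G Y)) Sg, act = act (alpha_G Y)\<rparr>"
proof -
  have "base_filter \<phi> = \<U> \<longleftrightarrow> \<phi> \<in> Sg" if phi: "\<phi> \<in> characters Y" for \<phi>
  proof
    assume "base_filter \<phi> = \<U>"
    then show "\<phi> \<in> Sg" using phi eventually_base_filter[OF phi, of "\<lambda>i. i \<in> _"] by (auto simp: Sg_def)
  next
    assume "\<phi> \<in> Sg"
    then have "\<U> = base_filter \<phi>"
      using base_filter_ultra(1)[OF phi] SgD(2)
      by (intro ultra_eqI[OF ultra_U]) (auto simp: eventually_base_filter[OF phi] ultra_def)
    then show "base_filter \<phi> = \<U>" by simp
  qed
  then have "{\<phi> \<in> pts (alpha_G Y). pi_I I X \<phi> = \<U>} = Sg"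
    unfolding topspace_alpha pi_I_eq using SgD(1) by auto
  moreover have "characters Y \<inter> Sg = Sg" using SgD(1) by blast
  ultimately show ?thesis
    unfolding ultracoproduct_def Let_def by (simp add: alpha_G_def subtopology_subtopology)
qed

lemma pts_ultracoproduct: "pts (ultracoproduct I X \<U>) = Sg"
  using SgD(1) characters_D(1) by (auto simp: ultracoproduct_eq PiE_def)

text \<open>Every choice of points in most factors converges to a point of the ultracoproduct; this
  is how counterexamples in the factors are collected into one.\<close>

lemma Sg_limit:
  assumes "eventually (\<lambda>i. x i \<in> pts (X i)) \<U>"
  shows "\<exists>\<phi>\<in>Sg. \<forall>p\<in>C_G Y. ((\<lambda>i. p (i, x i)) \<longlongrightarrow> \<phi> p) \<U>"
proof -
  have ev: "eventually (\<lambda>i. (i, x i) \<in> pts Y) \<U>"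
    using assms U_in_I by eventually_elim (simp add: pts_Y)
  have "eventually (\<lambda>i. point_eval Y (i, x i) \<in> characters Y) \<U>"
    using ev by eventually_elim (rule point_eval_characters)
  from characters_limit[OF ultra_U this] obtain \<phi> where phi0: "\<phi> \<in> characters Y"
      "\<forall>p\<in>C_G Y. ((\<lambda>i. point_eval Y (i, x i) p) \<longlongrightarrow> \<phi> p) \<U>" by (elim bexE)
  have phi: "\<phi> \<in> characters Y" "\<And>p. p \<in> C_G Y \<Longrightarrow> ((\<lambda>i. p (i, x i)) \<longlongrightarrow> \<phi> p) \<U>"
    using phi0 by (simp_all add: point_eval_def)
  have "\<phi> (ind A) = 1" if "eventually (\<lambda>i. i \<in> A) \<U>" for A
  proof -
    have "eventually (\<lambda>i. ind A (i, x i) = 1) \<U>" using that ev by eventually_elim (simp add: ind_def)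
    then have "((\<lambda>i. ind A (i, x i)) \<longlongrightarrow> 1) \<U>" by (rule tendsto_eventually)
    moreover have "\<U> \<noteq> bot" using ultra_U by (simp add: ultra_def)
    ultimately show ?thesis using phi(2)[OF ind_C_G] tendsto_unique by blast
  qed
  with phi show ?thesis by (auto simp: Sg_def)
qed

text \<open>The converse of \<open>Sg_limit\<close>: if approximating points were missing for most
  \<open>i\<close>, the indicator of these \<open>i\<close> could be added to the functions to be
  approximated and would force the approximating point to lie over such an \<open>i\<close>.\<close>

lemma Sg_approx:
  assumes phi: "\<phi> \<in> Sg" and P: "finite P" "P \<subseteq> C_G Y" and e: "e > 0"
  shows "eventually (\<lambda>i. i \<in> I \<and> (\<exists>x\<in>pts (X i). \<forall>p\<in>P. dist (p (i, x)) (\<phi> p) < e)) \<U>"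
proof (rule ccontr)
  let ?A = "{i. \<not> (i \<in> I \<and> (\<exists>x\<in>pts (X i). \<forall>p\<in>P. dist (p (i, x)) (\<phi> p) < e))}"
  assume "\<not> ?thesis"
  then have "eventually (\<lambda>i. \<not> (i \<in> I \<and> (\<exists>x\<in>pts (X i). \<forall>p\<in>P. dist (p (i, x)) (\<phi> p) < e))) \<U>"
    using ultra_not[OF ultra_U] by blast
  from SgD(2)[OF phi this] have A: "\<phi> (ind ?A) = 1" .
  \<comment> \<open>Tolerance 1 suffices for the indicator, whose values are 0 and 1.\<close>
  obtain y where y: "y \<in> pts Y" "\<forall>p\<in>insert (ind ?A) P. dist (p y) (\<phi> p) < min e 1"
    using characters_approx[OF SgD(1)[OF phi], of "insert (ind ?A) P" "min e 1"] P e ind_C_G by auto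
  obtain i x where ix: "y = (i, x)" "i \<in> I" "x \<in> pts (X i)" using y(1) pts_Y by (cases y) auto
  have "i \<in> ?A" using y A by (auto simp: ind_def ix(1) split: if_splits)
  then show False using ix y(2) by auto
qed

lemma act_Sg:
  assumes "\<phi> \<in> Sg"
  shows "act (alpha_G Y) g \<phi> \<in> Sg"
proof -
  have "translate Y (ind A) g = ind A" for A
    unfolding translate_def ind_def
  proof (rule restrict_ext)
    fix y assume y: "y \<in> pts Y"
    then show "(\<lambda>y\<in>pts Y. if fst y \<in> A then 1 else 0) (act Y g y) = (if fst y \<in> A then 1 else (0::complex))"
      using act_pts[OF y, of g] by (cases y) (simp add: act_Y)
  qed
  then show ?thesis
    using assms act_alpha_characters[OF SgD(1)[OF assms], of g] by (auto simp: Sg_def act_alpha ind_C_G)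
qed

lemma limitin_Sg:
  assumes "\<phi> \<in> Sg" "eventually (\<lambda>a. f a \<in> Sg) F" "\<And>p. p \<in> C_G Y \<Longrightarrow> ((\<lambda>a. f a p) \<longlongrightarrow> \<phi> p) F"
  shows "limitin (subtopology (product_topology (\<lambda>_. euclidean) (C_G Y)) Sg) f \<phi> F"
proof -
  have "eventually (\<lambda>a. f a \<in> extensional (C_G Y)) F"
    using assms(2) by eventually_elim (auto dest: SgD(1) characters_D(1))
  then show ?thesis
    unfolding limitin_subtopology limitin_componentwise
    using assms characters_D(1)[OF SgD(1)[OF assms(1)]] by (auto simp: PiE_def)
qed

lemma Sg_compact: "compact_space (topol (ultracoproduct I X \<U>))"
proof (rule compact_space_ultraI)
  fix V :: "(('i \<times> 'x \<Rightarrow> complex) \<Rightarrow> complex) filter"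
  assume V: "ultra V" and "eventually (\<lambda>\<phi>. \<phi> \<in> pts (ultracoproduct I X \<U>)) V"
  then have ev: "eventually (\<lambda>\<phi>. \<phi> \<in> Sg) V" by (simp add: pts_ultracoproduct)
  have "eventually (\<lambda>\<phi>. \<phi> \<in> characters Y) V" using ev by eventually_elim (rule SgD(1))
  from characters_limit[OF V this] obtain \<psi> where psi0: "\<psi> \<in> characters Y"
      "\<forall>p\<in>C_G Y. ((\<lambda>\<phi>. \<phi> p) \<longlongrightarrow> \<psi> p) V" by (elim bexE)
  have lim: "((\<lambda>\<phi>. \<phi> p) \<longlongrightarrow> \<psi> p) V" if "p \<in> C_G Y" for p using psi0(2) that by blast
  have "\<psi> (ind A) = 1" if A: "eventually (\<lambda>i. i \<in> A) \<U>" for A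
  proof -
    have "eventually (\<lambda>\<phi>. \<phi> (ind A) = 1) V" using ev by eventually_elim (use A in \<open>simp add: Sg_def\<close>)
    then have "((\<lambda>\<phi>. \<phi> (ind A)) \<longlongrightarrow> 1) V" by (rule tendsto_eventually)
    moreover have "V \<noteq> bot" using V by (simp add: ultra_def)
    ultimately show ?thesis using lim[OF ind_C_G] tendsto_unique by blast
  qed
  with psi0(1) have psi: "\<psi> \<in> Sg" by (simp add: Sg_def)
  have "limitin (topol (ultracoproduct I X \<U>)) (\<lambda>\<phi>. \<phi>) \<psi> V"
    unfolding ultracoproduct_eq gspace.simps by (rule limitin_Sg[OF psi ev lim])
  then show "\<exists>l\<in>pts (ultracoproduct I X \<U>). \<forall>W. openin (topol (ultracoproduct I X \<U>)) W \<longrightarrow> l \<in> W \<longrightarrow> eventually (\<lambda>\<phi>. \<phi> \<in> W) V"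
    unfolding limitin_def by blast
qed

text \<open>Joint continuity of the action comes from the uniformity built into \<open>C_G\<close>:
  characters are contractive, so a small change of \<open>translate Y p g\<close> in sup norm
  changes all their values by little.\<close>

lemma ultracoproduct_gflow: "gflow (ultracoproduct I X \<U>)"
  unfolding gflow_def
proof (intro conjI allI ballI)
  let ?S = "ultracoproduct I X \<U>"
  have act: "act ?S = act (alpha_G Y)" by (simp add: ultracoproduct_eq)
  show "compact_space (topol ?S)" by (rule Sg_compact)
  show "Hausdorff_space (topol ?S)"
    unfolding ultracoproduct_eq gspace.simps
    by (rule Hausdorff_space_subtopology) (simp add: Hausdorff_space_product_topology)
  fix \<phi> assume "\<phi> \<in> pts ?S"
  then have phi: "\<phi> \<in> Sg" by (simp add: pts_ultracoproduct)
  note ext = characters_D(1)[OF SgD(1)]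
  have t0: "translate Y p 0 = p" if "p \<in> C_G Y" for p
    using C_G_D(1)[OF that] act_zero by (intro extensionalityI[of _ "pts Y"]) (auto simp: translate_def)
  show "act ?S 0 \<phi> = \<phi>" unfolding act
    using ext[OF phi] ext[OF act_Sg[OF phi]] t0 by (intro extensionalityI[of _ "C_G Y"]) (auto simp: act_alpha)
  fix g h :: 'g
  have tt: "translate Y p (g + h) = translate Y (translate Y p g) h" for p
    unfolding translate_def by (rule restrict_ext) (simp add: act_add act_pts)
  show "act ?S (g + h) \<phi> = act ?S g (act ?S h \<phi>)" unfolding act
    using ext[OF act_Sg[OF phi]] ext[OF act_Sg[OF act_Sg[OF phi]]] tt
    by (intro extensionalityI[of _ "C_G Y"]) (auto simp: act_alpha translate_C_G)
next
  let ?S = "ultracoproduct I X \<U>"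
  let ?P = "prod_topology euclidean (topol ?S)"
  have "continuous_map ?P euclidean (\<lambda>(g, \<phi>). \<phi> (translate Y p g))" if p: "p \<in> C_G Y" for p
  proof (rule joint_continuity)
    show "continuous_map (topol ?S) euclidean (\<lambda>\<phi>. \<phi> (translate Y p g))" for g
      unfolding ultracoproduct_eq gspace.simps
      by (rule continuous_map_from_subtopology) (rule continuous_map_product_projection, rule translate_C_G[OF p])
    fix g0 :: 'g and e :: real assume e: "e > 0"
    from C_G_D(4)[OF p half_gt_zero[OF e], of g0]
    show "eventually (\<lambda>g. \<forall>\<phi>\<in>pts ?S. dist (\<phi> (translate Y p g)) (\<phi> (translate Y p g0)) < e) (nhds g0)"
    proof eventually_elim
      case (elim g)
      show ?case
      proof
        fix \<phi> assume "\<phi> \<in> pts ?S"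
        then have ch: "\<phi> \<in> characters Y" using SgD(1) by (simp add: pts_ultracoproduct)
        have "dist (\<phi> (translate Y p g)) (\<phi> (translate Y p g0)) \<le> e/2"
          by (rule characters_dist[OF ch translate_C_G[OF p] translate_C_G[OF p]])
            (use elim in \<open>auto simp: translate_def less_imp_le\<close>)
        then show "dist (\<phi> (translate Y p g)) (\<phi> (translate Y p g0)) < e" using e by simp
      qed
    qed
  qed
  then have c: "continuous_map ?P euclidean (\<lambda>z. (case z of (g, \<phi>) \<Rightarrow> act ?S g \<phi>) p)" if "p \<in> C_G Y" for p
    using that by (simp add: ultracoproduct_eq act_alpha case_prod_unfold)
  have img: "(\<lambda>(g, \<phi>). act ?S g \<phi>) ` topspace ?P \<subseteq> Sg"
    using act_Sg by (auto simp: pts_ultracoproduct) (simp add: ultracoproduct_eq)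
  have "continuous_map ?P (product_topology (\<lambda>_. euclidean) (C_G Y)) (\<lambda>(g, \<phi>). act ?S g \<phi>)"
    unfolding continuous_map_componentwise
  proof (intro conjI ballI)
    show "(\<lambda>(g, \<phi>). act ?S g \<phi>) ` topspace ?P \<subseteq> extensional (C_G Y)"
      using img SgD(1) characters_D(1) by blast
  qed (rule c)
  then show "continuous_map ?P (topol ?S) (\<lambda>(g, \<phi>). act ?S g \<phi>)"
    using img by (subst (2) ultracoproduct_eq) (auto simp: continuous_map_in_subtopology)
qed

end

subsection \<open>Transfer from the ultracoproduct to the factors\<close>

locale lrpc_family = lrpc_setup \<N> \<N>\<^sub>0 G\<^sub>0 \<zeta> + flow_family I X \<U>
  for \<N> :: "'g::topological_group_add set set" and \<N>\<^sub>0 G\<^sub>0 \<zeta>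
    and I :: "'i set" and X :: "'i \<Rightarrow> ('g, 'x) gspace" and \<U>
begin

section \<open>Functions with values in the unit interval and their action on characters\<close>

definition RC :: "('i \<times> 'x \<Rightarrow> complex) set" where
  "RC = {p \<in> C_G Y. \<forall>y\<in>pts Y. p y \<in> complex_of_real ` {0..1}}"

lemma RC_D: "p \<in> RC \<Longrightarrow> p \<in> C_G Y"
  by (simp add: RC_def)

lemma RC_real: "p \<in> RC \<Longrightarrow> y \<in> pts Y \<Longrightarrow> p y = of_real (Re (p y)) \<and> 0 \<le> Re (p y) \<and> Re (p y) \<le> 1"
  unfolding RC_def by auto

lemma RC_character:
  assumes p: "p \<in> RC" and phi: "\<phi> \<in> characters Y"
  shows "\<phi> p = of_real (Re (\<phi> p)) \<and> 0 \<le> Re (\<phi> p) \<and> Re (\<phi> p) \<le> 1"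
proof -
  have "closed (complex_of_real ` {0..1})"
    by (intro compact_imp_closed compact_continuous_image continuous_intros) auto
  then have "\<phi> p \<in> complex_of_real ` {0..1}"
    by (rule characters_closed[OF phi RC_D[OF p]]) (use p in \<open>auto simp: RC_def\<close>)
  then show ?thesis by auto
qed

lemma RC_comp2:
  fixes h :: "real \<Rightarrow> real \<Rightarrow> real"
  assumes p: "p \<in> RC" and q: "q \<in> RC"
    and h: "continuous_on UNIV (\<lambda>z :: complex \<times> complex. h (Re (fst z)) (Re (snd z)))"
    and range: "\<And>a b. a \<in> {0..1} \<Longrightarrow> b \<in> {0..1} \<Longrightarrow> h a b \<in> {0..1}"
  shows "\<exists>r\<in>RC. \<forall>\<phi>\<in>characters Y. Re (\<phi> r) = h (Re (\<phi> p)) (Re (\<phi> q))"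
proof -
  let ?h = "\<lambda>z :: complex \<times> complex. complex_of_real (h (Re (fst z)) (Re (snd z)))"
  have h': "continuous_on UNIV ?h" using h by (intro continuous_on_of_real)
  let ?r = "\<lambda>y\<in>pts Y. ?h (p y, q y)"
  have "?r y \<in> complex_of_real ` {0..1}" if "y \<in> pts Y" for y
    using range[of "Re (p y)" "Re (q y)"] RC_real[OF p that] RC_real[OF q that] that by auto
  then have "?r \<in> RC" using C_G_comp2[OF RC_D[OF p] RC_D[OF q] h'] by (simp only: RC_def) blast
  moreover have "Re (\<phi> ?r) = h (Re (\<phi> p)) (Re (\<phi> q))" if "\<phi> \<in> characters Y" for \<phi>
    using characters_comp2[OF that RC_D[OF p] RC_D[OF q] h'] by simp
  ultimately show ?thesis by blast
qed

lemma RC_const: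
  assumes "c \<in> {0..1}"
  shows "\<exists>r\<in>RC. \<forall>\<phi>\<in>characters Y. Re (\<phi> r) = c"
proof (rule bexI)
  show "(\<lambda>y\<in>pts Y. complex_of_real c) \<in> RC" using assms C_G_const by (auto simp: RC_def)
  show "\<forall>\<phi>\<in>characters Y. Re (\<phi> (\<lambda>y\<in>pts Y. complex_of_real c)) = c"
    by (rule ballI) (simp only: characters_const Re_complex_of_real)
qed

lemma RC_bump:
  assumes p: "p \<in> C_G Y" and phi: "\<phi> \<in> characters Y" and W: "open W" "\<phi> p \<in> W"
  shows "\<exists>r\<in>RC. Re (\<phi> r) = 1 \<and> (\<forall>\<psi>\<in>characters Y. \<psi> p \<notin> W \<longrightarrow> Re (\<psi> r) = 0)"
proof -
  obtain e where e: "e > 0" "ball (\<phi> p) e \<subseteq> W" using W open_contains_ball by blast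
  let ?h = "\<lambda>z :: complex \<times> complex. complex_of_real (max 0 (1 - dist (\<phi> p) (fst z) / e))"
  have h: "continuous_on UNIV ?h" using e by (intro continuous_intros) auto
  let ?r = "\<lambda>y\<in>pts Y. ?h (p y, p y)"
  have "max 0 (1 - dist (\<phi> p) a / e) \<in> {0..1}" for a using e by auto
  then have "?r \<in> RC" using C_G_comp2[OF p p h] unfolding RC_def by auto
  moreover have r: "Re (\<psi> ?r) = max 0 (1 - dist (\<phi> p) (\<psi> p) / e)" if "\<psi> \<in> characters Y" for \<psi>
    using characters_comp2[OF that p p h] by simp
  moreover have "max 0 (1 - dist (\<phi> p) (\<psi> p) / e) = 0" if "\<psi> p \<notin> W" for \<psi>
  proof -
    have "\<psi> p \<notin> ball (\<phi> p) e" using that e by blast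
    then show ?thesis using e by simp
  qed
  ultimately show ?thesis using phi by (intro bexI[of _ ?r]) auto
qed

abbreviation \<Sigma> :: "('g, ('i \<times> 'x \<Rightarrow> complex) \<Rightarrow> complex) gspace" where
  "\<Sigma> \<equiv> ultracoproduct I X \<U>"

lemma Sigma_eval_continuous:
  assumes "p \<in> C_G Y"
  shows "continuous_map (topol \<Sigma>) euclideanreal (\<lambda>\<phi>. Re (\<phi> p))"
proof -
  have "continuous_map (topol \<Sigma>) euclidean (\<lambda>\<phi>. \<phi> p)"
    unfolding ultracoproduct_eq gspace.simps
    by (rule continuous_map_from_subtopology) (rule continuous_map_product_projection, rule assms)
  moreover have "continuous_map euclidean euclideanreal Re" by (simp add: continuous_intros)
  ultimately have "continuous_map (topol \<Sigma>) euclideanreal (Re \<circ> (\<lambda>\<phi>. \<phi> p))" by (rule continuous_map_compose)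
  then show ?thesis by (simp add: o_def)
qed

lemma act_Sigma: "p \<in> C_G Y \<Longrightarrow> act \<Sigma> g \<phi> p = \<phi> (translate Y p g)"
  by (simp add: ultracoproduct_eq act_alpha)

text \<open>Urysohn's lemma for the ultracoproduct would give an arbitrary continuous function. Here
  the separating function is the trace of a function on the disjoint union, so that it can be read
  on every factor.\<close>

lemma Sigma_separation:
  assumes K: "closedin (topol \<Sigma>) K" and D: "openin (topol \<Sigma>) D" and KD: "K \<subseteq> D"
  shows "\<exists>p\<in>RC. (\<forall>\<phi>\<in>K. Re (\<phi> p) = 1) \<and> (\<forall>\<phi>\<in>Sg - D. Re (\<phi> p) = 0)"
proof -
  let ?T = "subtopology (product_topology (\<lambda>_. euclidean) (C_G Y)) Sg"
  let ?F = "(\<lambda>p \<phi>. Re (\<phi> p)) ` RC"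
  have T: "topol \<Sigma> = ?T" by (simp add: ultracoproduct_eq)
  have ts: "topspace ?T = Sg" using pts_ultracoproduct by (simp add: T)
  have h: "continuous_on UNIV (\<lambda>z :: complex \<times> complex. max (Re (fst z)) (Re (snd z)))"
    "continuous_on UNIV (\<lambda>z :: complex \<times> complex. min (Re (fst z)) (Re (snd z)))"
    "continuous_on UNIV (\<lambda>z :: complex \<times> complex. min 1 (2 * Re (fst z)))"
    by (intro continuous_intros)+
  have max01: "max a b \<in> {0..1}" and min01: "min a b \<in> {0..1}"
    if "a \<in> {0..1}" "b \<in> {0..1}" for a b :: real
    using that by (auto simp: max_def min_def)
  have dbl01: "\<And>(a :: real) (b :: real). a \<in> {0..1} \<Longrightarrow> b \<in> {0..1} \<Longrightarrow> min 1 (2 * a) \<in> {0..1}" by auto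
  have c1: "compact_space ?T" using Sg_compact by (simp add: T)
  have c2: "continuous_map ?T euclideanreal f" if "f \<in> ?F" for f
    using that Sigma_eval_continuous RC_D by (auto simp: T[symmetric])
  have c3: "\<exists>f\<in>?F. \<forall>z\<in>topspace ?T. f z = 0" using RC_const[of 0] SgD(1) by (auto simp: ts)
  have c4: "\<exists>f\<in>?F. \<forall>z\<in>topspace ?T. f z = 1" using RC_const[of 1] SgD(1) by (auto simp: ts)
  have c5: "\<exists>l\<in>?F. \<forall>z\<in>topspace ?T. l z = max (f z) (k z)" if fk: "f \<in> ?F" "k \<in> ?F" for f k
  proof -
    obtain p q where pq: "p \<in> RC" "q \<in> RC" "f = (\<lambda>\<phi>. Re (\<phi> p))" "k = (\<lambda>\<phi>. Re (\<phi> q))" using fk by blast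
    obtain r where "r \<in> RC" "\<forall>\<phi>\<in>characters Y. Re (\<phi> r) = max (Re (\<phi> p)) (Re (\<phi> q))"
      using RC_comp2[OF pq(1,2), of max, OF h(1) max01] by blast
    then show ?thesis
      using SgD(1) unfolding ts pq by (intro bexI[of _ "\<lambda>\<phi>. Re (\<phi> r)"]) auto
  qed
  have c6: "\<exists>l\<in>?F. \<forall>z\<in>topspace ?T. l z = min (f z) (k z)" if fk: "f \<in> ?F" "k \<in> ?F" for f k
  proof -
    obtain p q where pq: "p \<in> RC" "q \<in> RC" "f = (\<lambda>\<phi>. Re (\<phi> p))" "k = (\<lambda>\<phi>. Re (\<phi> q))" using fk by blast
    obtain r where "r \<in> RC" "\<forall>\<phi>\<in>characters Y. Re (\<phi> r) = min (Re (\<phi> p)) (Re (\<phi> q))"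
      using RC_comp2[OF pq(1,2), of min, OF h(2) min01] by blast
    then show ?thesis
      using SgD(1) unfolding ts pq by (intro bexI[of _ "\<lambda>\<phi>. Re (\<phi> r)"]) auto
  qed
  have c7: "\<exists>k\<in>?F. \<forall>z\<in>topspace ?T. k z = min 1 (2 * f z)" if "f \<in> ?F" for f
  proof -
    obtain p where p: "p \<in> RC" "f = (\<lambda>\<phi>. Re (\<phi> p))" using \<open>f \<in> ?F\<close> by blast
    have dbl: "\<exists>r\<in>RC. \<forall>\<phi>\<in>characters Y. Re (\<phi> r) = min 1 (2 * Re (\<phi> p))"
      by (rule RC_comp2[OF p(1,1), of "\<lambda>a b. min 1 (2 * a)"]) (rule h(3), rule dbl01)
    obtain r where "r \<in> RC" "\<forall>\<phi>\<in>characters Y. Re (\<phi> r) = min 1 (2 * Re (\<phi> p))"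
      using dbl by blast
    then show ?thesis
      using SgD(1) unfolding ts p by (intro bexI[of _ "\<lambda>\<phi>. Re (\<phi> r)"]) auto
  qed
  have c8: "f z \<in> {0..1}" if "f \<in> ?F" "z \<in> topspace ?T" for f z
    using RC_character[OF _ SgD(1)] that unfolding ts by auto
  have c9: "\<exists>f\<in>?F. f z > 1/2 \<and> (\<forall>z'\<in>topspace ?T. z' k \<notin> W \<longrightarrow> f z' = 0)"
    if k: "k \<in> C_G Y" and z: "z \<in> topspace ?T" and W: "open W" "z k \<in> W" for k z and W :: "complex set"
  proof -
    have z': "z \<in> characters Y" using z SgD(1) unfolding ts by simp
    obtain r where "r \<in> RC" "Re (z r) = 1" "\<forall>\<psi>\<in>characters Y. \<psi> k \<notin> W \<longrightarrow> Re (\<psi> r) = 0"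
      using RC_bump[OF k z' W] by auto
    then show ?thesis
      using SgD(1) unfolding ts by (intro bexI[of _ "\<lambda>\<phi>. Re (\<phi> r)"]) auto
  qed
  have "\<exists>f\<in>?F. (\<forall>z\<in>K. f z = 1) \<and> (\<forall>z\<in>topspace ?T - D. f z = 0)"
    by (rule lattice_separation[of "C_G Y" Sg ?F K D]) (fact c1 c2 c3 c4 c5 c6 c7 c8 c9 K[unfolded T] D[unfolded T] KD)+
  then show ?thesis unfolding ts by blast
qed

lemma C_G_small_displacement:
  assumes p: "p \<in> C_G Y" and e: "e > 0"
  shows "\<exists>V. open V \<and> 0 \<in> V \<and> (\<forall>a\<in>V. \<forall>i\<in>I. \<forall>x\<in>pts (X i). \<bar>Re (p (i, act (X i) a x)) - Re (p (i, x))\<bar> < e)"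
proof -
  obtain V where V: "open V" "0 \<in> V" "\<And>a y. a \<in> V \<Longrightarrow> y \<in> pts Y \<Longrightarrow> dist (p (act Y a y)) (p (act Y 0 y)) < e"
    using C_G_D(4)[OF p e, of 0] unfolding eventually_nhds by blast
  have "\<bar>Re (p (i, act (X i) a x)) - Re (p (i, x))\<bar> < e" if "a \<in> V" "i \<in> I" "x \<in> pts (X i)" for a i x
  proof -
    have y: "(i, x) \<in> pts Y" using that pts_Y by blast
    have "dist (p (i, act (X i) a x)) (p (i, x)) < e" using V(3)[OF that(1) y] act_zero[OF y] by (simp add: act_Y)
    then show ?thesis
      unfolding dist_norm using abs_Re_le_cmod[of "p (i, act (X i) a x) - p (i, x)"] by simp
  qed
  then show ?thesis using V(1,2) by (intro exI[of _ V]) simp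
qed

lemma slice_continuous:
  assumes p: "p \<in> C_G Y" and i: "i \<in> I"
  shows "continuous_map (topol (X i)) euclideanreal (\<lambda>x. Re (p (i, x)))"
proof -
  have "continuous_map (topol (X i)) (topol Y) (Pair i)"
    unfolding disjoint_union_def gspace.simps
    using continuous_map_component_injection[of i I "\<lambda>i. topol (X i)"] i by simp
  from continuous_map_compose[OF this C_G_D(2)[OF p]]
  have "continuous_map (topol (X i)) euclidean (p \<circ> Pair i)" .
  moreover have "continuous_map euclidean euclideanreal Re" by (simp add: continuous_intros)
  ultimately have "continuous_map (topol (X i)) euclideanreal (Re \<circ> (p \<circ> Pair i))" by (rule continuous_map_compose)
  then show ?thesis by (simp add: o_def)
qed

lemma Sg_limit_ge:
  assumes "eventually (\<lambda>i. P i (x i)) \<U>" "\<And>i z. P i z \<Longrightarrow> i \<in> I \<Longrightarrow> z \<in> pts (X i)"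
  shows "\<exists>\<phi>\<in>Sg. (\<forall>p\<in>C_G Y. \<forall>t. (\<forall>i\<in>I. \<forall>z. P i z \<longrightarrow> Re (p (i, z)) \<ge> t) \<longrightarrow> Re (\<phi> p) \<ge> t) \<and>
     (\<forall>p\<in>C_G Y. \<forall>t. (\<forall>i\<in>I. \<forall>z. P i z \<longrightarrow> Re (p (i, z)) \<le> t) \<longrightarrow> Re (\<phi> p) \<le> t)"
proof -
  have nb: "\<U> \<noteq> bot" using ultra_U by (simp add: ultra_def)
  have "eventually (\<lambda>i. x i \<in> pts (X i)) \<U>" using assms(1) U_in_I by eventually_elim (rule assms(2))
  then obtain \<phi> where phi: "\<phi> \<in> Sg" "\<And>p. p \<in> C_G Y \<Longrightarrow> ((\<lambda>i. p (i, x i)) \<longlongrightarrow> \<phi> p) \<U>"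
    using Sg_limit by blast
  have "Re (\<phi> p) \<ge> t" if "p \<in> C_G Y" "\<forall>i\<in>I. \<forall>z. P i z \<longrightarrow> Re (p (i, z)) \<ge> t" for p t
  proof (rule tendsto_lowerbound[OF tendsto_Re[OF phi(2)[OF that(1)]] _ nb])
    show "eventually (\<lambda>i. t \<le> Re (p (i, x i))) \<U>" using assms(1) U_in_I by eventually_elim (use that in blast)
  qed
  moreover have "Re (\<phi> p) \<le> t" if "p \<in> C_G Y" "\<forall>i\<in>I. \<forall>z. P i z \<longrightarrow> Re (p (i, z)) \<le> t" for p t
  proof (rule tendsto_upperbound[OF tendsto_Re[OF phi(2)[OF that(1)]] _ nb])
    show "eventually (\<lambda>i. Re (p (i, x i)) \<le> t) \<U>" using assms(1) U_in_I by eventually_elim (use that in blast)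
  qed
  ultimately show ?thesis using phi(1) by blast
qed

text \<open>Roelcke precompactness of \<open>A\<close> replaces group elements \<open>u \<in> A\<close> that vary with \<open>i\<close> by a single
  \<open>f\<close> along the ultrafilter, up to displacements that the functions do not see.\<close>

lemma edge_transfer:
  assumes A: "A \<in> N_RPC \<N>" and p: "p \<in> C_G Y" and q: "q \<in> C_G Y"
    and disj: "\<And>\<phi> u. \<phi> \<in> Sg \<Longrightarrow> u \<in> A \<Longrightarrow> \<not> (Re (\<phi> p) > 0 \<and> Re (act \<Sigma> (u + g) \<phi> q) > 0)"
  shows "eventually (\<lambda>i. \<forall>x\<in>pts (X i). \<forall>u\<in>A.
    \<not> (Re (p (i, x)) > 1/4 \<and> Re (q (i, act (X i) (u + g) x)) > 1/4)) \<U>"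
proof (rule ccontr)
  assume "\<not> ?thesis"
  then have ev: "eventually (\<lambda>i. \<not> (\<forall>x\<in>pts (X i). \<forall>u\<in>A.
    \<not> (Re (p (i, x)) > 1/4 \<and> Re (q (i, act (X i) (u + g) x)) > 1/4))) \<U>"
    using ultra_not[OF ultra_U] by blast
  \<comment> \<open>Values of \<open>p\<close> are displaced by \<open>b\<close> and
    \<open>b'\<close>, those of \<open>q\<close> by \<open>a'\<close> and \<open>a\<close>. Two
    errors below 1/16 leave at least 1/8 of a value above 1/4.\<close>
  obtain V1 where V1: "open V1" "0 \<in> V1" "\<And>a i x. a \<in> V1 \<Longrightarrow> i \<in> I \<Longrightarrow> x \<in> pts (X i) \<Longrightarrow>
      \<bar>Re (p (i, act (X i) a x)) - Re (p (i, x))\<bar> < 1/16"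
    using C_G_small_displacement[OF p, of "1/16"] by auto
  obtain V2 where V2: "open V2" "0 \<in> V2" "\<And>a i x. a \<in> V2 \<Longrightarrow> i \<in> I \<Longrightarrow> x \<in> pts (X i) \<Longrightarrow>
      \<bar>Re (q (i, act (X i) a x)) - Re (q (i, x))\<bar> < 1/16"
    using C_G_small_displacement[OF q, of "1/16"] by auto
  let ?V = "V1 \<inter> V2"
  have V: "open ?V" "0 \<in> ?V" using V1 V2 by auto
  obtain W where W: "W \<in> \<N>\<^sub>0" "W \<subseteq> ?V" using N0_base[OF V] by blast
  obtain F where F: "finite F" "\<And>u. u \<in> A \<Longrightarrow> \<exists>a\<in>W. \<exists>f\<in>F. \<exists>b\<in>W. u + g = a + f + b"
    "\<And>f. f \<in> F \<Longrightarrow> \<exists>a\<in>?V. \<exists>u\<in>A. \<exists>b\<in>?V. f = a + u + g + b"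
    using RPC_cover[OF A W(1) V] by metis
  let ?Q = "\<lambda>f i. \<exists>x\<in>pts (X i). \<exists>a\<in>W. \<exists>b\<in>W. Re (p (i, x)) > 1/4 \<and> Re (q (i, act (X i) (a + f + b) x)) > 1/4"
  have "eventually (\<lambda>i. \<exists>f\<in>F. ?Q f i) \<U>"
    using ev
  proof eventually_elim
    case (elim i)
    then obtain x u where xu: "x \<in> pts (X i)" "u \<in> A" "Re (p (i, x)) > 1/4" "Re (q (i, act (X i) (u + g) x)) > 1/4" by blast
    obtain a f b where afb: "a \<in> W" "f \<in> F" "b \<in> W" "u + g = a + f + b" using F(2)[OF xu(2)] by blast
    show ?case using xu(1,3,4) afb(1-3) unfolding afb(4) by blast
  qed
  then obtain f where f: "f \<in> F" "eventually (?Q f) \<U>"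
    using ultra_finite_bex[OF ultra_U F(1), of ?Q] by blast
  \<comment> \<open>The fixed \<open>f\<close> is brought back to a fixed \<open>u \<in> A\<close>.
    The limit of the displaced points then contradicts \<open>disj\<close> for this
    \<open>u\<close>.\<close>
  obtain a' u b' where f': "a' \<in> ?V" "u \<in> A" "b' \<in> ?V" "f = a' + u + g + b'" using F(3)[OF f(1)] by blast
  let ?P = "\<lambda>i z. z \<in> pts (X i) \<and> Re (p (i, z)) \<ge> 1/8 \<and> Re (q (i, act (X i) (u + g) z)) \<ge> 1/8"
  have "eventually (\<lambda>i. \<exists>z. ?P i z) \<U>"
    using f(2) U_in_I
  proof eventually_elim
    case (elim i)
    then obtain x a b where x: "x \<in> pts (X i)" "a \<in> W" "b \<in> W" "Re (p (i, x)) > 1/4"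
      "Re (q (i, act (X i) (a + f + b) x)) > 1/4" by blast
    note fl = flows[OF elim(2)]
    let ?x1 = "act (X i) b x" let ?z = "act (X i) b' ?x1" let ?y = "act (X i) (u + g) ?z"
    have in1: "?x1 \<in> pts (X i)" "?z \<in> pts (X i)" "?y \<in> pts (X i)" "act (X i) a' ?y \<in> pts (X i)"
      using x(1) act_in[OF fl] by auto
    have "\<bar>Re (p (i, ?x1)) - Re (p (i, x))\<bar> < 1/16" "\<bar>Re (p (i, ?z)) - Re (p (i, ?x1))\<bar> < 1/16"
      using V1(3)[OF _ elim(2)] x(1,3) W(2) f'(3) in1(1) by blast+
    then have 1: "Re (p (i, ?z)) \<ge> 1/8" using x(4) by linarith
    have eq: "act (X i) (a + f + b) x = act (X i) a (act (X i) a' ?y)"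
      using x(1) in1 gflowD(4)[OF fl] act_in[OF fl] by (simp add: f'(4) add.assoc)
    have "\<bar>Re (q (i, act (X i) a (act (X i) a' ?y))) - Re (q (i, act (X i) a' ?y))\<bar> < 1/16"
      "\<bar>Re (q (i, act (X i) a' ?y)) - Re (q (i, ?y))\<bar> < 1/16"
      using V2(3)[OF _ elim(2)] x(2) W(2) f'(1) in1(3,4) by blast+
    then have "Re (q (i, ?y)) \<ge> 1/8" using x(5)[unfolded eq] by linarith
    with 1 in1(2) show ?case by blast
  qed
  then obtain z where z: "eventually (\<lambda>i. ?P i (z i)) \<U>" unfolding eventually_ex by blast
  obtain \<phi> where phi: "\<phi> \<in> Sg" "\<And>p t. p \<in> C_G Y \<Longrightarrow> (\<forall>i\<in>I. \<forall>z. ?P i z \<longrightarrow> Re (p (i, z)) \<ge> t) \<Longrightarrow> Re (\<phi> p) \<ge> t"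
    using Sg_limit_ge[of ?P z, OF z] by auto
  have "Re (\<phi> p) \<ge> 1/8" by (rule phi(2)[OF p]) blast
  moreover have "Re (\<phi> (translate Y q (u + g))) \<ge> 1/8"
    by (rule phi(2)[OF translate_C_G[OF q]]) (auto simp: translate_def pts_Y act_Y)
  ultimately show False using disj[OF phi(1) f'(2)] by (simp add: act_Sigma[OF q])
qed

text \<open>The functions of an \<open>sdata\<close> on the ultracoproduct are replaced by elements
  of \<open>RC\<close> with the same ones and zeros; their slices form a \<open>wdata\<close> on
  most factors. Non-emptiness and distinctness are existential and follow from
  \<open>Sg_approx\<close>; covers and edges are universal and follow by passing to the limit of
  counterexamples.\<close>

lemma tp_ultracoproduct_imp:
  assumes "M \<in> tp_G \<N> \<Sigma>"
  shows "eventually (\<lambda>i. M \<in> tp_G \<N> (X i)) \<U>"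
proof -
  note fl = ultracoproduct_gflow
  let ?V = "verts M"
  have good: "good \<N> M" using tp_G_sdata(1)[OF fl assms] .
  obtain f where f: "sdata \<Sigma> ?V (edges_of M) (covers_of M) f" using tp_G_sdata(2)[OF fl assms] by blast
  note s = sdataD[OF f, unfolded pts_ultracoproduct]
  have "\<exists>p\<in>RC. (\<forall>\<phi>\<in>Sg. f v \<phi> = 1 \<longrightarrow> Re (\<phi> p) = 1) \<and> (\<forall>\<phi>\<in>Sg. f v \<phi> \<le> 0 \<longrightarrow> Re (\<phi> p) = 0)" if v: "v \<in> ?V" for v
  proof -
    have 1: "closedin (topol \<Sigma>) {\<phi> \<in> pts \<Sigma>. f v \<phi> \<in> {1}}"
      using closedin_continuous_map_preimage[OF s(1)[OF v], of "{1}"] by simp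
    have 2: "openin (topol \<Sigma>) {\<phi> \<in> pts \<Sigma>. f v \<phi> \<in> {0<..}}"
      using openin_continuous_map_preimage[OF s(1)[OF v], of "{0<..}"] by simp
    obtain p where "p \<in> RC" "\<forall>\<phi>\<in>{\<phi> \<in> pts \<Sigma>. f v \<phi> \<in> {1}}. Re (\<phi> p) = 1"
        "\<forall>\<phi>\<in>Sg - {\<phi> \<in> pts \<Sigma>. f v \<phi> \<in> {0<..}}. Re (\<phi> p) = 0"
      using Sigma_separation[OF 1 2] by force
    then show ?thesis by (intro bexI[of _ p]) (auto simp: pts_ultracoproduct)
  qed
  then obtain p where p: "\<And>v. v \<in> ?V \<Longrightarrow> p v \<in> RC" "\<And>v \<phi>. v \<in> ?V \<Longrightarrow> \<phi> \<in> Sg \<Longrightarrow> f v \<phi> = 1 \<Longrightarrow> Re (\<phi> (p v)) = 1"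
    "\<And>v \<phi>. v \<in> ?V \<Longrightarrow> \<phi> \<in> Sg \<Longrightarrow> f v \<phi> \<le> 0 \<Longrightarrow> Re (\<phi> (p v)) = 0" by metis
  note pC = RC_D[OF p(1)]
  let ?h = "\<lambda>i v x. Re (p v (i, x))"
  have near: "\<bar>Re a - Re b\<bar> < e" if "dist a b < e" for a b e
    using that abs_Re_le_cmod[of "a - b"] by (simp add: dist_norm)
  have ev2: "eventually (\<lambda>i. \<forall>v\<in>?V. \<exists>x\<in>pts (X i). ?h i v x > 1/2) \<U>"
  proof (rule eventually_ball_finite[OF goodD(1)[OF good]], rule ballI)
    fix v assume v: "v \<in> ?V"
    obtain \<phi> where phi: "\<phi> \<in> Sg" "f v \<phi> = 1" using s(3)[OF v] by blast
    \<comment> \<open>Values 1 and 0 at \<open>\<phi>\<close> approximated within 1/4 end up on the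
      correct sides of 1/2.\<close>
    have "eventually (\<lambda>i. i \<in> I \<and> (\<exists>x\<in>pts (X i). \<forall>q\<in>{p v}. dist (q (i, x)) (\<phi> q) < 1/4)) \<U>"
      using phi pC[OF v] by (intro Sg_approx) auto
    then show "eventually (\<lambda>i. \<exists>x\<in>pts (X i). ?h i v x > 1/2) \<U>"
    proof eventually_elim
      case (elim i)
      then obtain x where x: "x \<in> pts (X i)" "dist (p v (i, x)) (\<phi> (p v)) < 1/4" by blast
      then have "?h i v x > 1/2" using near[OF x(2)] p(2)[OF v phi] by linarith
      with x(1) show ?case by blast
    qed
  qed
  have ev3: "eventually (\<lambda>i. \<forall>v\<in>?V. \<forall>w\<in>?V. v \<noteq> w \<longrightarrow>
      (\<exists>x\<in>pts (X i). ?h i v x > 1/2 \<and> ?h i w x \<le> 1/2 \<or> ?h i w x > 1/2 \<and> ?h i v x \<le> 1/2)) \<U>"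
  proof (intro eventually_ball_finite[OF goodD(1)[OF good]] ballI)
    fix v w assume vw: "v \<in> ?V" "w \<in> ?V"
    show "eventually (\<lambda>i. v \<noteq> w \<longrightarrow>
      (\<exists>x\<in>pts (X i). ?h i v x > 1/2 \<and> ?h i w x \<le> 1/2 \<or> ?h i w x > 1/2 \<and> ?h i v x \<le> 1/2)) \<U>"
    proof (cases "v = w")
      case False
      obtain \<phi> where phi: "\<phi> \<in> Sg" "f v \<phi> = 1 \<and> f w \<phi> = 0 \<or> f w \<phi> = 1 \<and> f v \<phi> = 0" using s(4)[OF vw False] by blast
      then have vals: "Re (\<phi> (p v)) = 1 \<and> Re (\<phi> (p w)) = 0 \<or> Re (\<phi> (p w)) = 1 \<and> Re (\<phi> (p v)) = 0"
        using p(2,3) vw by auto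
      have "eventually (\<lambda>i. i \<in> I \<and> (\<exists>x\<in>pts (X i). \<forall>q\<in>{p v, p w}. dist (q (i, x)) (\<phi> q) < 1/4)) \<U>"
        using phi pC vw by (intro Sg_approx) auto
      then show ?thesis
      proof eventually_elim
        case (elim i)
        then obtain x where x: "x \<in> pts (X i)" "dist (p v (i, x)) (\<phi> (p v)) < 1/4" "dist (p w (i, x)) (\<phi> (p w)) < 1/4" by blast
        have "?h i v x > 1/2 \<and> ?h i w x \<le> 1/2 \<or> ?h i w x > 1/2 \<and> ?h i v x \<le> 1/2"
          using near[OF x(2)] near[OF x(3)] vals by linarith
        with x(1) show ?case by blast
      qed
    qed simp
  qed
  have ev4: "eventually (\<lambda>i. \<forall>c\<in>covers_of M. \<forall>x\<in>pts (X i). \<exists>v\<in>c. ?h i v x > 1/2) \<U>"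
  proof (rule eventually_ball_finite[OF goodD(3)[OF good]], rule ballI, rule ccontr)
    fix c assume c: "c \<in> covers_of M"
    \<comment> \<open>Uncovered points of most factors converge to a point at which all functions of
      the cover are at most 1/2, although one of them must be 1 there.\<close>
    let ?P = "\<lambda>i x. x \<in> pts (X i) \<and> (\<forall>v\<in>c. ?h i v x \<le> 1/2)"
    assume "\<not> eventually (\<lambda>i. \<forall>x\<in>pts (X i). \<exists>v\<in>c. ?h i v x > 1/2) \<U>"
    then have "eventually (\<lambda>i. \<not> (\<forall>x\<in>pts (X i). \<exists>v\<in>c. ?h i v x > 1/2)) \<U>" using ultra_not[OF ultra_U] by blast
    then have "eventually (\<lambda>i. \<exists>x. ?P i x) \<U>" by eventually_elim (auto simp: not_less)
    then obtain x where x: "eventually (\<lambda>i. ?P i (x i)) \<U>" unfolding eventually_ex by blast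
    obtain \<phi> where phi: "\<phi> \<in> Sg" "\<And>p t. p \<in> C_G Y \<Longrightarrow> (\<forall>i\<in>I. \<forall>z. ?P i z \<longrightarrow> Re (p (i, z)) \<le> t) \<Longrightarrow> Re (\<phi> p) \<le> t"
      using Sg_limit_ge[of ?P x, OF x] by auto
    obtain v where v: "v \<in> c" "f v \<phi> = 1" using s(5)[OF c phi(1)] by blast
    have vV: "v \<in> ?V" using goodD(5)[OF good c] v(1) by blast
    have "Re (\<phi> (p v)) \<le> 1/2" by (rule phi(2)[OF pC[OF vV]]) (use v(1) in blast)
    then show False using p(2)[OF vV phi(1) v(2)] by simp
  qed
  have ev5: "eventually (\<lambda>i. \<forall>E\<in>edges_of M. case E of (g, A, v, w) \<Rightarrow>
      \<forall>x\<in>pts (X i). \<forall>u\<in>A. \<not> (?h i v x > 1/4 \<and> ?h i w (act (X i) (u + g) x) > 1/4)) \<U>"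
  proof (rule eventually_ball_finite[OF goodD(2)[OF good]], rule ballI)
    fix E assume E: "E \<in> edges_of M"
    obtain g A v w where E': "E = (g, A, v, w)" by (cases E) auto
    note vw = goodD(4)[OF good E[unfolded E']]
    have "eventually (\<lambda>i. \<forall>x\<in>pts (X i). \<forall>u\<in>A. \<not> (?h i v x > 1/4 \<and> ?h i w (act (X i) (u + g) x) > 1/4)) \<U>"
    proof (rule edge_transfer)
      show "A \<in> N_RPC \<N>" "p v \<in> C_G Y" "p w \<in> C_G Y" using vw pC by auto
      fix \<phi> u assume phi: "\<phi> \<in> Sg" and u: "u \<in> A"
      have phi': "act \<Sigma> (u + g) \<phi> \<in> Sg" using act_in[OF fl, of \<phi> "u + g"] phi by (simp add: pts_ultracoproduct)
      have "f v \<phi> > 0" if "Re (\<phi> (p v)) > 0" using p(3)[of v \<phi>] vw phi that by force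
      moreover have "f w (act \<Sigma> (u + g) \<phi>) > 0" if "Re (act \<Sigma> (u + g) \<phi> (p w)) > 0"
        using p(3)[of w, OF _ phi'] vw that by force
      ultimately show "\<not> (Re (\<phi> (p v)) > 0 \<and> Re (act \<Sigma> (u + g) \<phi> (p w)) > 0)"
        using s(6)[OF E[unfolded E'] phi u] by blast
    qed
    then show "eventually (\<lambda>i. case E of (g, A, v, w) \<Rightarrow>
      \<forall>x\<in>pts (X i). \<forall>u\<in>A. \<not> (?h i v x > 1/4 \<and> ?h i w (act (X i) (u + g) x) > 1/4)) \<U>" by (simp add: E')
  qed
  show ?thesis
    using U_in_I ev2 ev3 ev4 ev5
  proof eventually_elim
    case (elim i)
    have "wdata (X i) ?V (edges_of M) (covers_of M) (?h i)"
      unfolding wdata_def using elim slice_continuous[OF pC] by (intro conjI) (blast | assumption)+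
    then show ?case by (rule tp_G_wdata[OF flows[OF elim(1)] good])
  qed
qed

text \<open>Here the function \<open>\<zeta>\<close> enters: the bound \<open>\<zeta> A\<close> is
  the same for all \<open>i\<close> and small near the identity, hence a common modulus as
  \<open>C_G_glue\<close> requires.\<close>

lemma Lipschitz_glue:
  assumes A: "A \<in> N_RPC \<N>"
    and cont: "\<And>i. i \<in> I \<Longrightarrow> continuous_map (topol (X i)) euclideanreal (r i)"
    and range: "\<And>i x. i \<in> I \<Longrightarrow> x \<in> pts (X i) \<Longrightarrow> r i x \<in> {0..1}"
    and lip: "\<And>i x g. i \<in> I \<Longrightarrow> x \<in> pts (X i) \<Longrightarrow> \<bar>r i (act (X i) g x) - r i x\<bar> \<le> \<zeta> A g"
  shows "\<exists>p\<in>RC. \<forall>i\<in>I. \<forall>x\<in>pts (X i). p (i, x) = of_real (r i x)"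
proof -
  have sn: "seminorm (\<zeta> A)" using zeta A by (auto simp: SN_RPC_def)
  let ?p = "\<lambda>y\<in>pts Y. complex_of_real (r (fst y) (snd y))"
  have "?p \<in> C_G Y"
  proof (rule C_G_glue[where B = 1])
    fix i assume i: "i \<in> I"
    have "continuous_map euclideanreal euclidean complex_of_real" by (simp add: continuous_intros)
    from continuous_map_compose[OF cont[OF i] this]
    show "continuous_map (topol (X i)) euclidean (\<lambda>x. complex_of_real (r i x))" by (simp add: o_def)
    show "cmod (complex_of_real (r i x)) \<le> 1" if "x \<in> pts (X i)" for x using range[OF i that] by auto
  next
    fix g0 :: 'g and e :: real assume e: "e > 0"
    have "open {g. g + - g0 \<in> {h. \<zeta> A h < e}}"
    proof -
      have "open {h. \<zeta> A h < e}"
        using sn by (intro open_Collect_less continuous_intros) (auto simp: seminorm_def)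
      from open_conj[OF this, of 0 "- g0"] show ?thesis by simp
    qed
    moreover have "g0 \<in> {g. g + - g0 \<in> {h. \<zeta> A h < e}}" using sn e by (simp add: seminorm_def)
    ultimately have "eventually (\<lambda>g. g \<in> {g. g + - g0 \<in> {h. \<zeta> A h < e}}) (nhds g0)"
      by (rule eventually_nhds_in_open)
    then show "eventually (\<lambda>g. \<forall>i\<in>I. \<forall>x\<in>pts (X i).
      dist (complex_of_real (r i (act (X i) g x))) (complex_of_real (r i (act (X i) g0 x))) < e) (nhds g0)"
    proof eventually_elim
      case (elim g)
      show ?case
      proof (intro ballI)
        fix i x assume i: "i \<in> I" and x: "x \<in> pts (X i)"
        note fl = flows[OF i]
        have "act (X i) g x = act (X i) (g + - g0) (act (X i) g0 x)"
          using gflowD(4)[OF fl x, of "g + - g0" g0] by (simp add: add.assoc)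
        then have "\<bar>r i (act (X i) g x) - r i (act (X i) g0 x)\<bar> \<le> \<zeta> A (g + - g0)"
          using lip[OF i act_in[OF fl x]] by metis
        then have "\<bar>r i (act (X i) g x) - r i (act (X i) g0 x)\<bar> < e" using elim by auto
        then show "dist (complex_of_real (r i (act (X i) g x))) (complex_of_real (r i (act (X i) g0 x))) < e"
          by (simp add: dist_norm flip: of_real_diff)
      qed
    qed
  qed
  moreover have "?p y \<in> complex_of_real ` {0..1}" if "y \<in> pts Y" for y
    using that range[of "fst y" "snd y"] pts_Y[of "fst y" "snd y"] by simp
  ultimately have "?p \<in> RC" by (simp add: RC_def)
  then show ?thesis by (rule bexI[rotated]) (simp add: pts_Y)
qed

text \<open>The closed sets are replaced by the level sets of two functions on the disjoint union.
  By \<open>edge_transfer\<close> with \<open>g = 0\<close> these level sets are unrelated in most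
  factors, so the Urysohn functions of the factors can be taken between them and glued.\<close>

lemma ultracoproduct_Urysohn:
  assumes A: "A \<in> N_RPC \<N>" and ury: "\<And>i. i \<in> I \<Longrightarrow> Urysohn (X i) A (\<zeta> A)"
  shows "Urysohn \<Sigma> A (\<zeta> A)"
  unfolding Urysohn_def
proof (intro allI impI)
  fix K L and c :: real
  assume K: "closedin (topol \<Sigma>) K" and L: "closedin (topol \<Sigma>) L" and "K \<noteq> {}" "L \<noteq> {}"
    and KL: "K \<times> L \<inter> R_rel \<Sigma> A = {}" and c: "0 < c" "c < 1"
  note fl = ultracoproduct_gflow
  have sn: "seminorm (\<zeta> A)" using zeta A by (auto simp: SN_RPC_def)
  obtain D D' where D: "openin (topol \<Sigma>) D" "openin (topol \<Sigma>) D'" "K \<subseteq> D" "L \<subseteq> D'"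
      "D \<times> D' \<inter> R_rel \<Sigma> A = {}"
    using R_rel_separation[OF fl K L KL] by (elim exE conjE)
  obtain p where p: "p \<in> RC" "\<forall>\<phi>\<in>K. Re (\<phi> p) = 1" "\<forall>\<phi>\<in>Sg - D. Re (\<phi> p) = 0"
    using Sigma_separation[OF K D(1,3)] by blast
  obtain q where q: "q \<in> RC" "\<forall>\<phi>\<in>L. Re (\<phi> q) = 1" "\<forall>\<phi>\<in>Sg - D'. Re (\<phi> q) = 0"
    using Sigma_separation[OF L D(2,4)] by blast
  let ?good = "\<lambda>i. \<forall>x\<in>pts (X i). \<forall>u\<in>A. \<not> (Re (p (i, x)) > 1/4 \<and> Re (q (i, act (X i) (u + 0) x)) > 1/4)"
  have good: "eventually ?good \<U>"
  proof (rule edge_transfer[OF A RC_D[OF p(1)] RC_D[OF q(1)]], rule notI, elim conjE)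
    fix \<phi> u assume phi: "\<phi> \<in> Sg" and u: "u \<in> A" and 1: "Re (\<phi> p) > 0" and 2: "Re (act \<Sigma> (u + 0) \<phi> q) > 0"
    have "\<phi> \<in> D" using p(3) phi 1 by force
    moreover have "act \<Sigma> u \<phi> \<in> Sg" using act_in[OF fl, of \<phi> u] phi by (simp add: pts_ultracoproduct)
    then have "act \<Sigma> u \<phi> \<in> D'" using q(3) 2 by force
    moreover have "(\<phi>, act \<Sigma> u \<phi>) \<in> R_rel \<Sigma> A" using R_relI[OF fl _ u] phi by (simp add: pts_ultracoproduct)
    ultimately show False using D(5) by blast
  qed
  let ?K = "\<lambda>i. {x \<in> pts (X i). Re (p (i, x)) \<in> {1/2..}}" and ?L = "\<lambda>i. {x \<in> pts (X i). Re (q (i, x)) \<in> {1/2..}}"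
  \<comment> \<open>On the exceptional factors only continuity, range and the Lipschitz bound are
    demanded; a constant satisfies these.\<close>
  let ?R = "\<lambda>i r. continuous_map (topol (X i)) euclideanreal r \<and> (\<forall>x\<in>pts (X i). r x \<in> {0..1}) \<and>
      (\<forall>x\<in>pts (X i). \<forall>g. \<bar>r (act (X i) g x) - r x\<bar> \<le> \<zeta> A g) \<and>
      (?good i \<longrightarrow> (\<forall>x\<in>?K i. r x = 0) \<and> (\<forall>x\<in>?L i. r x = c))"
  have const: "continuous_map (topol (X i)) euclideanreal (\<lambda>_. d) \<and> (\<forall>x\<in>pts (X i). d \<in> {0..1}) \<and>
      (\<forall>x\<in>pts (X i). \<forall>g. \<bar>d - d\<bar> \<le> \<zeta> A g)" if "d \<in> {0..1}" for i and d :: real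
    using that sn by (auto simp: seminorm_def)
  have "\<exists>r. ?R i r" if i: "i \<in> I" for i
  proof (cases "?good i")
    case False
    then show ?thesis using const[of 0 i] by (intro exI[of _ "\<lambda>_. 0"]) auto
  next
    case good: True
    \<comment> \<open>The Urysohn property speaks of non-empty sets only; if one level set is empty,
      the constant for the other one serves.\<close>
    show ?thesis
    proof (cases "?K i = {} \<or> ?L i = {}")
      case True
      then show ?thesis
      proof
        assume "?K i = {}"
        then show ?thesis using const[of c i] c by (intro exI[of _ "\<lambda>_. c"]) auto
      next
        assume "?L i = {}"
        then show ?thesis using const[of 0 i] by (intro exI[of _ "\<lambda>_. 0"]) auto
      qed
    next
      case False
      note pc = slice_continuous[OF RC_D[OF p(1)] i] and qc = slice_continuous[OF RC_D[OF q(1)] i]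
      have clK: "closedin (topol (X i)) (?K i)"
        using closedin_continuous_map_preimage[OF pc, of "{1/2..}"] by simp
      have clL: "closedin (topol (X i)) (?L i)"
        using closedin_continuous_map_preimage[OF qc, of "{1/2..}"] by simp
      have "(a, b) \<notin> R_rel (X i) A" if "a \<in> ?K i" "b \<in> ?L i" for a b
      proof
        assume ab: "(a, b) \<in> R_rel (X i) A"
        have "Re (p (i, a)) > 1/4" "Re (q (i, b)) > 1/4" using that by auto
        then obtain x u where "x \<in> pts (X i)" "u \<in> A" "Re (p (i, x)) > 1/4 \<and> Re (q (i, act (X i) u x)) > 1/4"
          using R_rel_approx[OF ab pc qc] by blast
        with good show False by auto
      qed
      then have disj: "?K i \<times> ?L i \<inter> R_rel (X i) A = {}" by blast
      have ne: "?K i \<noteq> {}" "?L i \<noteq> {}" using False by simp_all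
      obtain r where r: "continuous_map (topol (X i)) (top_of_set {0..1}) r"
          "\<forall>g. \<forall>x\<in>pts (X i). \<bar>r (act (X i) g x) - r x\<bar> \<le> \<zeta> A g"
          "\<forall>x\<in>?K i. r x = 0" "\<forall>x\<in>?L i. r x = c"
        using ury[OF i, unfolded Urysohn_def, rule_format, OF clK clL ne disj c] by (elim exE conjE)
      then show ?thesis
        by (intro exI[of _ r]) (auto simp: continuous_map_in_subtopology image_subset_iff Pi_iff)
    qed
  qed
  then have "\<forall>i\<in>I. \<exists>r. ?R i r" by (rule ballI)
  from bchoice[OF this] obtain r where r0: "\<forall>i\<in>I. ?R i (r i)" by (elim exE)
  have r: "?R i (r i)" if "i \<in> I" for i by (rule bspec[OF r0 that])
  have "\<exists>P\<in>RC. \<forall>i\<in>I. \<forall>x\<in>pts (X i). P (i, x) = of_real (r i x)"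
    using r by (intro Lipschitz_glue[OF A]) blast+
  then obtain P where P: "P \<in> RC" "\<And>i x. i \<in> I \<Longrightarrow> x \<in> pts (X i) \<Longrightarrow> P (i, x) = of_real (r i x)" by blast
  note PC = RC_D[OF P(1)]
  \<comment> \<open>Near \<open>\<phi>\<close> there are points of good factors with
    \<open>s\<close> at least 1/2, and there the glued function is exactly \<open>d\<close>.\<close>
  have val: "Re (\<phi> P) = d" if phi: "\<phi> \<in> Sg" and s: "s \<in> C_G Y" "Re (\<phi> s) = 1"
      and d: "\<And>i x. i \<in> I \<Longrightarrow> ?good i \<Longrightarrow> x \<in> pts (X i) \<Longrightarrow> Re (s (i, x)) \<ge> 1/2 \<Longrightarrow> r i x = d" for \<phi> s d
  proof -
    have "\<bar>d - Re (\<phi> P)\<bar> < e" if e: "e > 0" for e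
    proof -
      have "eventually (\<lambda>i. i \<in> I \<and> (\<exists>x\<in>pts (X i). \<forall>q\<in>{P, s}. dist (q (i, x)) (\<phi> q) < min e (1/2))) \<U>"
        using phi PC s e by (intro Sg_approx) auto
      from eventually_conj[OF this good] obtain i x where i: "i \<in> I" "?good i" "x \<in> pts (X i)"
          "dist (P (i, x)) (\<phi> P) < e" "dist (s (i, x)) (\<phi> s) < 1/2"
        using ultra_ex_of_ev[OF ultra_U] by (smt (verit, best) insertI1 insertI2 min_less_iff_conj)
      have "\<bar>Re (s (i, x)) - Re (\<phi> s)\<bar> < 1/2"
        using i(5) abs_Re_le_cmod[of "s (i, x) - \<phi> s"] by (simp add: dist_norm)
      then have "r i x = d" using d[OF i(1,2,3)] s(2) by linarith
      then have "P (i, x) = of_real d" using P(2)[OF i(1,3)] by simp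
      then show ?thesis using i(4) abs_Re_le_cmod[of "P (i, x) - \<phi> P"] by (simp add: dist_norm)
    qed
    then have "\<not> 0 < \<bar>d - Re (\<phi> P)\<bar>" by blast
    then show ?thesis by simp
  qed
  show "\<exists>p. continuous_map (topol \<Sigma>) (top_of_set {0..1}) p \<and>
      (\<forall>g. \<forall>x\<in>pts \<Sigma>. \<bar>p (act \<Sigma> g x) - p x\<bar> \<le> \<zeta> A g) \<and> (\<forall>x\<in>K. p x = 0) \<and> (\<forall>x\<in>L. p x = c)"
  proof (intro exI[of _ "\<lambda>\<phi>. Re (\<phi> P)"] conjI allI ballI)
    show "continuous_map (topol \<Sigma>) (top_of_set {0..1}) (\<lambda>\<phi>. Re (\<phi> P))"
      using Sigma_eval_continuous[OF PC] RC_character[OF P(1) SgD(1)]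
      by (auto simp: continuous_map_in_subtopology pts_ultracoproduct)
    fix g \<phi> assume "\<phi> \<in> pts \<Sigma>"
    then have phi: "\<phi> \<in> characters Y" using SgD(1) by (simp add: pts_ultracoproduct)
    have "dist (\<phi> (translate Y P g)) (\<phi> P) \<le> \<zeta> A g"
    proof (rule characters_dist[OF phi translate_C_G[OF PC] PC])
      fix y assume y: "y \<in> pts Y"
      obtain i x where ix: "y = (i, x)" "i \<in> I" "x \<in> pts (X i)" using y pts_Y by (cases y) auto
      have "dist (P (i, act (X i) g x)) (P (i, x)) \<le> \<zeta> A g"
        using r[OF ix(2)] ix(3) P(2)[OF ix(2) act_in[OF flows[OF ix(2)] ix(3)]] P(2)[OF ix(2,3)]
        by (simp add: dist_norm flip: of_real_diff)
      then show "dist (translate Y P g y) (P y) \<le> \<zeta> A g" using y ix(1) by (simp add: translate_def act_Y)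
    qed
    then show "\<bar>Re (act \<Sigma> g \<phi> P) - Re (\<phi> P)\<bar> \<le> \<zeta> A g"
      using abs_Re_le_cmod[of "\<phi> (translate Y P g) - \<phi> P"] by (simp add: dist_norm act_Sigma[OF PC])
  next
    fix \<phi> assume phi: "\<phi> \<in> K"
    then have "\<phi> \<in> Sg" using closedin_subset[OF K] pts_ultracoproduct by blast
    then show "Re (\<phi> P) = 0" by (rule val[OF _ RC_D[OF p(1)]]) (use phi p(2) r in auto)
  next
    fix \<phi> assume phi: "\<phi> \<in> L"
    then have "\<phi> \<in> Sg" using closedin_subset[OF L] pts_ultracoproduct by blast
    then show "Re (\<phi> P) = c" by (rule val[OF _ RC_D[OF q(1)]]) (use phi q(2) r in auto)
  qed
qed

end

subsection \<open>Refinements\<close>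

text \<open>A code consists of the number of cells, one neighborhood and a finite list of
  non-closeness facts. With neighborhoods from \<open>\<N>\<^sub>0\<close> and group elements from
  \<open>G\<^sub>0\<close> there are only countably many codes if both sets are countable. Only the
  list of all cells is declared a cover, and none if there are no cells, since
  \<open>Cover 0\<close> is no symbol of the language.\<close>

definition mkstr :: "nat \<Rightarrow> 'g::topological_group_add set \<Rightarrow> ('g \<times> nat \<times> nat) list \<Rightarrow> ('g, nat) relstr" where
  "mkstr m W E = \<lparr>lang = language (insert 0 (fst ` set E)) {W}, verts = {..<m},
     interp = (\<lambda>s. case s of
         Edge g V \<Rightarrow> if V = W then {[j, k] |j k. (g, j, k) \<in> set E \<and> j < m \<and> k < m} else {}
       | Cover n \<Rightarrow> if n = m \<and> 1 \<le> m then {[0..<m]} else {})\<rparr>"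

lemma mkstr_Str: "mkstr m W E \<in> Str (insert 0 (fst ` set E)) {W}"
proof -
  let ?L = "language (insert 0 (fst ` set E)) {W}"
  have 1: "interp (mkstr m W E) s \<subseteq> {xs. length xs = arity s \<and> set xs \<subseteq> {..<m}}" for s
    by (cases s) (auto simp: mkstr_def)
  have 2: "interp (mkstr m W E) s = {}" if "s \<notin> ?L" for s
  proof (cases s)
    case (Edge g V)
    then have "V = W \<Longrightarrow> (g, j, k) \<notin> set E" for j k
      using that by (force simp: language_def)
    then show ?thesis unfolding Edge by (simp add: mkstr_def)
  next
    case (Cover n)
    then have "\<not> 1 \<le> n" using that by (simp add: language_def)
    then show ?thesis unfolding Cover by (simp add: mkstr_def)
  qed
  have "verts (mkstr m W E) = {..<m}" "lang (mkstr m W E) = ?L" by (simp_all add: mkstr_def)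
  with 1 2 show ?thesis unfolding Str_def by auto
qed

definition realizes_code :: "('g::topological_group_add, 'x) gspace \<Rightarrow> nat \<Rightarrow> 'g set \<Rightarrow> ('g \<times> nat \<times> nat) list \<Rightarrow>
    (nat \<Rightarrow> 'x set) \<Rightarrow> bool" where
  "realizes_code X m W E B \<longleftrightarrow>
     (\<forall>j<m. openin (topol X) (B j) \<and> B j \<noteq> {}) \<and> inj_on B {..<m} \<and>
     (1 \<le> m \<longrightarrow> (\<Union>j<m. B j) = pts X) \<and>
     (\<forall>(g, j, k)\<in>set E. j < m \<longrightarrow> k < m \<longrightarrow>
        ((topol X closure_of (act X g ` B j)) \<times> (topol X closure_of B k)) \<inter> R_rel X W = {})"

lemma mkstr_tp_iff:
  assumes W: "W \<in> N_RPC \<N>"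
  shows "mkstr m W E \<in> tp_G \<N> X \<longleftrightarrow> (\<exists>B. realizes_code X m W E B)"
proof
  assume "mkstr m W E \<in> tp_G \<N> X"
  then obtain F N where FN: "mkstr m W E \<in> Str F N" "realizes X F N (mkstr m W E)"
    unfolding tp_G_def by blast
  have v: "verts (mkstr m W E) = {..<m}" by (simp add: mkstr_def)
  from FN(2) obtain \<O> B where O1: "\<forall>A\<in>\<O>. openin (topol X) A \<and> A \<noteq> {}"
      "bij_betw B (verts (mkstr m W E)) (verts (Str_of X \<O> F N))"
      "\<forall>s\<in>language F N. \<forall>xs\<in>interp (mkstr m W E) s. map B xs \<in> interp (Str_of X \<O> F N) s"
    unfolding realizes_def by (elim exE conjE)
  have O: "\<And>A. A \<in> \<O> \<Longrightarrow> openin (topol X) A \<and> A \<noteq> {}" "bij_betw B {..<m} \<O>"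
      "\<And>s xs. s \<in> language F N \<Longrightarrow> xs \<in> interp (mkstr m W E) s \<Longrightarrow> map B xs \<in> interp (Str_of X \<O> F N) s"
    using O1(1) O1(2)[unfolded v] O1(3) by (simp_all add: Str_of_def)
  have e1: "openin (topol X) (B j) \<and> B j \<noteq> {}" if "j < m" for j
    using O(1) bij_betw_apply[OF O(2), of j] that by simp
  have e2: "inj_on B {..<m}" using O(2) by (simp add: bij_betw_def)
  have e3: "(\<Union>j<m. B j) = pts X" if "1 \<le> m"
  proof -
    have xs: "[0..<m] \<in> interp (mkstr m W E) (Cover m)" using that by (simp add: mkstr_def)
    from O(3)[OF Str_interp(1)[OF FN(1) xs] xs] Str_interp(1)[OF FN(1) xs]
    have "\<Union>(set (map B [0..<m])) = pts X" by (simp add: Str_of_def)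
    then show ?thesis by (simp add: atLeast0LessThan)
  qed
  have e4: "((topol X closure_of (act X g ` B j)) \<times> (topol X closure_of B k)) \<inter> R_rel X W = {}"
    if "(g, j, k) \<in> set E" "j < m" "k < m" for g j k
  proof -
    have xs: "[j, k] \<in> interp (mkstr m W E) (Edge g W)" using that by (simp add: mkstr_def)
    from O(3)[OF Str_interp(1)[OF FN(1) xs] xs] Str_interp(1)[OF FN(1) xs]
    show ?thesis by (simp add: Str_of_def)
  qed
  show "\<exists>B. realizes_code X m W E B"
    unfolding realizes_code_def
  proof (intro exI[of _ B] conjI)
    show "\<forall>(g, j, k)\<in>set E. j < m \<longrightarrow> k < m \<longrightarrow>
        ((topol X closure_of (act X g ` B j)) \<times> (topol X closure_of B k)) \<inter> R_rel X W = {}"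
      using e4 by auto
  qed (use e1 e2 e3 in simp_all)
next
  assume "\<exists>B. realizes_code X m W E B"
  then obtain B where B0: "realizes_code X m W E B" ..
  have B: "\<And>j. j < m \<Longrightarrow> openin (topol X) (B j) \<and> B j \<noteq> {}" "inj_on B {..<m}"
    "1 \<le> m \<Longrightarrow> (\<Union>j<m. B j) = pts X"
    "\<And>g j k. (g, j, k) \<in> set E \<Longrightarrow> j < m \<Longrightarrow> k < m \<Longrightarrow>
        ((topol X closure_of (act X g ` B j)) \<times> (topol X closure_of B k)) \<inter> R_rel X W = {}"
    using B0 unfolding realizes_code_def by fast+
  let ?F = "insert 0 (fst ` set E)" and ?N = "{W}"
  have rel: "map B xs \<in> interp (Str_of X (B ` {..<m}) ?F ?N) s"
    if s: "s \<in> language ?F ?N" and xs: "xs \<in> interp (mkstr m W E) s" for s xs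
  proof (cases s)
    case (Edge g V)
    with xs obtain j k where jk: "V = W" "xs = [j, k]" "(g, j, k) \<in> set E" "j < m" "k < m"
      by (auto simp: mkstr_def split: if_splits)
    show ?thesis using s B(4)[OF jk(3-5)] jk unfolding Edge by (simp add: Str_of_def)
  next
    case (Cover n)
    with xs have n: "n = m" "1 \<le> m" "xs = [0..<m]" by (auto simp: mkstr_def split: if_splits)
    show ?thesis using s B(3)[OF n(2)] n unfolding Cover
      by (auto simp: Str_of_def atLeast0LessThan)
  qed
  have "realizes X ?F ?N (mkstr m W E)"
    unfolding realizes_def
  proof (intro exI[of _ "B ` {..<m}"] conjI exI[of _ B] ballI)
    show "bij_betw B (verts (mkstr m W E)) (verts (Str_of X (B ` {..<m}) ?F ?N))"
      using B(2) by (simp add: mkstr_def Str_of_def bij_betw_def)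
  qed (use B(1) rel in auto)
  then show "mkstr m W E \<in> tp_G \<N> X"
    unfolding tp_G_def using W mkstr_Str[of m W E]
    by (intro CollectI exI[of _ ?F] exI[of _ ?N] conjI) auto
qed

text \<open>\<open>prec M m W E\<close>: the realizations of the structure coded by \<open>(m, W, E)\<close> determine realizations of
  \<open>M\<close> robustly enough to survive an ultracoproduct. A vertex \<open>v\<close> of \<open>M\<close> is a union of the cells
  indexed by \<open>J v\<close>, and two cells are close unless \<open>E\<close> says otherwise.\<close>

definition prec :: "('g::topological_group_add, nat) relstr \<Rightarrow> nat \<Rightarrow> 'g set \<Rightarrow> ('g \<times> nat \<times> nat) list \<Rightarrow> bool" where
  "prec M m W E \<longleftrightarrow> verts M = {} \<or> (1 \<le> m \<and> (\<exists>J.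
     (\<forall>v\<in>verts M. J v \<subseteq> {..<m} \<and> J v \<noteq> {}) \<and>
     (\<forall>v\<in>verts M. \<forall>w\<in>verts M. v \<noteq> w \<longrightarrow> (\<exists>j. j \<in> J v \<and> (\<forall>k\<in>J w. (0, j, k) \<in> set E) \<or>
         j \<in> J w \<and> (\<forall>k\<in>J v. (0, j, k) \<in> set E))) \<and>
     (\<forall>c\<in>covers_of M. {..<m} \<subseteq> (\<Union>v\<in>c. J v)) \<and>
     (\<forall>(g, A, v, w)\<in>edges_of M. \<forall>u\<in>A. \<exists>a\<in>W. \<exists>f. \<exists>b\<in>W. u + g = a + f + b \<and>
        (\<forall>j\<in>J v. \<forall>k'\<in>J w. \<forall>j1<m. \<forall>j2<m. \<forall>k<m.
           (0, j1, j) \<in> set E \<or> (0, j1, j2) \<in> set E \<or> (0, k, k') \<in> set E \<or> (f, j2, k) \<in> set E))))"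

lemma good_empty:
  assumes "good \<N> M" "verts M = {}"
  shows "edges_of M = {}" "covers_of M = {}"
proof -
  obtain F N where M: "M \<in> Str F N" using assms(1) unfolding good_def by blast
  show "edges_of M = {}" using StrE_edge(3)[OF M] assms(2) by auto
  have "xs \<notin> interp M (Cover n)" if "n \<ge> 1" for xs n
    using Str_interp(2,3)[OF M, of xs "Cover n"] assms(2) that by auto
  then show "covers_of M = {}" unfolding covers_of_def by blast
qed

text \<open>The bound for actual pairs extends to the closed relation; a larger difference would be
  an open condition on the pair.\<close>

lemma R_rel_close:
  fixes f :: "'x \<Rightarrow> real"
  assumes ab: "(a, b) \<in> R_rel X W" and f: "continuous_map (topol X) euclideanreal f"
    and e: "\<And>x u. x \<in> pts X \<Longrightarrow> u \<in> W \<Longrightarrow> \<bar>f (act X u x) - f x\<bar> \<le> e"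
  shows "\<bar>f a - f b\<bar> \<le> e"
proof -
  have mf: "continuous_map (topol X) euclideanreal (\<lambda>x. - f x)" using f by (rule continuous_map_minus)
  have "\<not> f a - f b > e"
  proof
    assume d: "f a - f b > e"
    let ?d = "(f a - f b - e) / 2"
    obtain x u where "x \<in> pts X" "u \<in> W" "f x > f a - ?d \<and> - f (act X u x) > - f b - ?d"
      using R_rel_approx[OF ab f mf, of "f a - ?d" "- f b - ?d"] d by auto
    then show False using e[of x u] by (simp add: field_simps abs_le_iff)
  qed
  moreover have "\<not> f b - f a > e"
  proof
    assume d: "f b - f a > e"
    let ?d = "(f b - f a - e) / 2"
    obtain x u where "x \<in> pts X" "u \<in> W" "- f x > - f a - ?d \<and> f (act X u x) > f b - ?d"
      using R_rel_approx[OF ab mf f, of "- f a - ?d" "f b - ?d"] d by auto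
    then show False using e[of x u] by (simp add: field_simps abs_le_iff)
  qed
  ultimately show ?thesis by linarith
qed

lemma closure_close:
  fixes f :: "'x \<Rightarrow> real"
  assumes f: "continuous_map T euclideanreal f" and S: "S \<subseteq> topspace T" "a \<in> T closure_of S"
    and e: "\<And>x. x \<in> S \<Longrightarrow> \<bar>f x - r\<bar> \<le> e"
  shows "\<bar>f a - r\<bar> \<le> e"
proof -
  have "f a \<ge> r - e" by (rule closure_ge[OF f _ S]) (use e in \<open>fastforce simp: abs_le_iff\<close>)
  moreover have "- f a \<ge> - r - e"
    by (rule closure_ge[OF continuous_map_minus[OF f] _ S]) (use e in \<open>fastforce simp: abs_le_iff\<close>)
  ultimately show ?thesis by linarith
qed

section \<open>Every member of a weak type has a refinement in it\<close>

context lrpc_setup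
begin

lemma small_displacement:
  fixes f :: "nat \<Rightarrow> 'x \<Rightarrow> real"
  assumes X: "gflow X" and V: "finite V" "\<And>v. v \<in> V \<Longrightarrow> continuous_map (topol X) euclideanreal (f v)"
    and e: "e > 0"
  shows "\<exists>V\<^sub>0. open V\<^sub>0 \<and> 0 \<in> V\<^sub>0 \<and> (\<forall>a\<in>V\<^sub>0. \<forall>x\<in>pts X. \<forall>v\<in>V. \<bar>f v (act X a x) - f v x\<bar> < e)"
  using V
proof (induction V rule: finite_induct)
  case empty
  then show ?case by (intro exI[of _ UNIV]) auto
next
  case (insert v V)
  obtain V1 where V1: "open V1" "0 \<in> V1" "\<forall>a\<in>V1. \<forall>x\<in>pts X. \<forall>v\<in>V. \<bar>f v (act X a x) - f v x\<bar> < e"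
    using insert.IH insert.prems by auto
  obtain V2 where V2: "open V2" "0 \<in> V2" "\<forall>a\<in>V2. \<forall>x\<in>pts X. \<bar>f v (act X a x) - f v x\<bar> < e"
    using flow_equicontinuous[OF X insert.prems[of v] e] by auto
  show ?case by (rule exI[of _ "V1 \<inter> V2"]) (use V1 V2 in auto)
qed

lemma cell_cover:
  fixes f :: "nat \<Rightarrow> 'x \<Rightarrow> real"
  assumes X: "gflow X" and V: "finite V" "\<And>v. v \<in> V \<Longrightarrow> continuous_map (topol X) euclideanreal (f v)"
    and e: "e > 0"
  shows "\<exists>(m::nat) B. (\<forall>j<m. openin (topol X) (B j) \<and> B j \<noteq> {}) \<and> inj_on B {..<m} \<and> (\<Union>j<m. B j) = pts X \<and>
    (\<forall>j<m. \<forall>x\<in>B j. \<forall>y\<in>B j. \<forall>v\<in>V. \<bar>f v x - f v y\<bar> \<le> e)"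
proof -
  let ?C = "\<lambda>x. pts X \<inter> (\<Inter>v\<in>V. {y \<in> pts X. f v y \<in> ball (f v x) (e/2)})"
  have op: "openin (topol X) (?C x)" for x
  proof -
    have "openin (topol X) (topspace (topol X) \<inter> \<Inter>((\<lambda>v. {y \<in> pts X. f v y \<in> ball (f v x) (e/2)}) ` V))"
      using V openin_continuous_map_preimage[OF V(2), of _ "ball (f _ x) (e/2)"]
      by (intro openin_Int_Inter) auto
    then show ?thesis .
  qed
  obtain D where D: "finite D" "D \<subseteq> pts X" "pts X \<subseteq> \<Union>(?C ` D)"
  proof (rule compactin_finite_subcover[where T = "topol X" and W = ?C and A = "pts X" and K = "pts X"])
    show "compactin (topol X) (pts X)" using gflowD(1)[OF X] by (simp add: compact_space_def)
    show "pts X \<subseteq> \<Union>(?C ` pts X)" using e by auto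
  qed (use op in auto)
  have fin: "finite (?C ` D)" using D(1) by simp
  \<comment> \<open>The set of cells is enumerated rather than the set of their centers, so that
    equal cells are not repeated and \<open>B\<close> is injective.\<close>
  obtain B where B: "bij_betw B {0..<card (?C ` D)} (?C ` D)"
    using ex_bij_betw_nat_finite[OF fin] by blast
  let ?m = "card (?C ` D)"
  have img: "B ` {..<?m} = ?C ` D" "inj_on B {..<?m}" using B by (auto simp: bij_betw_def atLeast0LessThan)
  have cell: "\<exists>x\<in>D. B j = ?C x" if "j < ?m" for j using img(1) that by blast
  have d1: "\<bar>f v x - f v y\<bar> \<le> e" if j: "j < ?m" and xy: "x \<in> B j" "y \<in> B j" and v: "v \<in> V" for j x y v
  proof -
    obtain z where z: "B j = ?C z" using cell[OF j] by blast
    have "dist (f v z) (f v x) < e/2" "dist (f v z) (f v y) < e/2" using xy v unfolding z by auto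
    then show ?thesis unfolding dist_real_def by linarith
  qed
  have d2: "openin (topol X) (B j) \<and> B j \<noteq> {}" if j: "j < ?m" for j
  proof -
    obtain z where z: "z \<in> D" "B j = ?C z" using cell[OF j] by blast
    then have "z \<in> ?C z" using D(2) e by auto
    then show ?thesis using op[of z] z(2) by auto
  qed
  have d3: "(\<Union>j<?m. B j) = pts X"
    using D(3) unfolding img(1)[symmetric, unfolded image_def] using img(1) by auto
  show ?thesis
  proof (rule exI[of _ ?m], rule exI[of _ B], intro conjI)
    show "\<forall>j<?m. openin (topol X) (B j) \<and> B j \<noteq> {}" using d2 by blast
    show "inj_on B {..<?m}" by (rule img(2))
    show "(\<Union>j<?m. B j) = pts X" by (rule d3)
    show "\<forall>j<?m. \<forall>x\<in>B j. \<forall>y\<in>B j. \<forall>v\<in>V. \<bar>f v x - f v y\<bar> \<le> e" using d1 by blast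
  qed
qed

text \<open>Cells on which all functions vary by at most 1/10 and a neighborhood that moves values
  by less than 1/20 are fine enough. All non-closeness facts that hold for these cells are recorded;
  whatever is not recorded is close, and along chains of close cells the values change too little to
  allow a violation of an edge of \<open>M\<close>.\<close>

lemma tp_refinement:
  assumes X: "gflow X" and M: "M \<in> tp_G \<N> X"
  shows "\<exists>m W E. W \<in> \<N>\<^sub>0 \<and> set E \<subseteq> G\<^sub>0 \<times> UNIV \<and> prec M m W E \<and> mkstr m W E \<in> tp_G \<N> X"
proof (cases "verts M = {}")
  case True
  \<comment> \<open>A structure without vertices is realized even by the empty flow, where no
    non-empty cell exists; hence the code without cells.\<close>
  obtain W where W: "W \<in> \<N>\<^sub>0" using N0_base[of UNIV] by auto
  have "realizes_code X 0 W [] (\<lambda>_. {})" by (simp add: realizes_code_def)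
  then have "mkstr 0 W [] \<in> tp_G \<N> X" using mkstr_tp_iff[OF N0_D(1)[OF W]] by blast
  then show ?thesis using W True by (intro exI[of _ 0] exI[of _ W] exI[of _ "[]"]) (simp add: prec_def)
next
  case ne: False
  let ?V = "verts M"
  have good: "good \<N> M" using tp_G_sdata(1)[OF X M] .
  note fin = goodD(1-3)[OF good]
  obtain f where f: "sdata X ?V (edges_of M) (covers_of M) f" using tp_G_sdata(2)[OF X M] by blast
  note s = sdataD[OF f]
  obtain V0 where V0: "open V0" "0 \<in> V0" "\<And>a x v. a \<in> V0 \<Longrightarrow> x \<in> pts X \<Longrightarrow> v \<in> ?V \<Longrightarrow> \<bar>f v (act X a x) - f v x\<bar> < 1/20"
    using small_displacement[where f = f and e = "1/20", OF X fin(1) s(1)] by auto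
  obtain W where W: "W \<in> \<N>\<^sub>0" "W \<subseteq> V0" using N0_base[OF V0(1,2)] by blast
  have "\<exists>(m::nat) B. (\<forall>j<m. openin (topol X) (B j) \<and> B j \<noteq> {}) \<and> inj_on B {..<m} \<and> (\<Union>j<m. B j) = pts X \<and>
      (\<forall>j<m. \<forall>x\<in>B j. \<forall>y\<in>B j. \<forall>v\<in>?V. \<bar>f v x - f v y\<bar> \<le> 1/10)"
    by (rule cell_cover[OF X fin(1) s(1)]) auto
  then obtain m :: nat and B where B0: "\<forall>j<m. openin (topol X) (B j) \<and> B j \<noteq> {}" "inj_on B {..<m}" "(\<Union>j<m. B j) = pts X"
      "\<forall>j<m. \<forall>x\<in>B j. \<forall>y\<in>B j. \<forall>v\<in>?V. \<bar>f v x - f v y\<bar> \<le> 1/10"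
    by (elim exE conjE)
  have B: "\<And>j. j < m \<Longrightarrow> openin (topol X) (B j) \<and> B j \<noteq> {}" "inj_on B {..<m}" "(\<Union>j<m. B j) = pts X"
    "\<And>j x y v. j < m \<Longrightarrow> x \<in> B j \<Longrightarrow> y \<in> B j \<Longrightarrow> v \<in> ?V \<Longrightarrow> \<bar>f v x - f v y\<bar> \<le> 1/10"
    by (fact B0(1)[rule_format] B0(2,3) B0(4)[rule_format])+
  have Bp: "B j \<subseteq> pts X" if "j < m" for j using B(1)[OF that] openin_subset by blast
  have "\<exists>F. finite F \<and> F \<subseteq> G\<^sub>0 \<and> (\<forall>u\<in>fst (snd e). \<exists>a\<in>W. \<exists>f\<in>F. \<exists>b\<in>W. u + fst e = a + f + b) \<and>
      (\<forall>f\<in>F. \<exists>a\<in>V0. \<exists>u\<in>fst (snd e). \<exists>b\<in>V0. f = a + u + fst e + b)" if e: "e \<in> edges_of M" for e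
  proof -
    have "fst (snd e) \<in> N_RPC \<N>" using goodD(4)[OF good] e by (cases e) auto
    from RPC_cover[OF this W(1) V0(1,2)] show ?thesis .
  qed
  then obtain F where F: "\<And>e. e \<in> edges_of M \<Longrightarrow> finite (F e) \<and> F e \<subseteq> G\<^sub>0 \<and>
      (\<forall>u\<in>fst (snd e). \<exists>a\<in>W. \<exists>f\<in>F e. \<exists>b\<in>W. u + fst e = a + f + b) \<and>
      (\<forall>f\<in>F e. \<exists>a\<in>V0. \<exists>u\<in>fst (snd e). \<exists>b\<in>V0. f = a + u + fst e + b)" by metis
  \<comment> \<open>The identity is included for closeness of cells themselves, the other elements
    for the edges of \<open>M\<close>.\<close>
  define Fs where "Fs = insert 0 (\<Union>e\<in>edges_of M. F e)"
  have F1: "finite (F e)" "F e \<subseteq> G\<^sub>0" if "e \<in> edges_of M" for e using F[OF that] by blast+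
  have Fs: "finite Fs" "Fs \<subseteq> G\<^sub>0" using F1 fin(2) G0_zero unfolding Fs_def by (simp, blast)
  define Es where "Es = {(g, j, k). g \<in> Fs \<and> j < m \<and> k < m \<and>
      ((topol X closure_of (act X g ` B j)) \<times> (topol X closure_of B k)) \<inter> R_rel X W = {}}"
  have "finite Es" by (rule finite_subset[of _ "Fs \<times> {..<m} \<times> {..<m}"]) (use Fs in \<open>auto simp: Es_def\<close>)
  then obtain E where E: "set E = Es" using finite_list by blast
  have rc: "realizes_code X m W E B" using B(1-3) by (auto simp: realizes_code_def E Es_def)
  have act0: "act X 0 ` B j = B j" if "j < m" for j
    using gflowD(3)[OF X] Bp[OF that] by (force simp: image_iff)
  \<comment> \<open>Oscillation on two cells and one displacement: 1/10 + 1/20 + 1/10 = 1/4.\<close>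
  have close: "\<bar>f v x - f v y\<bar> \<le> 1/4"
    if nE: "(0, j, k) \<notin> set E" and jk: "j < m" "k < m" and xy: "x \<in> B j" "y \<in> B k" and v: "v \<in> ?V" for j k x y v
  proof -
    obtain a b where ab: "a \<in> topol X closure_of B j" "b \<in> topol X closure_of B k" "(a, b) \<in> R_rel X W"
      using nE jk act0[OF jk(1)] by (auto simp: E Es_def Fs_def)
    have "\<bar>f v a - f v x\<bar> \<le> 1/10"
      by (rule closure_close[OF s(1)[OF v] Bp[OF jk(1)] ab(1)]) (use B(4) jk xy v in auto)
    moreover have "\<bar>f v b - f v y\<bar> \<le> 1/10"
      by (rule closure_close[OF s(1)[OF v] Bp[OF jk(2)] ab(2)]) (use B(4) jk xy v in auto)
    moreover have "\<bar>f v a - f v b\<bar> \<le> 1/20"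
      by (rule R_rel_close[OF ab(3) s(1)[OF v]]) (use V0(3)[OF _ _ v] W(2) less_imp_le in blast)
    ultimately show ?thesis by linarith
  qed
  \<comment> \<open>Cells that contain a point of value 1. By \<open>close\<close> their neighbors
    still have values at least 3/4, and the neighbors of these at least 1/2.\<close>
  define J where "J v = {j. j < m \<and> (\<exists>x\<in>B j. f v x = 1)}" for v
  have cellof: "\<exists>j<m. x \<in> B j" if "x \<in> pts X" for x using B(3) that by blast
  have J1: "J v \<subseteq> {..<m} \<and> J v \<noteq> {}" if v: "v \<in> ?V" for v
  proof -
    obtain x where x: "x \<in> pts X" "f v x = 1" using s(3)[OF v] by blast
    obtain j where "j < m" "x \<in> B j" using cellof[OF x(1)] by blast
    then have "j \<in> J v" using x(2) by (auto simp: J_def)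
    then show ?thesis by (auto simp: J_def)
  qed
  have far: "\<exists>j\<in>J v. \<forall>k\<in>J w. (0, j, k) \<in> set E"
    if vw: "v \<in> ?V" "w \<in> ?V" and x: "x \<in> pts X" "f v x = 1" "f w x = 0" for v w x
  proof -
    obtain j where j: "j < m" "x \<in> B j" using cellof[OF x(1)] by blast
    have "(0, j, k) \<in> set E" if k: "k \<in> J w" for k
    proof (rule ccontr)
      assume n: "(0, j, k) \<notin> set E"
      obtain y where "y \<in> B k" "f w y = 1" "k < m" using k by (auto simp: J_def)
      then show False using close[OF n j(1) _ j(2) _ vw(2), of y] x(3) by simp
    qed
    moreover have "j \<in> J v" using j x(2) by (auto simp: J_def)
    ultimately show ?thesis by blast
  qed
  have J2: "\<exists>j. j \<in> J v \<and> (\<forall>k\<in>J w. (0, j, k) \<in> set E) \<or> j \<in> J w \<and> (\<forall>k\<in>J v. (0, j, k) \<in> set E)"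
    if vw: "v \<in> ?V" "w \<in> ?V" "v \<noteq> w" for v w
    using s(4)[OF vw] far[OF vw(1,2)] far[OF vw(2,1)] by meson
  have J3: "{..<m} \<subseteq> (\<Union>v\<in>c. J v)" if c: "c \<in> covers_of M" for c
  proof
    fix j assume j: "j \<in> {..<m}"
    then obtain x where x: "x \<in> B j" using B(1)[of j] by auto
    then have "x \<in> pts X" using Bp[of j] j by auto
    then obtain v where "v \<in> c" "f v x = 1" using s(5)[OF c] by blast
    then show "j \<in> (\<Union>v\<in>c. J v)" using x j by (auto simp: J_def)
  qed
  \<comment> \<open>Two closeness steps from \<open>j\<close> keep \<open>f v\<close> at least 1/2
    on \<open>B j2\<close>, and one step from \<open>k'\<close> keeps \<open>f w\<close> at least
    3/4 on \<open>B k\<close>. If \<open>B j2\<close> moved by \<open>h\<close> were close to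
    \<open>B k\<close>, there would be a genuine point violating the edge of
    \<open>sdata\<close>.\<close>
  have edge: "(h, j2, k) \<in> set E"
    if e: "(g, A, v, w) \<in> edges_of M" and h: "h \<in> F (g, A, v, w)" and j: "j \<in> J v" and k': "k' \<in> J w"
      and lt: "j1 < m" "j2 < m" "k < m"
      and n: "(0, j1, j) \<notin> set E" "(0, j1, j2) \<notin> set E" "(0, k, k') \<notin> set E" for g A v w h j k' j1 j2 k
  proof (rule ccontr)
    assume nE: "(h, j2, k) \<notin> set E"
    have vw: "v \<in> ?V" "w \<in> ?V" using goodD(4)[OF good e] by auto
    have "h \<in> Fs" using e h by (auto simp: Fs_def)
    with nE lt obtain a b where ab: "a \<in> topol X closure_of (act X h ` B j2)" "b \<in> topol X closure_of B k"
        "(a, b) \<in> R_rel X W" by (auto simp: E Es_def)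
    obtain x0 where x0: "x0 \<in> B j" "f v x0 = 1" "j < m" using j by (auto simp: J_def)
    obtain y0 where y0: "y0 \<in> B k'" "f w y0 = 1" "k' < m" using k' by (auto simp: J_def)
    obtain x1 where x1: "x1 \<in> B j1" using B(1)[OF lt(1)] by auto
    have f1: "f v x1 \<ge> 3/4" using close[OF n(1) lt(1) x0(3) x1 x0(1) vw(1)] x0(2) by linarith
    have f2: "f v x \<ge> 1/2" if "x \<in> B j2" for x
      using close[OF n(2) lt(1,2) x1 that vw(1)] f1 by linarith
    have f3: "f w y \<ge> 3/4" if "y \<in> B k" for y
      using close[OF n(3) lt(3) y0(3) that y0(1) vw(2)] y0(2) by linarith
    note cv = compose_act_continuous[OF X s(1)[OF vw(1)], of "- h"]
    have "f v (act X (- h) a) \<ge> 1/2"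
      by (rule closure_ge[OF cv _ _ ab(1)])
        (use Bp[OF lt(2)] f2 act_in[OF X] in \<open>auto simp: act_minus[OF X] subset_iff\<close>)
    moreover have "f w b \<ge> 3/4" by (rule closure_ge[OF s(1)[OF vw(2)] f3 Bp[OF lt(3)] ab(2)])
    ultimately obtain x u where x: "x \<in> pts X" "u \<in> W" "f v (act X (- h) x) > 4/10" "f w (act X u x) > 7/10"
      using R_rel_approx[OF ab(3) cv s(1)[OF vw(2)], of "4/10" "7/10"] by auto
    \<comment> \<open>\<open>h\<close> is only near an element \<open>u' + g\<close>; the
      displacements by \<open>b'\<close>, \<open>a'\<close> and \<open>u\<close> cost less than 1/20
      each and leave both values positive.\<close>
    obtain a' u' b' where h': "a' \<in> V0" "u' \<in> A" "b' \<in> V0" "h = a' + u' + g + b'" using F[OF e] h by auto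
    let ?y = "act X (- h) x" let ?y' = "act X b' ?y" let ?z = "act X (u' + g) ?y'"
    have in1: "?y \<in> pts X" "?y' \<in> pts X" "?z \<in> pts X" "act X a' ?z \<in> pts X" using x(1) act_in[OF X] by auto
    have "x = act X h ?y" using act_minus(2)[OF X x(1)] by simp
    also have "\<dots> = act X a' ?z" using in1 gflowD(4)[OF X] act_in[OF X] by (simp add: h'(4) add.assoc)
    finally have eq: "x = act X a' ?z" .
    have "\<bar>f v ?y' - f v ?y\<bar> < 1/20" using V0(3)[OF h'(3) in1(1) vw(1)] .
    then have 1: "f v ?y' > 0" using x(3) by linarith
    have "\<bar>f w (act X a' ?z) - f w ?z\<bar> < 1/20" using V0(3)[OF h'(1) in1(3) vw(2)] .
    moreover have "\<bar>f w (act X u x) - f w x\<bar> < 1/20" using V0(3)[OF _ x(1) vw(2), of u] x(2) W(2) by blast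
    ultimately have "f w ?z > 0" using x(4) unfolding eq[symmetric] by linarith
    with 1 show False using s(6)[OF e in1(2) h'(2)] by blast
  qed
  have m: "1 \<le> m"
  proof -
    obtain v where "v \<in> ?V" using ne by blast
    then have "J v \<subseteq> {..<m}" "J v \<noteq> {}" using J1 by auto
    then show ?thesis by (cases m) auto
  qed
  have "prec M m W E"
    unfolding prec_def
  proof (rule disjI2, intro conjI exI[of _ J] ballI impI)
    fix e assume e: "e \<in> edges_of M"
    obtain g A v w where e': "e = (g, A, v, w)" by (cases e) auto
    have "\<exists>a\<in>W. \<exists>h. \<exists>b\<in>W. u + g = a + h + b \<and> (\<forall>j\<in>J v. \<forall>k'\<in>J w. \<forall>j1<m. \<forall>j2<m. \<forall>k<m.
           (0, j1, j) \<in> set E \<or> (0, j1, j2) \<in> set E \<or> (0, k, k') \<in> set E \<or> (h, j2, k) \<in> set E)"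
      if u: "u \<in> A" for u
    proof -
      have "\<exists>a\<in>W. \<exists>h\<in>F (g, A, v, w). \<exists>b\<in>W. u + g = a + h + b" using F[OF e] u unfolding e' by simp
      then obtain a h b where ahb: "a \<in> W" "h \<in> F (g, A, v, w)" "b \<in> W" "u + g = a + h + b" by blast
      have "(0, j1, j) \<in> set E \<or> (0, j1, j2) \<in> set E \<or> (0, k, k') \<in> set E \<or> (h, j2, k) \<in> set E"
        if "j \<in> J v" "k' \<in> J w" "j1 < m" "j2 < m" "k < m" for j k' j1 j2 k
        using edge[OF e[unfolded e'] ahb(2) that] by blast
      with ahb(1,3,4) show ?thesis by blast
    qed
    then show "case e of (g, A, v, w) \<Rightarrow> \<forall>u\<in>A. \<exists>a\<in>W. \<exists>h. \<exists>b\<in>W. u + g = a + h + b \<and>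
        (\<forall>j\<in>J v. \<forall>k'\<in>J w. \<forall>j1<m. \<forall>j2<m. \<forall>k<m.
           (0, j1, j) \<in> set E \<or> (0, j1, j2) \<in> set E \<or> (0, k, k') \<in> set E \<or> (h, j2, k) \<in> set E)"
      unfolding e' by simp
  qed (use m J1 J2 J3 in auto)
  moreover have "mkstr m W E \<in> tp_G \<N> X" using mkstr_tp_iff[OF N0_D(1)[OF W(1)]] rc by blast
  moreover have "set E \<subseteq> G\<^sub>0 \<times> UNIV" using Fs(2) by (auto simp: E Es_def)
  ultimately show ?thesis using W(1) by blast
qed

end

section \<open>Realizations in the ultracoproduct from refinements in the factors\<close>

context lrpc_family
begin

text \<open>The Urysohn functions of the cells, glued over the index set, are uniformly equicontinuous
  because the bound \<open>\<zeta> W\<close> does not depend on the flow.\<close>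

lemma cell_function:
  assumes A: "W \<in> N_RPC \<N>" and fl: "gflow Z" and ury: "Urysohn Z W (\<zeta> W)"
    and rc: "realizes_code Z m W E B" and j: "j < m"
  shows "\<exists>r. continuous_map (topol Z) euclideanreal r \<and> (\<forall>x\<in>pts Z. r x \<in> {0..1}) \<and>
    (\<forall>x\<in>pts Z. \<forall>g. \<bar>r (act Z g x) - r x\<bar> \<le> \<zeta> W g) \<and>
    (\<forall>x\<in>B j. r x = 1/2) \<and> (\<forall>k<m. (0, k, j) \<in> set E \<longrightarrow> (\<forall>x\<in>B k. r x = 0))"
proof -
  have sn: "seminorm (\<zeta> W)" using zeta A by (auto simp: SN_RPC_def)
  have op: "openin (topol Z) (B k)" "B k \<noteq> {}" "B k \<subseteq> pts Z" if "k < m" for k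
    using rc that openin_subset unfolding realizes_code_def by blast+
  have edge: "((topol Z closure_of (act Z g ` B k)) \<times> (topol Z closure_of B l)) \<inter> R_rel Z W = {}"
    if "(g, k, l) \<in> set E" "k < m" "l < m" for g k l
    using rc that unfolding realizes_code_def by fast
  let ?S = "{k. k < m \<and> (0, k, j) \<in> set E}"
  let ?K = "\<Union>k\<in>?S. topol Z closure_of B k" and ?L = "topol Z closure_of B j"
  have sub: "B k \<subseteq> topol Z closure_of B k" if "k < m" for k
    using closure_of_subset[OF op(3)[OF that]] .
  show ?thesis
  proof (cases "?S = {}")
    case True
    \<comment> \<open>Without cells that must receive 0 there is no non-empty set \<open>?K\<close>,
      and the constant suffices.\<close>
    show ?thesis
      using True sn by (intro exI[of _ "\<lambda>_. 1/2"]) (auto simp: seminorm_def)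
  next
    case False
    have clK: "closedin (topol Z) ?K" by (intro closedin_Union) auto
    have clL: "closedin (topol Z) ?L" by simp
    obtain k where k: "k \<in> ?S" using False by blast
    have "topol Z closure_of B k \<noteq> {}" using sub[of k] op(2)[of k] k by blast
    then have ne: "?K \<noteq> {}" "?L \<noteq> {}" using k sub[OF j] op(2)[OF j] by (blast, blast)
    have disj: "?K \<times> ?L \<inter> R_rel Z W = {}"
    proof -
      have "((topol Z closure_of B k) \<times> ?L) \<inter> R_rel Z W = {}" if "k \<in> ?S" for k
      proof -
        have "act Z 0 ` B k = B k" using gflowD(3)[OF fl] op(3)[of k] that by (force simp: image_iff)
        then show ?thesis using edge[of 0 k j] that j by simp
      qed
      then show ?thesis by blast
    qed
    \<comment> \<open>The Urysohn property offers only values below 1; 1/2 is taken and rescaled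
      later.\<close>
    have half: "0 < (1/2 :: real)" "(1/2 :: real) < 1" by auto
    obtain r where r: "continuous_map (topol Z) (top_of_set {0..1}) r"
        "\<forall>g. \<forall>x\<in>pts Z. \<bar>r (act Z g x) - r x\<bar> \<le> \<zeta> W g" "\<forall>x\<in>?K. r x = 0" "\<forall>x\<in>?L. r x = 1/2"
      using ury[unfolded Urysohn_def, rule_format, OF clK clL ne disj half] by (elim exE conjE)
    have "continuous_map (topol Z) euclideanreal r" "\<forall>x\<in>pts Z. r x \<in> {0..1}"
      using r(1) by (auto simp: continuous_map_in_subtopology image_subset_iff Pi_iff)
    moreover have "\<forall>x\<in>B j. r x = 1/2" using r(4) sub[OF j] by blast
    moreover have "\<forall>k<m. (0, k, j) \<in> set E \<longrightarrow> (\<forall>x\<in>B k. r x = 0)" using r(3) sub by blast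
    ultimately show ?thesis using r(2) by blast
  qed
qed

text \<open>The glued cell functions are positive at a point of a factor only if every cell
  containing the point is close to the given one. A violated edge in the ultracoproduct is
  approximated in a good factor and yields a chain of pairwise close cells there, and
  \<open>prec\<close> excludes exactly such chains.\<close>

lemma tp_ultracoproduct_intro:
  assumes ury: "\<And>i. i \<in> I \<Longrightarrow> zeta_Urysohn \<N> \<zeta> (X i)" and good: "good \<N> M"
    and W: "W \<in> N_RPC \<N>" and pr: "prec M m W E"
    and ev: "eventually (\<lambda>i. mkstr m W E \<in> tp_G \<N> (X i)) \<U>"
  shows "M \<in> tp_G \<N> \<Sigma>"
proof (cases "verts M = {}")
  case True
  have "wdata \<Sigma> (verts M) (edges_of M) (covers_of M) (\<lambda>_ _. 0)"
    unfolding wdata_def using good_empty[OF good True] True by simp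
  then show ?thesis by (rule tp_G_wdata[OF ultracoproduct_gflow good])
next
  case False
  let ?V = "verts M"
  obtain J where J: "\<forall>v\<in>?V. J v \<subseteq> {..<m} \<and> J v \<noteq> {}"
     "\<forall>v\<in>?V. \<forall>w\<in>?V. v \<noteq> w \<longrightarrow> (\<exists>j. j \<in> J v \<and> (\<forall>k\<in>J w. (0, j, k) \<in> set E) \<or>
         j \<in> J w \<and> (\<forall>k\<in>J v. (0, j, k) \<in> set E))"
     "\<forall>c\<in>covers_of M. {..<m} \<subseteq> (\<Union>v\<in>c. J v)"
     "\<forall>(g, A, v, w)\<in>edges_of M. \<forall>u\<in>A. \<exists>a\<in>W. \<exists>f. \<exists>b\<in>W. u + g = a + f + b \<and>
        (\<forall>j\<in>J v. \<forall>k'\<in>J w. \<forall>j1<m. \<forall>j2<m. \<forall>k<m.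
           (0, j1, j) \<in> set E \<or> (0, j1, j2) \<in> set E \<or> (0, k, k') \<in> set E \<or> (f, j2, k) \<in> set E)"
    and m: "1 \<le> m"
    using pr False unfolding prec_def by (elim disjE exE conjE) simp_all
  note fl = ultracoproduct_gflow
  let ?good = "\<lambda>i. \<exists>B. realizes_code (X i) m W E B"
  have evg: "eventually ?good \<U>" using ev by eventually_elim (simp add: mkstr_tp_iff[OF W])
  define B where "B i = (SOME B. realizes_code (X i) m W E B)" for i
  have B: "realizes_code (X i) m W E (B i)" if "?good i" for i
    unfolding B_def using that by (rule someI_ex)
  let ?R = "\<lambda>j i r. continuous_map (topol (X i)) euclideanreal r \<and> (\<forall>x\<in>pts (X i). r x \<in> {0..1}) \<and>
    (\<forall>x\<in>pts (X i). \<forall>g. \<bar>r (act (X i) g x) - r x\<bar> \<le> \<zeta> W g) \<and>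
    (?good i \<longrightarrow> (\<forall>x\<in>B i j. r x = 1/2) \<and> (\<forall>k<m. (0, k, j) \<in> set E \<longrightarrow> (\<forall>x\<in>B i k. r x = 0)))"
  have "\<exists>p\<in>RC. \<forall>i\<in>I. ?good i \<longrightarrow>
      (\<forall>x\<in>B i j. p (i, x) = of_real (1/2)) \<and> (\<forall>k<m. (0, k, j) \<in> set E \<longrightarrow> (\<forall>x\<in>B i k. p (i, x) = 0))"
    if j: "j < m" for j
  proof -
    have "\<forall>i\<in>I. \<exists>r. ?R j i r"
    proof
      fix i assume i: "i \<in> I"
      show "\<exists>r. ?R j i r"
      proof (cases "?good i")
        case True
        have "Urysohn (X i) W (\<zeta> W)" using ury[OF i] W unfolding zeta_Urysohn_def by blast
        from cell_function[OF W flows[OF i] this B[OF True] j] show ?thesis by blast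
      next
        case False
        have "seminorm (\<zeta> W)" using zeta W by (auto simp: SN_RPC_def)
        then show ?thesis using False by (intro exI[of _ "\<lambda>_. 0"]) (auto simp: seminorm_def)
      qed
    qed
    from bchoice[OF this] obtain r where r0: "\<forall>i\<in>I. ?R j i (r i)" by (elim exE)
    have r: "?R j i (r i)" if "i \<in> I" for i by (rule bspec[OF r0 that])
    have "\<exists>p\<in>RC. \<forall>i\<in>I. \<forall>x\<in>pts (X i). p (i, x) = of_real (r i x)"
      using r by (intro Lipschitz_glue[OF W]) blast+
    then obtain p where p: "p \<in> RC" "\<forall>i\<in>I. \<forall>x\<in>pts (X i). p (i, x) = of_real (r i x)" by blast
    have "(\<forall>x\<in>B i j. p (i, x) = of_real (1/2)) \<and> (\<forall>k<m. (0, k, j) \<in> set E \<longrightarrow> (\<forall>x\<in>B i k. p (i, x) = 0))"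
      if i: "i \<in> I" and g: "?good i" for i
    proof -
      have sub: "B i k \<subseteq> pts (X i)" if "k < m" for k
        using B[OF g] that openin_subset unfolding realizes_code_def by blast
      have v: "(\<forall>x\<in>B i j. r i x = 1/2)" "(\<forall>k<m. (0, k, j) \<in> set E \<longrightarrow> (\<forall>x\<in>B i k. r i x = 0))"
        using r[OF i] g by blast+
      have "p (i, x) = of_real (1/2)" if "x \<in> B i j" for x
        using p(2) i sub[OF j] v(1) that by fastforce
      moreover have "p (i, x) = 0" if "k < m" "(0, k, j) \<in> set E" "x \<in> B i k" for k x
        using p(2) i sub[OF that(1)] v(2) that by fastforce
      ultimately show ?thesis by blast
    qed
    with p(1) show ?thesis by blast
  qed
  then have "\<forall>j\<in>{..<m}. \<exists>p. p \<in> RC \<and> (\<forall>i\<in>I. ?good i \<longrightarrow>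
      (\<forall>x\<in>B i j. p (i, x) = of_real (1/2)) \<and> (\<forall>k<m. (0, k, j) \<in> set E \<longrightarrow> (\<forall>x\<in>B i k. p (i, x) = 0)))"
    by blast
  from bchoice[OF this] obtain p where p0: "\<forall>j\<in>{..<m}. p j \<in> RC \<and> (\<forall>i\<in>I. ?good i \<longrightarrow>
      (\<forall>x\<in>B i j. p j (i, x) = of_real (1/2)) \<and> (\<forall>k<m. (0, k, j) \<in> set E \<longrightarrow> (\<forall>x\<in>B i k. p j (i, x) = 0)))"
    by (elim exE)
  have pRC: "p j \<in> RC" if "j < m" for j using p0 that by blast
  note pC = RC_D[OF pRC]
  have phalf: "p j (i, x) = of_real (1/2)" if "j < m" "i \<in> I" "?good i" "x \<in> B i j" for j i x
    using p0 that by (metis lessThan_iff)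
  have pzero: "p j (i, x) = 0" if "j < m" "i \<in> I" "?good i" "k < m" "(0, k, j) \<in> set E" "x \<in> B i k" for j i x k
    using p0 that by (metis lessThan_iff)
  have Bop: "B i j \<noteq> {}" "B i j \<subseteq> pts (X i)" if "?good i" "j < m" for i j
    using B[OF that(1)] that(2) openin_subset unfolding realizes_code_def by blast+
  have Bcov: "\<exists>j<m. x \<in> B i j" if "?good i" "x \<in> pts (X i)" for i x
    using B[OF that(1)] that(2) m unfolding realizes_code_def by blast
  have Bedge: "(y, z) \<notin> R_rel (X i) W"
    if g: "?good i" and i: "i \<in> I" and e: "(h, j, k) \<in> set E" "j < m" "k < m"
      and y: "act (X i) (- h) y \<in> B i j" "y \<in> pts (X i)" and z: "z \<in> B i k" for i h j k y z
  proof -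
    have "((topol (X i) closure_of (act (X i) h ` B i j)) \<times> (topol (X i) closure_of B i k)) \<inter> R_rel (X i) W = {}"
      using B[OF g] e unfolding realizes_code_def by fast
    moreover have "y \<in> act (X i) h ` B i j"
      using act_minus(2)[OF flows[OF i] y(2), of h] y(1) by (metis imageI)
    moreover have "act (X i) h ` B i j \<subseteq> pts (X i)" using Bop(2)[OF g e(2)] act_in[OF flows[OF i]] by blast
    then have "act (X i) h ` B i j \<subseteq> topol (X i) closure_of (act (X i) h ` B i j)" by (rule closure_of_subset)
    moreover have "z \<in> topol (X i) closure_of B i k" using closure_of_subset[OF Bop(2)[OF g e(3)]] z by blast
    ultimately show ?thesis by blast
  qed
  have Jm: "j < m" if "v \<in> ?V" "j \<in> J v" for v j using J(1) that by blast
  have finJ: "finite (J v)" if "v \<in> ?V" for v using J(1) that finite_subset by blast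
  have ppos: "0 \<le> Re (\<phi> (p j))" if "\<phi> \<in> Sg" "j < m" for \<phi> j
    using RC_character[OF pRC[OF that(2)] SgD(1)[OF that(1)]] by blast
  \<comment> \<open>The factor 2 turns the value 1/2 of a cell function on its own cell into
    1.\<close>
  define F where "F v \<phi> = (\<Sum>j\<in>J v. 2 * Re (\<phi> (p j)))" for v and \<phi> :: "('i \<times> 'x \<Rightarrow> complex) \<Rightarrow> complex"
  have Fge: "F v \<phi> \<ge> 2 * Re (\<phi> (p j))" if "\<phi> \<in> Sg" "v \<in> ?V" "j \<in> J v" for \<phi> v j
    unfolding F_def using that finJ ppos Jm
    by (intro member_le_sum[of j "J v" "\<lambda>j. 2 * Re (\<phi> (p j))"]) auto
  have Fpos: "\<exists>j\<in>J v. Re (\<phi> (p j)) > 0" if "F v \<phi> > 1/4" for \<phi> v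
  proof (rule ccontr)
    assume "\<not> ?thesis"
    then have "F v \<phi> \<le> 0" unfolding F_def by (intro sum_nonpos) auto
    with that show False by simp
  qed
  \<comment> \<open>A limit of points in the \<open>j\<close>-th cells of the good factors; the
    values of the cell functions there do not vary with the factor.\<close>
  have cell_point: "\<exists>\<phi>\<in>Sg. Re (\<phi> (p j)) = 1/2 \<and> (\<forall>k<m. (0, j, k) \<in> set E \<longrightarrow> Re (\<phi> (p k)) = 0)" if j: "j < m" for j
  proof -
    let ?P = "\<lambda>i x. x \<in> pts (X i) \<and> i \<in> I \<and> ?good i \<and> x \<in> B i j"
    have "eventually (\<lambda>i. \<exists>x. ?P i x) \<U>"
      using U_in_I evg
    proof eventually_elim
      case (elim i)
      then show ?case using Bop(1)[OF elim(2) j] Bop(2)[OF elim(2) j] by blast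
    qed
    then obtain x where x: "eventually (\<lambda>i. ?P i (x i)) \<U>" unfolding eventually_ex by blast
    have "\<exists>\<phi>\<in>Sg. (\<forall>p\<in>C_G Y. \<forall>t. (\<forall>i\<in>I. \<forall>z. ?P i z \<longrightarrow> Re (p (i, z)) \<ge> t) \<longrightarrow> Re (\<phi> p) \<ge> t) \<and>
      (\<forall>p\<in>C_G Y. \<forall>t. (\<forall>i\<in>I. \<forall>z. ?P i z \<longrightarrow> Re (p (i, z)) \<le> t) \<longrightarrow> Re (\<phi> p) \<le> t)"
      by (rule Sg_limit_ge[of ?P x, OF x]) (elim conjE)
    then obtain \<phi> where phi: "\<phi> \<in> Sg"
      "\<forall>p\<in>C_G Y. \<forall>t. (\<forall>i\<in>I. \<forall>z. ?P i z \<longrightarrow> Re (p (i, z)) \<ge> t) \<longrightarrow> Re (\<phi> p) \<ge> t"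
      "\<forall>p\<in>C_G Y. \<forall>t. (\<forall>i\<in>I. \<forall>z. ?P i z \<longrightarrow> Re (p (i, z)) \<le> t) \<longrightarrow> Re (\<phi> p) \<le> t"
      by (elim bexE conjE)
    have val: "Re (\<phi> q) = t" if q: "q \<in> C_G Y" and t: "\<And>i z. ?P i z \<Longrightarrow> Re (q (i, z)) = t" for q t
    proof (rule antisym)
      show "Re (\<phi> q) \<le> t" by (rule phi(3)[THEN bspec, OF q, THEN spec, THEN mp]) (use t in force)
      show "t \<le> Re (\<phi> q)" by (rule phi(2)[THEN bspec, OF q, THEN spec, THEN mp]) (use t in force)
    qed
    have "Re (\<phi> (p j)) = 1/2"
    proof (rule val[OF pC[OF j]], elim conjE)
      fix i z assume "i \<in> I" "?good i" "z \<in> B i j"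
      from phalf[OF j this] show "Re (p j (i, z)) = 1/2" by (simp only: Re_complex_of_real)
    qed
    moreover have "Re (\<phi> (p k)) = 0" if k: "k < m" "(0, j, k) \<in> set E" for k
    proof (rule val[OF pC[OF k(1)]], elim conjE)
      fix i z assume "i \<in> I" "?good i" "z \<in> B i j"
      from pzero[OF k(1) this(1,2) j k(2) this(3)] show "Re (p k (i, z)) = 0" by (simp only: zero_complex.simps)
    qed
    ultimately show ?thesis using phi(1) by blast
  qed
  have near: "\<bar>Re a - Re b\<bar> < e" if "dist a b < e" for a b e
    using that abs_Re_le_cmod[of "a - b"] by (simp add: dist_norm)
  have w1: "continuous_map (topol \<Sigma>) euclideanreal (F v)" if "v \<in> ?V" for v
    unfolding F_def using that finJ Jm pC
    by (intro continuous_map_sum continuous_map_real_mult_left Sigma_eval_continuous) auto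
  have w2: "\<exists>\<phi>\<in>Sg. F v \<phi> > 1/2" if v: "v \<in> ?V" for v
  proof -
    obtain j where j: "j \<in> J v" using J(1) v by blast
    obtain \<phi> where phi: "\<phi> \<in> Sg" "Re (\<phi> (p j)) = 1/2" using cell_point[OF Jm[OF v j]] by blast
    then have "F v \<phi> > 1/2" using Fge[OF phi(1) v j] by linarith
    with phi(1) show ?thesis by blast
  qed
  have sep: "\<exists>\<phi>\<in>Sg. F v \<phi> > 1/2 \<and> F w \<phi> \<le> 1/2"
    if v: "v \<in> ?V" and w: "w \<in> ?V" and j: "j \<in> J v" "\<forall>k\<in>J w. (0, j, k) \<in> set E" for v w j
  proof -
    obtain \<phi> where phi: "\<phi> \<in> Sg" "Re (\<phi> (p j)) = 1/2" "\<forall>k<m. (0, j, k) \<in> set E \<longrightarrow> Re (\<phi> (p k)) = 0"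
      using cell_point[OF Jm[OF v j(1)]] by blast
    have "F v \<phi> > 1/2" using Fge[OF phi(1) v j(1)] phi(2) by linarith
    moreover have "F w \<phi> = 0" unfolding F_def using phi(3) j(2) Jm[OF w] by (intro sum.neutral) auto
    ultimately show ?thesis using phi(1) by (intro bexI[of _ \<phi>]) auto
  qed
  have w3: "\<exists>\<phi>\<in>Sg. F v \<phi> > 1/2 \<and> F w \<phi> \<le> 1/2 \<or> F w \<phi> > 1/2 \<and> F v \<phi> \<le> 1/2"
    if vw: "v \<in> ?V" "w \<in> ?V" "v \<noteq> w" for v w
  proof -
    obtain j where "j \<in> J v \<and> (\<forall>k\<in>J w. (0, j, k) \<in> set E) \<or> j \<in> J w \<and> (\<forall>k\<in>J v. (0, j, k) \<in> set E)"
      using J(2) vw by blast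
    then show ?thesis using sep[OF vw(1,2)] sep[OF vw(2,1)] by (elim disjE conjE) blast+
  qed
  have w4: "\<exists>v\<in>c. F v \<phi> > 1/2" if c: "c \<in> covers_of M" and phi: "\<phi> \<in> Sg" for c \<phi>
  proof -
    \<comment> \<open>A nearby point of a good factor lies in some cell, where the function is 1/2;
      within 1/10 more than 3/10 remains, and doubled this exceeds 1/2.\<close>
    have "eventually (\<lambda>i. i \<in> I \<and> (\<exists>x\<in>pts (X i). \<forall>q\<in>p ` {..<m}. dist (q (i, x)) (\<phi> q) < 1/10)) \<U>"
      using phi pC by (intro Sg_approx) auto
    from ultra_ex_of_ev[OF ultra_U eventually_conj[OF this evg]]
    obtain i where "(i \<in> I \<and> (\<exists>x\<in>pts (X i). \<forall>q\<in>p ` {..<m}. dist (q (i, x)) (\<phi> q) < 1/10)) \<and> ?good i" by (elim exE)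
    then obtain x where i: "i \<in> I" "?good i" and x: "x \<in> pts (X i)" "\<forall>q\<in>p ` {..<m}. dist (q (i, x)) (\<phi> q) < 1/10"
      by (elim conjE bexE)
    obtain j where j: "j < m" "x \<in> B i j" using Bcov[OF i(2) x(1)] by blast
    have "\<bar>Re (p j (i, x)) - Re (\<phi> (p j))\<bar> < 1/10" using x(2) j(1) by (intro near) blast
    moreover have "Re (p j (i, x)) = 1/2" by (simp only: phalf[OF j(1) i j(2)] Re_complex_of_real)
    ultimately have ge: "Re (\<phi> (p j)) > 3/10" by linarith
    obtain v where v: "v \<in> c" "j \<in> J v" using J(3) c j(1) by blast
    have "v \<in> ?V" using goodD(5)[OF good c] v(1) by blast
    then have "F v \<phi> > 1/2" using Fge[OF phi _ v(2)] ge by fastforce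
    with v(1) show ?thesis by blast
  qed
  have w5: "\<not> (F v \<phi> > 1/4 \<and> F w (act \<Sigma> (u + g) \<phi>) > 1/4)"
    if e: "(g, A, v, w) \<in> edges_of M" and phi: "\<phi> \<in> Sg" and u: "u \<in> A" for g A v w \<phi> u
  proof
    assume a: "F v \<phi> > 1/4 \<and> F w (act \<Sigma> (u + g) \<phi>) > 1/4"
    have vw: "v \<in> ?V" "w \<in> ?V" using goodD(4)[OF good e] by auto
    obtain j where j: "j \<in> J v" "Re (\<phi> (p j)) > 0" using Fpos a by blast
    obtain k' where k': "k' \<in> J w" "Re (act \<Sigma> (u + g) \<phi> (p k')) > 0" using Fpos a by blast
    note jm = Jm[OF vw(1) j(1)] and km = Jm[OF vw(2) k'(1)]
    let ?q = "translate Y (p k') (u + g)"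
    have qpos: "Re (\<phi> ?q) > 0" using k'(2) by (simp add: act_Sigma[OF pC[OF km]])
    \<comment> \<open>With this tolerance both values remain positive at the approximating
      point.\<close>
    let ?d = "min (Re (\<phi> (p j))) (Re (\<phi> ?q))"
    have "eventually (\<lambda>i. i \<in> I \<and> (\<exists>x\<in>pts (X i). \<forall>q\<in>{p j, ?q}. dist (q (i, x)) (\<phi> q) < ?d)) \<U>"
      using phi pC[OF jm] translate_C_G[OF pC[OF km]] j(2) qpos by (intro Sg_approx) auto
    from ultra_ex_of_ev[OF ultra_U eventually_conj[OF this evg]]
    obtain i where "(i \<in> I \<and> (\<exists>x\<in>pts (X i). \<forall>q\<in>{p j, ?q}. dist (q (i, x)) (\<phi> q) < ?d)) \<and> ?good i" by (elim exE)
    then obtain x where i: "i \<in> I" "?good i" and x: "x \<in> pts (X i)" "\<forall>q\<in>{p j, ?q}. dist (q (i, x)) (\<phi> q) < ?d"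
      by (elim conjE bexE)
    note fli = flows[OF i(1)]
    have "\<bar>Re (p j (i, x)) - Re (\<phi> (p j))\<bar> < ?d" using x(2) by (intro near) simp
    then have pj: "Re (p j (i, x)) > 0" by linarith
    have "\<bar>Re (?q (i, x)) - Re (\<phi> ?q)\<bar> < ?d" using x(2) by (intro near) simp
    then have "Re (?q (i, x)) > 0" by linarith
    then have pk: "Re (p k' (i, act (X i) (u + g) x)) > 0"
      using x(1) i(1) by (simp add: translate_def pts_Y act_Y)
    have "\<exists>a\<in>W. \<exists>f. \<exists>b\<in>W. u + g = a + f + b \<and>
        (\<forall>j\<in>J v. \<forall>k'\<in>J w. \<forall>j1<m. \<forall>j2<m. \<forall>k<m.
           (0, j1, j) \<in> set E \<or> (0, j1, j2) \<in> set E \<or> (0, k, k') \<in> set E \<or> (f, j2, k) \<in> set E)"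
      using J(4) e u by fast
    then obtain a f b where ab: "a \<in> W" "b \<in> W" "u + g = a + f + b"
      and comb: "\<forall>j\<in>J v. \<forall>k'\<in>J w. \<forall>j1<m. \<forall>j2<m. \<forall>k<m.
           (0, j1, j) \<in> set E \<or> (0, j1, j2) \<in> set E \<or> (0, k, k') \<in> set E \<or> (f, j2, k) \<in> set E"
      by (elim bexE exE conjE)
    \<comment> \<open>\<open>x\<close>, \<open>?y\<close> and \<open>?z\<close> choose the cells
      \<open>j1\<close>, \<open>j2\<close> and \<open>k\<close>. The moves by \<open>b\<close> and
      by \<open>a\<close> stay within \<open>W\<close>, which makes \<open>j1\<close> and
      \<open>j2\<close> close, and likewise \<open>j2\<close> moved by \<open>f\<close> and
      \<open>k\<close>; positivity of the cell functions makes \<open>j1\<close> close to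
      \<open>j\<close> and \<open>k\<close> close to \<open>k'\<close>.\<close>
    let ?y = "act (X i) b x" let ?fy = "act (X i) f ?y" let ?z = "act (X i) (u + g) x"
    have in1: "?y \<in> pts (X i)" "?fy \<in> pts (X i)" "?z \<in> pts (X i)" using x(1) act_in[OF fli] by auto
    have z: "?z = act (X i) a ?fy" using x(1) in1 gflowD(4)[OF fli] by (simp add: ab(3) add.assoc)
    obtain j1 where j1: "j1 < m" "x \<in> B i j1" using Bcov[OF i(2) x(1)] by blast
    obtain j2 where j2: "j2 < m" "?y \<in> B i j2" using Bcov[OF i(2) in1(1)] by blast
    obtain k where k: "k < m" "?z \<in> B i k" using Bcov[OF i(2) in1(3)] by blast
    have n1: "(0, j1, j) \<notin> set E" using pzero[OF jm i j1(1) _ j1(2)] pj by auto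
    have n2: "(0, k, k') \<notin> set E" using pzero[OF km i k(1) _ k(2)] pk by auto
    have n3: "(0, j1, j2) \<notin> set E"
      using Bedge[OF i(2,1) _ j1(1) j2(1) _ x(1) j2(2), of 0] R_relI[OF fli x(1) ab(2)] j1(2) gflowD(3)[OF fli x(1)]
      by auto
    have n4: "(f, j2, k) \<notin> set E"
      using Bedge[OF i(2,1) _ j2(1) k(1) _ in1(2) k(2), of f] R_relI[OF fli in1(2) ab(1)] j2(2)
        act_minus(1)[OF fli in1(1), of f] z by auto
    show False using comb j(1) k'(1) j1(1) j2(1) k(1) n1 n2 n3 n4 by blast
  qed
  have "wdata \<Sigma> ?V (edges_of M) (covers_of M) F"
    unfolding wdata_def pts_ultracoproduct
  proof (intro conjI ballI impI)
    fix e assume "e \<in> edges_of M"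
    then show "case e of (g, A, v, w) \<Rightarrow> \<forall>\<phi>\<in>Sg. \<forall>u\<in>A. \<not> (F v \<phi> > 1/4 \<and> F w (act \<Sigma> (u + g) \<phi>) > 1/4)"
      using w5 by (cases e) simp
  qed (fact w1 w2 w3 w4)+
  then show ?thesis by (rule tp_G_wdata[OF fl good])
qed

end

subsection \<open>Small factors with the same weak type\<close>

text \<open>The factor \<open>nat\<close> makes the index type infinite even for a finite group, so
  it is as large as its square.\<close>

lemma pairing_universe:
  "\<exists>P :: ('g set \<times> nat) \<times> ('g set \<times> nat) \<Rightarrow> 'g set \<times> nat. inj P"
proof -
  let ?A = "UNIV :: ('g set \<times> nat) set"
  have "infinite ?A" by (simp add: finite_prod)
  then have "(card_of (?A \<times> ?A), card_of ?A) \<in> ordLeq"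
    using card_of_Times_same_infinite ordIso_imp_ordLeq by blast
  then have "\<exists>f. inj_on f (?A \<times> ?A) \<and> f ` (?A \<times> ?A) \<subseteq> ?A" unfolding card_of_ordLeq .
  then show ?thesis by auto
qed

fun nest :: "('a \<times> 'a \<Rightarrow> 'a) \<Rightarrow> 'a \<Rightarrow> 'a list \<Rightarrow> 'a" where
  "nest P x0 [] = x0"
| "nest P x0 (x # xs) = P (x, nest P x0 xs)"

lemma nest_inj:
  assumes "inj P"
  shows "length xs = length ys \<Longrightarrow> nest P x0 xs = nest P x0 ys \<Longrightarrow> xs = ys"
  by (induction xs ys rule: list_induct2) (auto dest: injD[OF assms])

text \<open>Iterated pairing is injective on lists of equal length; the length is stored in
  front.\<close>

lemma list_code_universe:
  "\<exists>c :: ('g set \<times> nat) list \<Rightarrow> 'g set \<times> nat. inj c"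
proof -
  obtain P :: "('g set \<times> nat) \<times> ('g set \<times> nat) \<Rightarrow> 'g set \<times> nat" where P: "inj P"
    using pairing_universe by blast
  have "inj (\<lambda>xs. P (({}, length xs), nest P ({}, 0) xs))"
  proof (rule injI)
    fix xs ys
    assume "P (({}, length xs), nest P ({}, 0) xs) = P (({}, length ys), nest P ({}, 0) ys)"
    then have "length xs = length ys" "nest P ({}, 0) xs = nest P ({}, 0) ys" using injD[OF P] by blast+
    then show "xs = ys" by (rule nest_inj[OF P])
  qed
  then show ?thesis by blast
qed

text \<open>Names for the functions that generate the factor flow: besides witnesses for realizations
  (\<open>Leaf\<close>) and for the Urysohn property (\<open>Ury\<close>), they contain enough operations for
  \<open>lattice_separation\<close> and are closed under translation.\<close>

datatype 'g tm =
    Zero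
  | One
  | Leaf "('g \<times> 'g set \<times> nat \<times> nat) list" "nat list list" nat nat
  | Trans 'g "'g tm"
  | Ury "'g set" nat "'g tm" "'g tm"
  | Bump rat nat "'g tm"
  | Mx "'g tm" "'g tm"
  | Mn "'g tm" "'g tm"
  | Dbl "'g tm"

text \<open>The first entry tags the constructor. Group elements are stored as singletons,
  neighborhoods as themselves, countable data as natural numbers through
  \<open>to_nat\<close>.\<close>

primrec enc :: "(('g set \<times> nat) list \<Rightarrow> 'g set \<times> nat) \<Rightarrow> 'g tm \<Rightarrow> 'g set \<times> nat" where
  "enc c Zero = c [({}, 0)]"
| "enc c One = c [({}, 1)]"
| "enc c (Leaf E C n v) = c [({}, 2), c (map (\<lambda>(g, U, a, b). c [({g}, a), (U, b)]) E), ({}, to_nat (C, n, v))]"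
| "enc c (Trans g t) = c [({}, 3), ({g}, 0), enc c t]"
| "enc c (Ury U n t s) = c [({}, 4), (U, n), enc c t, enc c s]"
| "enc c (Bump q n t) = c [({}, 5), ({}, to_nat (q, n)), enc c t]"
| "enc c (Mx t s) = c [({}, 6), enc c t, enc c s]"
| "enc c (Mn t s) = c [({}, 7), enc c t, enc c s]"
| "enc c (Dbl t) = c [({}, 8), enc c t]"

lemma enc_inj:
  assumes c: "inj c"
  shows "enc c t = enc c t' \<Longrightarrow> t = t'"
proof (induction t arbitrary: t')
  case (Leaf E C n v)
  have "inj (\<lambda>(g, U, a, b). c [({g}, a), (U, b)])"
    by (rule injI) (auto simp: inj_eq[OF c])
  note m = inj_map_eq_map[OF this]
  from Leaf show ?case by (cases t') (simp_all add: inj_eq[OF c] m)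
next
  case Zero then show ?case by (cases t') (simp_all add: inj_eq[OF c])
next
  case One then show ?case by (cases t') (simp_all add: inj_eq[OF c])
next
  case (Trans g t) then show ?case by (cases t') (auto simp add: inj_eq[OF c])
next
  case (Ury U n t s) then show ?case by (cases t') (auto simp add: inj_eq[OF c])
next
  case (Bump q n t) then show ?case by (cases t') (auto simp add: inj_eq[OF c])
next
  case (Mx t s) then show ?case by (cases t') (auto simp add: inj_eq[OF c])
next
  case (Mn t s) then show ?case by (cases t') (auto simp add: inj_eq[OF c])
next
  case (Dbl t) then show ?case by (cases t') (auto simp add: inj_eq[OF c])
qed

declare enc.simps [simp del]

text \<open>The index type may be countable, so only countably many levels can be named. The levels
  1 - 1/(n+2) lie strictly between 0 and 1 and tend to 1; every smaller level is obtained from one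
  of them by truncation.\<close>

definition ury_witness ::
    "('g::topological_group_add, 'x) gspace \<Rightarrow> ('g \<Rightarrow> real) \<Rightarrow> nat \<Rightarrow> ('x \<Rightarrow> real) \<Rightarrow> ('x \<Rightarrow> real) \<Rightarrow> ('x \<Rightarrow> real) \<Rightarrow> bool" where
  "ury_witness X \<sigma> n f h p \<longleftrightarrow>
     continuous_map (topol X) euclideanreal p \<and> (\<forall>x\<in>pts X. p x \<in> {0..1}) \<and>
     (\<forall>g. \<forall>x\<in>pts X. \<bar>p (act X g x) - p x\<bar> \<le> \<sigma> g) \<and>
     (\<forall>x\<in>pts X. f x \<ge> 1/2 \<longrightarrow> p x = 0) \<and> (\<forall>x\<in>pts X. h x \<ge> 1/2 \<longrightarrow> p x = 1 - 1 / (real n + 2))"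

text \<open>All \<open>Leaf\<close> names that differ only in the vertex refer to one choice of
  realization, so their values fit together. Names without a witness denote 0.\<close>

primrec val :: "('g::topological_group_add, 'x) gspace \<Rightarrow> ('g set \<Rightarrow> 'g \<Rightarrow> real) \<Rightarrow> 'g tm \<Rightarrow> 'x \<Rightarrow> real" where
  "val X \<zeta> Zero = (\<lambda>_. 0)"
| "val X \<zeta> One = (\<lambda>_. 1)"
| "val X \<zeta> (Leaf E C n v) =
     (if v < n \<and> (\<exists>f. sdata X {..<n} (set E) (set ` set C) f)
      then (SOME f. sdata X {..<n} (set E) (set ` set C) f) v else (\<lambda>_. 0))"
| "val X \<zeta> (Trans g t) = (\<lambda>x. val X \<zeta> t (act X g x))"
| "val X \<zeta> (Ury U n t s) =
     (if \<exists>p. ury_witness X (\<zeta> U) n (val X \<zeta> t) (val X \<zeta> s) p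
      then (SOME p. ury_witness X (\<zeta> U) n (val X \<zeta> t) (val X \<zeta> s) p) else (\<lambda>_. 0))"
| "val X \<zeta> (Bump q n t) = (\<lambda>x. max 0 (1 - real n * \<bar>val X \<zeta> t x - of_rat q\<bar>))"
| "val X \<zeta> (Mx t s) = (\<lambda>x. max (val X \<zeta> t x) (val X \<zeta> s x))"
| "val X \<zeta> (Mn t s) = (\<lambda>x. min (val X \<zeta> t x) (val X \<zeta> s x))"
| "val X \<zeta> (Dbl t) = (\<lambda>x. min 1 (2 * val X \<zeta> t x))"

lemma val_continuous:
  assumes X: "gflow X"
  shows "continuous_map (topol X) euclideanreal (val X \<zeta> t) \<and> (\<forall>x\<in>pts X. val X \<zeta> t x \<in> {0..1})"
proof (induction t)
  case (Leaf E C n v)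
  show ?case
  proof (cases "v < n \<and> (\<exists>f. sdata X {..<n} (set E) (set ` set C) f)")
    case True
    then have ex: "\<exists>f. sdata X {..<n} (set E) (set ` set C) f" by simp
    have "sdata X {..<n} (set E) (set ` set C) (SOME f. sdata X {..<n} (set E) (set ` set C) f)"
      by (rule someI_ex[OF ex])
    from sdataD(1,2)[OF this] show ?thesis using True by simp
  next
    case False
    have "val X \<zeta> (Leaf E C n v) = (\<lambda>_. 0)"
      unfolding val.simps using False by (rule if_not_P)
    then show ?thesis by simp
  qed
next
  case (Trans g t)
  then show ?case using compose_act_continuous[OF X Trans[THEN conjunct1]] act_in[OF X] by simp
next
  case (Ury U n t s)
  show ?case
  proof (cases "\<exists>p. ury_witness X (\<zeta> U) n (val X \<zeta> t) (val X \<zeta> s) p")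
    case True
    have "val X \<zeta> (Ury U n t s) = (SOME p. ury_witness X (\<zeta> U) n (val X \<zeta> t) (val X \<zeta> s) p)"
      unfolding val.simps using True by (rule if_P)
    then have "ury_witness X (\<zeta> U) n (val X \<zeta> t) (val X \<zeta> s) (val X \<zeta> (Ury U n t s))"
      using someI_ex[OF True] by (simp only:)
    then show ?thesis unfolding ury_witness_def by (elim conjE) (rule conjI)
  next
    case False
    have "val X \<zeta> (Ury U n t s) = (\<lambda>_. 0)"
      unfolding val.simps using False by (rule if_not_P)
    then show ?thesis by simp
  qed
next
  case (Bump q n t)
  have "continuous_map (topol X) euclideanreal (\<lambda>x. max 0 (1 - real n * \<bar>val X \<zeta> t x - of_rat q\<bar>))"
    using Bump by (intro continuous_map_real_max continuous_map_diff continuous_map_real_mult_left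
        continuous_map_real_abs) auto
  then show ?case by auto
next
  case (Mx t s)
  then have "continuous_map (topol X) euclideanreal (\<lambda>x. max (val X \<zeta> t x) (val X \<zeta> s x))"
    by (intro continuous_map_real_max) auto
  with Mx show ?case by (auto simp: max_def)
next
  case (Mn t s)
  then have "continuous_map (topol X) euclideanreal (\<lambda>x. min (val X \<zeta> t x) (val X \<zeta> s x))"
    by (intro continuous_map_real_min) auto
  with Mn show ?case by (auto simp: min_def)
next
  case (Dbl t)
  then have "continuous_map (topol X) euclideanreal (\<lambda>x. min 1 (2 * val X \<zeta> t x))"
    by (intro continuous_map_real_min continuous_map_real_mult_left) auto
  with Dbl show ?case by (auto simp: min_def)
qed simp_all

section \<open>The factor flow on the universe\<close>

locale factor_flow =
  fixes X :: "('g::topological_group_add, 'x) gspace" and \<zeta> :: "'g set \<Rightarrow> 'g \<Rightarrow> real"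
    and c :: "('g set \<times> nat) list \<Rightarrow> 'g set \<times> nat"
  assumes X: "gflow X" and c: "inj c"
begin

abbreviation vl :: "'g tm \<Rightarrow> 'x \<Rightarrow> real" where
  "vl \<equiv> val X \<zeta>"

definition \<pi> :: "'x \<Rightarrow> 'g universe" where
  "\<pi> x k = (if k \<in> range (enc c) then vl (inv (enc c) k) x else 0)"

text \<open>The action is a rearrangement of coordinates: the value of a translated point at the
  name \<open>t\<close> is the value of the point at \<open>Trans g t\<close>. It therefore needs no
  choice of preimages in \<open>X\<close>.\<close>

definition Z :: "('g, 'g universe) gspace" where
  "Z = \<lparr>topol = subtopology (product_topology (\<lambda>_. euclidean) UNIV) (\<pi> ` pts X),
     act = (\<lambda>g y k. if k \<in> range (enc c) then y (enc c (Trans g (inv (enc c) k))) else 0)\<rparr>"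

lemma inv_enc: "inv (enc c) (enc c t) = t"
  using enc_inj[OF c] by (intro inv_f_f injI)

lemma pi_enc: "\<pi> x (enc c t) = vl t x"
  by (simp add: \<pi>_def inv_enc)

lemma act_enc: "act Z g y (enc c t) = y (enc c (Trans g t))"
  by (simp add: Z_def inv_enc)

lemma pts_Z: "pts Z = \<pi> ` pts X"
  by (simp add: Z_def)

lemma act_pi: "act Z g (\<pi> x) = \<pi> (act X g x)"
proof
  fix k
  show "act Z g (\<pi> x) k = \<pi> (act X g x) k"
  proof (cases "k \<in> range (enc c)")
    case True
    then obtain t where "k = enc c t" by blast
    then show ?thesis by (simp add: act_enc pi_enc)
  qed (simp add: Z_def \<pi>_def)
qed

lemma vl_continuous: "continuous_map (topol X) euclideanreal (vl t)"
  and vl_range: "x \<in> pts X \<Longrightarrow> vl t x \<in> {0..1}"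
  using val_continuous[OF X] by blast+

lemma pi_continuous: "continuous_map (topol X) (topol Z) \<pi>"
proof -
  have "continuous_map (topol X) euclideanreal (\<lambda>x. \<pi> x k)" for k
  proof (cases "k \<in> range (enc c)")
    case True
    then obtain t where "k = enc c t" by blast
    then show ?thesis using vl_continuous by (simp add: pi_enc)
  qed (simp add: \<pi>_def)
  then show ?thesis
    unfolding Z_def gspace.simps continuous_map_in_subtopology by (auto simp: continuous_map_componentwise_UNIV)
qed

lemma coord_continuous: "continuous_map (topol Z) euclideanreal (\<lambda>y. y k)"
  unfolding Z_def gspace.simps
  by (rule continuous_map_from_subtopology) (rule continuous_map_product_projection, simp)

lemma Z_gflow: "gflow Z"
  unfolding gflow_def
proof (intro conjI allI ballI)
  have "compactin (topol Z) (\<pi> ` pts X)"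
    using image_compactin[OF _ pi_continuous] gflowD(1)[OF X] by (simp add: compact_space_def)
  then show "compact_space (topol Z)" by (simp add: compact_space_def pts_Z)
  show "Hausdorff_space (topol Z)"
    unfolding Z_def gspace.simps
    by (rule Hausdorff_space_subtopology) (simp add: Hausdorff_space_product_topology)
  fix y assume "y \<in> pts Z"
  then obtain x where x: "y = \<pi> x" "x \<in> pts X" by (auto simp: pts_Z)
  show "act Z 0 y = y" using gflowD(3)[OF X x(2)] by (simp add: x act_pi)
  show "act Z (g + h) y = act Z g (act Z h y)" for g h
    using gflowD(4)[OF X x(2)] by (simp add: x act_pi)
next
  let ?P = "prod_topology euclidean (topol Z)"
  have comp: "continuous_map ?P euclideanreal (\<lambda>z. (case z of (g, y) \<Rightarrow> act Z g y) k)" for k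
  proof (cases "k \<in> range (enc c)")
    case True
    then obtain t where k: "k = enc c t" by blast
    have "continuous_map ?P euclideanreal (\<lambda>(g, y). y (enc c (Trans g t)))"
    proof (rule joint_continuity)
      show "continuous_map (topol Z) euclideanreal (\<lambda>y. y (enc c (Trans g t)))" for g by (rule coord_continuous)
      fix g0 :: 'g and e :: real assume e: "e > 0"
      obtain V where V: "open V" "0 \<in> V" "\<forall>a\<in>V. \<forall>x\<in>pts X. \<bar>vl t (act X a x) - vl t x\<bar> < e"
        using flow_equicontinuous[OF X vl_continuous e] by blast
      have "continuous_on UNIV (\<lambda>g. g + - g0)" by (intro continuous_intros)
      from open_vimage[OF V(1) this] have "open {g. g + - g0 \<in> V}" by (simp add: vimage_def)
      then have "eventually (\<lambda>g. g \<in> {g. g + - g0 \<in> V}) (nhds g0)" using V(2) by (intro eventually_nhds_in_open) auto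
      then show "eventually (\<lambda>g. \<forall>z\<in>pts Z. dist (z (enc c (Trans g t))) (z (enc c (Trans g0 t))) < e) (nhds g0)"
      proof eventually_elim
        case (elim g)
        show ?case
        proof
          fix z assume "z \<in> pts Z"
          then obtain x where x: "z = \<pi> x" "x \<in> pts X" by (auto simp: pts_Z)
          have "act X g x = act X (g + - g0) (act X g0 x)"
            using gflowD(4)[OF X x(2), of "g + - g0" g0] by (simp add: add.assoc)
          moreover have "\<bar>vl t (act X (g + - g0) (act X g0 x)) - vl t (act X g0 x)\<bar> < e"
            using V(3) elim act_in[OF X x(2)] by blast
          ultimately show "dist (z (enc c (Trans g t))) (z (enc c (Trans g0 t))) < e"
            by (simp add: x(1) pi_enc dist_real_def)
        qed
      qed
    qed
    then show ?thesis by (simp add: k act_enc case_prod_unfold)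
  next
    case False
    then show ?thesis by (simp add: Z_def case_prod_unfold)
  qed
  have img: "(\<lambda>(g, y). act Z g y) ` topspace ?P \<subseteq> \<pi> ` pts X"
    using act_in[OF X] by (auto simp: pts_Z act_pi)
  have "continuous_map ?P (product_topology (\<lambda>_. euclidean) UNIV) (\<lambda>(g, y). act Z g y)"
    unfolding continuous_map_componentwise_UNIV by (intro allI comp)
  then have "continuous_map ?P (subtopology (product_topology (\<lambda>_. euclidean) UNIV) (\<pi> ` pts X)) (\<lambda>(g, y). act Z g y)"
    using img by (auto simp: continuous_map_in_subtopology)
  moreover have "topol Z = subtopology (product_topology (\<lambda>_. euclidean) UNIV) (\<pi> ` pts X)" by (simp add: Z_def)
  ultimately show "continuous_map ?P (topol Z) (\<lambda>(g, y). act Z g y)" by metis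
qed

lemma R_rel_pi:
  assumes "(a, b) \<in> R_rel X U"
  shows "(\<pi> a, \<pi> b) \<in> R_rel Z U"
proof -
  let ?T = "prod_topology (topol X) (topol X)" and ?f = "\<lambda>z. (\<pi> (fst z), \<pi> (snd z))"
  let ?S = "{(x, act X g x) |x g. x \<in> pts X \<and> g \<in> U}"
  have "continuous_map ?T (topol Z) (\<pi> \<circ> fst)" "continuous_map ?T (topol Z) (\<pi> \<circ> snd)"
    by (intro continuous_map_compose[OF _ pi_continuous] continuous_map_fst continuous_map_snd)+
  then have "continuous_map ?T (prod_topology (topol Z) (topol Z)) ?f"
    by (intro continuous_map_pairedI) (simp_all add: o_def)
  from continuous_map_image_closure_subset[OF this, of ?S]
  have "?f (a, b) \<in> prod_topology (topol Z) (topol Z) closure_of (?f ` ?S)"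
    using assms unfolding R_rel_def by blast
  moreover have "?f ` ?S \<subseteq> {(y, act Z g y) |y g. y \<in> pts Z \<and> g \<in> U}"
    by (auto simp: pts_Z act_pi[symmetric])
  ultimately show ?thesis using closure_of_mono unfolding R_rel_def by fastforce
qed

text \<open>Names are closed under maximum, minimum and doubling and contain bumps at every
  coordinate, so \<open>lattice_separation\<close> applies and a single coordinate
  separates.\<close>

lemma coord_separation:
  assumes K: "closedin (topol Z) K" and D: "openin (topol Z) D" and KD: "K \<subseteq> D"
  shows "\<exists>t. (\<forall>y\<in>K. y (enc c t) = 1) \<and> (\<forall>y\<in>pts Z - D. y (enc c t) = 0)"
proof -
  let ?T = "subtopology (product_topology (\<lambda>_. euclidean) UNIV) (\<pi> ` pts X)"
  let ?F = "range (\<lambda>t y. y (enc c t)) :: ('g universe \<Rightarrow> real) set"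
  have T: "topol Z = ?T" by (simp add: Z_def)
  have ts: "topspace ?T = \<pi> ` pts X" by simp
  have c1: "compact_space ?T" using gflowD(1)[OF Z_gflow] by (simp add: T)
  have c2: "continuous_map ?T euclideanreal f" if "f \<in> ?F" for f
  proof -
    obtain t where t: "f = (\<lambda>y. y (enc c t))" using \<open>f \<in> ?F\<close> by blast
    show ?thesis unfolding t T[symmetric] by (rule coord_continuous)
  qed
  have c3: "\<exists>f\<in>?F. \<forall>z\<in>topspace ?T. f z = 0"
    unfolding ts by (rule bexI[of _ "\<lambda>y. y (enc c Zero)"]) (auto simp: pi_enc)
  have c4: "\<exists>f\<in>?F. \<forall>z\<in>topspace ?T. f z = 1"
    unfolding ts by (rule bexI[of _ "\<lambda>y. y (enc c One)"]) (auto simp: pi_enc)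
  have c5: "\<exists>l\<in>?F. \<forall>z\<in>topspace ?T. l z = max (f z) (k z)" if fk: "f \<in> ?F" "k \<in> ?F" for f k
  proof -
    obtain t s where "f = (\<lambda>y. y (enc c t))" "k = (\<lambda>y. y (enc c s))" using fk by blast
    then show ?thesis
      unfolding ts by (intro bexI[of _ "\<lambda>y. y (enc c (Mx t s))"]) (auto simp: pi_enc)
  qed
  have c6: "\<exists>l\<in>?F. \<forall>z\<in>topspace ?T. l z = min (f z) (k z)" if fk: "f \<in> ?F" "k \<in> ?F" for f k
  proof -
    obtain t s where "f = (\<lambda>y. y (enc c t))" "k = (\<lambda>y. y (enc c s))" using fk by blast
    then show ?thesis
      unfolding ts by (intro bexI[of _ "\<lambda>y. y (enc c (Mn t s))"]) (auto simp: pi_enc)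
  qed
  have c7: "\<exists>k\<in>?F. \<forall>z\<in>topspace ?T. k z = min 1 (2 * f z)" if f: "f \<in> ?F" for f
  proof -
    obtain t where "f = (\<lambda>y. y (enc c t))" using f by blast
    then show ?thesis
      unfolding ts by (intro bexI[of _ "\<lambda>y. y (enc c (Dbl t))"]) (auto simp: pi_enc)
  qed
  have c8: "f z \<in> {0..1}" if f: "f \<in> ?F" "z \<in> topspace ?T" for f z
  proof -
    obtain t x where "f = (\<lambda>y. y (enc c t))" "z = \<pi> x" "x \<in> pts X" using f unfolding ts by blast
    then show ?thesis using vl_range[of x t] by (simp add: pi_enc)
  qed
  have c9: "\<exists>f\<in>?F. f z > 1/2 \<and> (\<forall>z'\<in>topspace ?T. z' k \<notin> W \<longrightarrow> f z' = 0)"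
    if "k \<in> UNIV" and z: "z \<in> topspace ?T" and W: "open W" "z k \<in> W" for k z and W :: "real set"
  proof (cases "k \<in> range (enc c)")
    \<comment> \<open>Coordinates that code no name are constantly 0 on the factor.\<close>
    case False
    have "z' k = z k" if "z' \<in> topspace ?T" for z' using that z False unfolding ts by (auto simp: \<pi>_def)
    then have "z' k \<in> W" if "z' \<in> topspace ?T" for z' using W(2) that by metis
    then show ?thesis using z unfolding ts
      by (intro bexI[of _ "\<lambda>y. y (enc c One)"]) (auto simp: pi_enc)
  next
    case True
    then obtain t where k: "k = enc c t" by blast
    obtain x where x: "z = \<pi> x" "x \<in> pts X" using z unfolding ts by blast
    have zk: "z k = vl t x" by (simp add: x(1) k pi_enc)
    obtain e where e: "e > 0" "ball (z k) e \<subseteq> W" using W open_contains_ball by blast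
    \<comment> \<open>The rational center lies within 1/(2n) of the value at \<open>z\<close>, so
      the bump exceeds 1/2 there. Its support has radius 1/n < e/2 and thus stays inside the ball of
      radius \<open>e\<close>.\<close>
    obtain n :: nat where n: "real n > 2 / e" using reals_Archimedean2 by blast
    have n0: "real n > 0" using n e(1) by (smt (verit) divide_pos_pos)
    obtain q :: rat where q: "z k - 1 / (2 * real n) < of_rat q" "of_rat q < z k"
      using of_rat_dense[of "z k - 1 / (2 * real n)" "z k"] n0 by auto
    let ?b = "\<lambda>y :: 'g universe. y (enc c (Bump q n t))"
    have val: "?b (\<pi> x') = max 0 (1 - real n * \<bar>vl t x' - of_rat q\<bar>)" for x'
      by (simp add: pi_enc)
    have "\<bar>z k - of_rat q\<bar> < 1 / (2 * real n)" using q by linarith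
    then have "real n * \<bar>z k - of_rat q\<bar> < 1/2" using n0 by (simp add: field_simps)
    then have "?b z > 1/2" unfolding x(1) val using zk by (simp add: x(1))
    moreover have "?b z' = 0" if z': "z' \<in> topspace ?T" "z' k \<notin> W" for z'
    proof -
      obtain x' where x': "z' = \<pi> x'" using z'(1) unfolding ts by blast
      have "\<not> \<bar>z' k - z k\<bar> < e" using e(2) z'(2) by (auto simp: subset_iff dist_real_def abs_minus_commute)
      moreover have "1 / real n < e / 2" using n n0 e(1) by (simp add: field_simps)
      moreover have "1 / (2 * real n) < 1 / real n" using n0 by (simp add: field_simps)
      ultimately have "\<bar>z' k - of_rat q\<bar> \<ge> 1 / real n" using q by linarith
      then have "real n * \<bar>z' k - of_rat q\<bar> \<ge> 1" using n0 by (simp add: field_simps)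
      then show ?thesis unfolding x' val by (simp add: x' k pi_enc)
    qed
    ultimately show ?thesis by (intro bexI[of _ ?b]) auto
  qed
  have "\<exists>f\<in>?F. (\<forall>z\<in>K. f z = 1) \<and> (\<forall>z\<in>topspace ?T - D. f z = 0)"
    by (rule lattice_separation[of UNIV "\<pi> ` pts X" ?F K D])
      (fact c1 c2 c3 c4 c5 c6 c7 c8 c9 K[unfolded T] D[unfolded T] KD)+
  then show ?thesis unfolding ts pts_Z by blast
qed

text \<open>Two coordinates separate the closed sets, and their level sets at 1/2, pulled back to
  \<open>X\<close>, are unrelated there by \<open>R_rel_pi\<close>. A Urysohn function between them
  exists on \<open>X\<close>, and its name \<open>Ury\<close> makes it a coordinate of the
  factor.\<close>

lemma Z_Urysohn:
  assumes ury: "Urysohn X U (\<zeta> U)"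
  shows "Urysohn Z U (\<zeta> U)"
  unfolding Urysohn_def
proof (intro allI impI)
  fix K L and d :: real
  assume K: "closedin (topol Z) K" and L: "closedin (topol Z) L" and ne: "K \<noteq> {}" "L \<noteq> {}"
    and KL: "K \<times> L \<inter> R_rel Z U = {}" and d: "0 < d" "d < 1"
  obtain D D' where D: "openin (topol Z) D" "openin (topol Z) D'" "K \<subseteq> D" "L \<subseteq> D'"
      "D \<times> D' \<inter> R_rel Z U = {}"
    using R_rel_separation[OF Z_gflow K L KL] by (elim exE conjE)
  obtain t where t: "\<forall>y\<in>K. y (enc c t) = 1" "\<forall>y\<in>pts Z - D. y (enc c t) = 0"
    using coord_separation[OF K D(1,3)] by blast
  obtain s where s: "\<forall>y\<in>L. y (enc c s) = 1" "\<forall>y\<in>pts Z - D'. y (enc c s) = 0"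
    using coord_separation[OF L D(2,4)] by blast
  \<comment> \<open>Chosen so that the named level lies above \<open>d\<close>; the minimum with
    \<open>d\<close> then has the prescribed value.\<close>
  obtain n :: nat where n: "real n > 1 / (1 - d)" using reals_Archimedean2 by blast
  let ?d = "1 - 1 / (real n + 2)"
  have "1 < real n * (1 - d)" using n d by (simp add: field_simps)
  then have "1 < (real n + 2) * (1 - d)" using d by (simp add: algebra_simps)
  then have dn: "d < ?d" "0 < ?d" "?d < 1" using d by (simp_all add: field_simps)
  let ?K = "{x \<in> pts X. vl t x \<in> {1/2..}}" and ?L = "{x \<in> pts X. vl s x \<in> {1/2..}}"
  have clK: "closedin (topol X) ?K" using closedin_continuous_map_preimage[OF vl_continuous, of "{1/2..}"] by simp
  have clL: "closedin (topol X) ?L" using closedin_continuous_map_preimage[OF vl_continuous, of "{1/2..}"] by simp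
  have Kx: "x \<in> ?K" if "x \<in> pts X" "\<pi> x \<in> K" for x using that t(1) by (auto simp flip: pi_enc)
  have Lx: "x \<in> ?L" if "x \<in> pts X" "\<pi> x \<in> L" for x using that s(1) by (auto simp flip: pi_enc)
  have neK: "?K \<noteq> {}" using ne(1) closedin_subset[OF K] Kx by (auto simp: pts_Z)
  have neL: "?L \<noteq> {}" using ne(2) closedin_subset[OF L] Lx by (auto simp: pts_Z)
  have "(a, b) \<notin> R_rel X U" if a: "a \<in> ?K" and b: "b \<in> ?L" for a b
  proof
    assume "(a, b) \<in> R_rel X U"
    from R_rel_pi[OF this] have "\<not> (\<pi> a \<in> D \<and> \<pi> b \<in> D')" using D(5) by blast
    moreover have "\<pi> a \<in> D"
    proof (rule ccontr)
      assume "\<pi> a \<notin> D"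
      then have "\<pi> a (enc c t) = 0" using t(2) a by (simp add: pts_Z)
      then show False using a by (simp add: pi_enc)
    qed
    moreover have "\<pi> b \<in> D'"
    proof (rule ccontr)
      assume "\<pi> b \<notin> D'"
      then have "\<pi> b (enc c s) = 0" using s(2) b by (simp add: pts_Z)
      then show False using b by (simp add: pi_enc)
    qed
    ultimately show False by blast
  qed
  then have disj: "?K \<times> ?L \<inter> R_rel X U = {}" by blast
  obtain p where p: "continuous_map (topol X) (top_of_set {0..1}) p"
      "\<forall>g. \<forall>x\<in>pts X. \<bar>p (act X g x) - p x\<bar> \<le> \<zeta> U g" "\<forall>x\<in>?K. p x = 0" "\<forall>x\<in>?L. p x = ?d"
    using ury[unfolded Urysohn_def, rule_format, OF clK clL neK neL disj dn(2,3)] by (elim exE conjE)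
  have "ury_witness X (\<zeta> U) n (vl t) (vl s) p"
    using p by (auto simp: ury_witness_def continuous_map_in_subtopology image_subset_iff Pi_iff)
  then have ex: "\<exists>p. ury_witness X (\<zeta> U) n (vl t) (vl s) p" by blast
  then have w: "ury_witness X (\<zeta> U) n (vl t) (vl s) (vl (Ury U n t s))"
    using someI_ex[OF ex] by simp
  let ?u = "enc c (Ury U n t s)"
  have u: "\<pi> x ?u = vl (Ury U n t s) x" for x by (rule pi_enc)
  show "\<exists>p. continuous_map (topol Z) (top_of_set {0..1}) p \<and>
      (\<forall>g. \<forall>x\<in>pts Z. \<bar>p (act Z g x) - p x\<bar> \<le> \<zeta> U g) \<and> (\<forall>x\<in>K. p x = 0) \<and> (\<forall>x\<in>L. p x = d)"
  proof (intro exI[of _ "\<lambda>y. min (y ?u) d"] conjI allI ballI)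
    have "continuous_map (topol Z) euclideanreal (\<lambda>y. min (y ?u) d)"
      by (intro continuous_map_real_min coord_continuous) simp
    moreover have "min (y ?u) d \<in> {0..1}" if y: "y \<in> pts Z" for y
    proof -
      obtain x where x: "y = \<pi> x" "x \<in> pts X" using y unfolding pts_Z by (elim imageE)
      show ?thesis using vl_range[OF x(2), of "Ury U n t s"] d unfolding x(1) u by (auto simp: min_def)
    qed
    ultimately show "continuous_map (topol Z) (top_of_set {0..1}) (\<lambda>y. min (y ?u) d)"
      by (auto simp: continuous_map_in_subtopology)
    fix g :: 'g and y assume y: "y \<in> pts Z"
    obtain x where x: "y = \<pi> x" "x \<in> pts X" using y unfolding pts_Z by (elim imageE)
    \<comment> \<open>Truncation is a contraction and preserves the bound
      \<open>\<zeta> U\<close>.\<close>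
    have min_lip: "\<bar>a - b\<bar> \<le> e \<Longrightarrow> \<bar>min a d - min b d\<bar> \<le> e" for a b e :: real by (auto simp: min_def)
    have "\<bar>vl (Ury U n t s) (act X g x) - vl (Ury U n t s) x\<bar> \<le> \<zeta> U g"
      using w x(2) unfolding ury_witness_def by blast
    then show "\<bar>min (act Z g y ?u) d - min (y ?u) d\<bar> \<le> \<zeta> U g"
      unfolding x(1) act_pi u by (rule min_lip)
  next
    fix y assume y: "y \<in> K"
    have "y \<in> pts Z" using closedin_subset[OF K] y by blast
    then obtain x where x: "y = \<pi> x" "x \<in> pts X" by (auto simp: pts_Z)
    then have "vl t x \<ge> 1/2" using Kx[of x] y by simp
    then have "vl (Ury U n t s) x = 0" using w x(2) unfolding ury_witness_def by blast
    then show "min (y ?u) d = 0" unfolding x(1) u using d by simp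
  next
    fix y assume y: "y \<in> L"
    have "y \<in> pts Z" using closedin_subset[OF L] y by blast
    then obtain x where x: "y = \<pi> x" "x \<in> pts X" by (auto simp: pts_Z)
    then have "vl s x \<ge> 1/2" using Lx[of x] y by simp
    then have "vl (Ury U n t s) x = ?d" using w x(2) unfolding ury_witness_def by blast
    then show "min (y ?u) d = d" unfolding x(1) u using dn by simp
  qed
qed

text \<open>Realizations pull back along \<open>\<pi>\<close>. Conversely, every structure realized
  in \<open>X\<close> has a functional realization among the \<open>Leaf\<close>
  coordinates.\<close>

lemma tp_Z: "tp_G \<N> Z = tp_G \<N> X"
proof (intro set_eqI iffI)
  fix M assume M: "M \<in> tp_G \<N> Z"
  obtain f where f: "sdata Z (verts M) (edges_of M) (covers_of M) f"
    using tp_G_sdata(2)[OF Z_gflow M] by blast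
  note s = sdataD[OF f]
  have "sdata X (verts M) (edges_of M) (covers_of M) (\<lambda>v x. f v (\<pi> x))"
    unfolding sdata_def
  proof (intro conjI ballI impI)
    fix v assume v: "v \<in> verts M"
    show "continuous_map (topol X) euclideanreal (\<lambda>x. f v (\<pi> x))"
      using continuous_map_compose[OF pi_continuous s(1)[OF v]] by (simp add: o_def)
    show "f v (\<pi> x) \<in> {0..1}" if "x \<in> pts X" for x using s(2)[OF v] that by (simp add: pts_Z)
    show "\<exists>x\<in>pts X. f v (\<pi> x) = 1" using s(3)[OF v] by (simp add: pts_Z)
    show "\<exists>x\<in>pts X. f v (\<pi> x) = 1 \<and> f w (\<pi> x) = 0 \<or> f w (\<pi> x) = 1 \<and> f v (\<pi> x) = 0"
      if "w \<in> verts M" "v \<noteq> w" for w using s(4)[OF v that] by (simp add: pts_Z)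
  next
    fix d x assume "d \<in> covers_of M" "x \<in> pts X"
    then show "\<exists>v\<in>d. f v (\<pi> x) = 1" using s(5) by (simp add: pts_Z)
  next
    fix e assume e: "e \<in> edges_of M"
    obtain g U v w where e': "e = (g, U, v, w)" by (cases e) auto
    have "\<not> (f v (\<pi> x) > 0 \<and> f w (\<pi> (act X (u + g) x)) > 0)" if "x \<in> pts X" "u \<in> U" for x u
      using s(6)[OF e[unfolded e'], of "\<pi> x" u] that by (simp add: pts_Z act_pi)
    then show "case e of (g, U, v, w) \<Rightarrow> \<forall>x\<in>pts X. \<forall>u\<in>U. \<not> (f v (\<pi> x) > 0 \<and> f w (\<pi> (act X (u + g) x)) > 0)"
      by (simp add: e')
  qed
  then show "M \<in> tp_G \<N> X"
    using tp_G_wdata[OF X tp_G_sdata(1)[OF Z_gflow M]] sdata_imp_wdata by blast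
next
  fix M assume M: "M \<in> tp_G \<N> X"
  have good: "good \<N> M" using tp_G_sdata(1)[OF X M] .
  obtain n where n: "verts M = {..<n}" using good unfolding good_def Str_def by blast
  obtain E where E: "set E = edges_of M" using goodD(2)[OF good] finite_list by blast
  have "\<exists>C. set ` set C = covers_of M"
  proof -
    obtain L where L: "set L = covers_of M" using goodD(3)[OF good] finite_list by blast
    have "set (sorted_list_of_set d) = d" if "d \<in> covers_of M" for d
      using goodD(5)[OF good that] goodD(1)[OF good] finite_subset by (intro set_sorted_list_of_set) blast
    then have "set ` set (map sorted_list_of_set L) = covers_of M" using L by (force simp: image_iff)
    then show ?thesis by blast
  qed
  then obtain C where C: "set ` set C = covers_of M" by blast
  let ?Q = "sdata X {..<n} (set E) (set ` set C)"
  have ex: "\<exists>f. ?Q f" using tp_G_sdata(2)[OF X M] by (simp add: n E C)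
  have f: "?Q (SOME f. ?Q f)" using someI_ex[OF ex] .
  define f' where "f' = (SOME f. ?Q f)"
  note s = sdataD[OF f[folded f'_def]]
  let ?l = "\<lambda>v. enc c (Leaf E C n v)"
  have l: "\<pi> x (?l v) = f' v x" if "v < n" for v x
    unfolding pi_enc using that ex by (simp add: f'_def)
  have "sdata Z (verts M) (edges_of M) (covers_of M) (\<lambda>v y. y (?l v))"
    unfolding sdata_def n
  proof (intro conjI ballI impI)
    fix v assume v: "v \<in> {..<n}"
    then have v': "v < n" by simp
    show "continuous_map (topol Z) euclideanreal (\<lambda>y. y (?l v))" by (rule coord_continuous)
    show "y (?l v) \<in> {0..1}" if "y \<in> pts Z" for y using s(2)[OF v] that by (auto simp: pts_Z l[OF v'])
    show "\<exists>y\<in>pts Z. y (?l v) = 1" using s(3)[OF v] by (simp add: pts_Z l[OF v'])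
    show "\<exists>y\<in>pts Z. y (?l v) = 1 \<and> y (?l w) = 0 \<or> y (?l w) = 1 \<and> y (?l v) = 0"
      if w: "w \<in> {..<n}" "v \<noteq> w" for w
    proof -
      have w': "w < n" using w by simp
      show ?thesis using s(4)[OF v w] by (simp add: pts_Z l[OF v'] l[OF w'])
    qed
  next
    fix d y assume d: "d \<in> covers_of M" and y: "y \<in> pts Z"
    obtain x where x: "y = \<pi> x" "x \<in> pts X" using y by (auto simp: pts_Z)
    obtain v where v: "v \<in> d" "f' v x = 1" using s(5)[OF _ x(2), of d] d C by auto
    have "v < n" using goodD(5)[OF good d] v(1) n by auto
    then show "\<exists>v\<in>d. y (?l v) = 1" using v by (intro bexI[of _ v]) (simp_all add: x(1) l)
  next
    fix e assume e: "e \<in> edges_of M"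
    obtain g U v w where e': "e = (g, U, v, w)" by (cases e) auto
    have vw: "v < n" "w < n" using goodD(4)[OF good e[unfolded e']] n by auto
    have "\<not> (y (?l v) > 0 \<and> act Z (u + g) y (?l w) > 0)" if y: "y \<in> pts Z" "u \<in> U" for y u
    proof -
      obtain x where x: "y = \<pi> x" "x \<in> pts X" using y(1) by (auto simp: pts_Z)
      show ?thesis using s(6)[of g U v w x u] e x(2) y(2) unfolding x(1) act_pi l[OF vw(1)] l[OF vw(2)] E e' by blast
    qed
    then show "case e of (g, U, v, w) \<Rightarrow> \<forall>y\<in>pts Z. \<forall>u\<in>U. \<not> (y (?l v) > 0 \<and> act Z (u + g) y (?l w) > 0)"
      by (simp add: e')
  qed
  then show "M \<in> tp_G \<N> Z" using tp_G_wdata[OF Z_gflow good] sdata_imp_wdata by blast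
qed

end

text \<open>Flows on arbitrary carrier types are covered, in particular ultracoproducts, whose
  points are characters and do not belong to the universe type.\<close>

lemma tp_G_in_WT:
  fixes X :: "('g::topological_group_add, 'x) gspace"
  assumes X: "gflow X" and ury: "zeta_Urysohn \<N> \<zeta> X"
  shows "tp_G \<N> X \<in> WT \<N> \<zeta>"
proof -
  obtain c :: "('g set \<times> nat) list \<Rightarrow> 'g set \<times> nat" where c: "inj c" using list_code_universe by blast
  interpret factor_flow X \<zeta> c by unfold_locales (rule X, rule c)
  have "zeta_Urysohn \<N> \<zeta> Z" using ury Z_Urysohn unfolding zeta_Urysohn_def by blast
  then show ?thesis using Z_gflow tp_Z unfolding WT_def by blast
qed

subsection \<open>The topology on weak types\<close>

text \<open>A point of the closure of \<open>C\<close> is the limit of an ultrafilter containing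
  \<open>C\<close>; in a Hausdorff space this limit can only be \<open>L U\<close>, and
  \<open>L U\<close> lies in \<open>C\<close> because \<open>C\<close> is closed for the other
  topology. Used in both directions, this shows that the limit operation determines the
  topology.\<close>

lemma closedin_of_ultralimits:
  assumes S: "topspace \<tau> = S" "topspace \<tau>' = S" and H: "Hausdorff_space \<tau>'"
    and L: "\<And>U. ultra U \<Longrightarrow> eventually (\<lambda>t. t \<in> S) U \<Longrightarrow> L U \<in> S"
    and conv: "\<And>U W. ultra U \<Longrightarrow> eventually (\<lambda>t. t \<in> S) U \<Longrightarrow> openin \<tau> W \<Longrightarrow> L U \<in> W \<Longrightarrow> eventually (\<lambda>t. t \<in> W) U"
    and conv': "\<And>U W. ultra U \<Longrightarrow> eventually (\<lambda>t. t \<in> S) U \<Longrightarrow> openin \<tau>' W \<Longrightarrow> L U \<in> W \<Longrightarrow> eventually (\<lambda>t. t \<in> W) U"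
    and C: "closedin \<tau> C"
  shows "closedin \<tau>' C"
proof -
  have CS: "C \<subseteq> S" using closedin_subset[OF C] S by simp
  have "t \<in> C" if t: "t \<in> \<tau>' closure_of C" for t
  proof -
    have tS: "t \<in> S" and tC: "\<And>W. openin \<tau>' W \<Longrightarrow> t \<in> W \<Longrightarrow> W \<inter> C \<noteq> {}"
      using t S unfolding in_closure_of by auto
    let ?N = "{W. openin \<tau>' W \<and> t \<in> W}"
    have "(INF W\<in>?N. principal (W \<inter> C)) \<noteq> bot"
    proof (rule INF_filter_not_bot)
      fix X assume X: "X \<subseteq> ?N" "finite X"
      have "(\<Inter>W\<in>X. W \<inter> C) \<noteq> {}"
      proof (cases "X = {}")
        case False
        then have "openin \<tau>' (\<Inter>X)" using X by (intro openin_Inter) auto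
        moreover have "t \<in> \<Inter>X" using X by auto
        ultimately have "\<Inter>X \<inter> C \<noteq> {}" by (rule tC)
        then show ?thesis using False by auto
      qed simp
      then show "(INF W\<in>X. principal (W \<inter> C)) \<noteq> bot"
        using X(2) by (simp add: INF_principal_finite principal_eq_bot_iff)
    qed
    then obtain U where U: "U \<le> (INF W\<in>?N. principal (W \<inter> C))" "ultra U" using ultra_exists by blast
    have ev: "eventually (\<lambda>s. s \<in> W \<inter> C) U" if "openin \<tau>' W" "t \<in> W" for W
    proof -
      have "(INF W\<in>?N. principal (W \<inter> C)) \<le> principal (W \<inter> C)"
        using INF_lower[of W ?N "\<lambda>W. principal (W \<inter> C)"] that by simp
      with U(1) have "U \<le> principal (W \<inter> C)" by (rule order_trans)
      then show ?thesis by (simp add: le_principal)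
    qed
    have "openin \<tau>' S" using S(2) by (metis openin_topspace)
    from ev[OF this tS] have evC: "eventually (\<lambda>s. s \<in> C) U" by eventually_elim auto
    then have evS: "eventually (\<lambda>s. s \<in> S) U" by eventually_elim (use CS in blast)
    have "t = L U"
    proof (rule ccontr)
      assume "t \<noteq> L U"
      then obtain W W' where W: "openin \<tau>' W" "openin \<tau>' W'" "t \<in> W" "L U \<in> W'" "disjnt W W'"
        using H tS L[OF U(2) evS] S(2) unfolding Hausdorff_space_def by metis
      from ev[OF W(1,3)] conv'[OF U(2) evS W(2,4)] have "eventually (\<lambda>s. False) U"
        by eventually_elim (use W(5) in \<open>auto simp: disjnt_def\<close>)
      with U(2) show False by (simp add: ultra_def)
    qed
    moreover have "L U \<in> C"
    proof (rule ccontr)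
      assume "L U \<notin> C"
      then have "L U \<in> S - C" using L[OF U(2) evS] by blast
      moreover have "openin \<tau> (S - C)" using C S(1) by (simp add: closedin_def)
      ultimately have "eventually (\<lambda>t. t \<in> S - C) U" by (intro conv[OF U(2) evS])
      with evC have "eventually (\<lambda>s. False) U" by eventually_elim auto
      with U(2) show False by (simp add: ultra_def)
    qed
    ultimately show ?thesis by simp
  qed
  then have "\<tau>' closure_of C \<subseteq> C" by blast
  then show ?thesis using CS S(2) closure_of_subset_eq by metis
qed

text \<open>A limit operation \<open>L\<close> for ultrafilters on a family of sets, given up to the refinement relation
  \<open>R\<close> by taking ultralimits of membership predicates.\<close>

locale limit_structure =
  fixes S :: "'a set set" and L :: "'a set filter \<Rightarrow> 'a set"
    and R :: "'a \<Rightarrow> 'd \<Rightarrow> bool" and mk :: "'d \<Rightarrow> 'a" and D :: "'d set"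
  assumes L_in: "ultra U \<Longrightarrow> eventually (\<lambda>t. t \<in> S) U \<Longrightarrow> L U \<in> S"
    and L_sub: "ultra U \<Longrightarrow> eventually (\<lambda>t. t \<in> S) U \<Longrightarrow> M \<in> L U \<Longrightarrow> eventually (\<lambda>t. M \<in> t) U"
    and L_intro: "ultra U \<Longrightarrow> eventually (\<lambda>t. t \<in> S) U \<Longrightarrow> d \<in> D \<Longrightarrow> R M d \<Longrightarrow> eventually (\<lambda>t. mk d \<in> t) U \<Longrightarrow> M \<in> L U"
    and refine: "t \<in> S \<Longrightarrow> M \<in> t \<Longrightarrow> \<exists>d\<in>D. R M d \<and> mk d \<in> t"
begin

lemma L_principal:
  assumes t: "t \<in> S"
  shows "L (principal {t}) = t"
proof -
  have ev: "eventually P (principal {t}) \<longleftrightarrow> P t" for P by (simp add: eventually_principal)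
  note u = ultra_principal[of t]
  have evS: "eventually (\<lambda>s. s \<in> S) (principal {t})" using t by (simp add: ev)
  show ?thesis
  proof (intro set_eqI iffI)
    fix M assume "M \<in> L (principal {t})"
    then show "M \<in> t" using L_sub[OF u evS] by (simp add: ev)
  next
    fix M assume "M \<in> t"
    then obtain d where "d \<in> D" "R M d" "mk d \<in> t" using refine[OF t] by blast
    then show "M \<in> L (principal {t})" using L_intro[OF u evS] by (simp add: ev)
  qed
qed

lemma refine_converse: "t \<in> S \<Longrightarrow> d \<in> D \<Longrightarrow> R M d \<Longrightarrow> mk d \<in> t \<Longrightarrow> M \<in> t"
  using L_intro[OF ultra_principal, of t d M] by (simp add: L_principal eventually_principal)

text \<open>For \<open>d \<in> D\<close> this becomes the closure of
  \<open>{t \<in> S. mk d \<in> t}\<close> in \<open>\<tau>\<close>. If \<open>R M d\<close> holds,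
  it lies between this set and \<open>{t \<in> S. M \<in> t}\<close>.\<close>

definition limits :: "'d \<Rightarrow> 'a set set" where
  "limits d = {L U |U. ultra U \<and> eventually (\<lambda>t. t \<in> S) U \<and> eventually (\<lambda>t. mk d \<in> t) U}"

lemma limits_subset: "limits d \<subseteq> S"
  using L_in unfolding limits_def by blast

lemma mem_limits: "t \<in> S \<Longrightarrow> mk d \<in> t \<Longrightarrow> t \<in> limits d"
  unfolding limits_def using ultra_principal[of t] L_principal[of t]
  by (intro CollectI exI[of _ "principal {t}"]) (simp add: eventually_principal)

lemma limits_imp: "d \<in> D \<Longrightarrow> R M d \<Longrightarrow> t \<in> limits d \<Longrightarrow> M \<in> t"
  using L_intro unfolding limits_def by blast

text \<open>The membership sets distinguish points but give a neighborhood on one side only; the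
  complements of \<open>limits d\<close> supply the disjoint neighborhood on the other side.\<close>

definition \<tau> :: "'a set topology" where
  "\<tau> = topology_generated_by ({S} \<union> {{t \<in> S. M \<in> t} |M. True} \<union> {S - limits d |d. d \<in> D})"

lemma topspace_tau: "topspace \<tau> = S"
  unfolding \<tau>_def topology_generated_by_topspace by auto

lemma openin_member: "openin \<tau> {t \<in> S. M \<in> t}"
  unfolding \<tau>_def by (rule topology_generated_by_Basis) blast

lemma openin_limits: "d \<in> D \<Longrightarrow> openin \<tau> (S - limits d)"
  unfolding \<tau>_def by (rule topology_generated_by_Basis) blast

text \<open>The limit along \<open>U\<close> of the limits along ultrafilters \<open>V t\<close> is the limit along the
  ultrafilter \<open>\<integral> V t dU(t)\<close>; hence \<open>limits d\<close> is closed under limits.\<close>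

lemma limits_closed:
  assumes U: "ultra U" "eventually (\<lambda>t. t \<in> S) U" and d: "d \<in> D" and ev: "eventually (\<lambda>t. t \<in> limits d) U"
  shows "L U \<in> limits d"
proof -
  \<comment> \<open>Outside \<open>limits d\<close> a principal ultrafilter merely fills in, so that
    \<open>V\<close> is defined on all of \<open>S\<close>.\<close>
  have "\<exists>V. ultra V \<and> eventually (\<lambda>t. t \<in> S) V \<and> (r \<in> limits d \<longrightarrow> eventually (\<lambda>t. mk d \<in> t) V \<and> L V = r)" if "r \<in> S" for r
  proof (cases "r \<in> limits d")
    case True then show ?thesis unfolding limits_def by blast
  next
    case False
    then show ?thesis using that ultra_principal[of r]
      by (intro exI[of _ "principal {r}"]) (simp add: eventually_principal)
  qed
  then have "\<forall>r\<in>S. \<exists>V. ultra V \<and> eventually (\<lambda>t. t \<in> S) V \<and> (r \<in> limits d \<longrightarrow> eventually (\<lambda>t. mk d \<in> t) V \<and> L V = r)"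
    by blast
  from bchoice[OF this] obtain V where V: "\<forall>r\<in>S. ultra (V r) \<and> eventually (\<lambda>t. t \<in> S) (V r) \<and>
      (r \<in> limits d \<longrightarrow> eventually (\<lambda>t. mk d \<in> t) (V r) \<and> L (V r) = r)" by (elim exE)
  define B where "B = Abs_filter (\<lambda>P. eventually (\<lambda>r. eventually P (V r)) U)"
  have B: "eventually P B \<longleftrightarrow> eventually (\<lambda>r. eventually P (V r)) U" for P
    unfolding B_def
  proof (rule eventually_Abs_filter, unfold_locales)
    fix P Q :: "'a set \<Rightarrow> bool"
    show "eventually (\<lambda>r. eventually (\<lambda>x. P x \<and> Q x) (V r)) U"
      if "eventually (\<lambda>r. eventually P (V r)) U" "eventually (\<lambda>r. eventually Q (V r)) U"
      using that
    proof eventually_elim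
      case (elim r)
      then show ?case by (rule eventually_conj)
    qed
    show "\<forall>x. P x \<longrightarrow> Q x \<Longrightarrow> eventually (\<lambda>r. eventually P (V r)) U \<Longrightarrow> eventually (\<lambda>r. eventually Q (V r)) U"
      by (rule eventually_mono[of "\<lambda>r. eventually P (V r)"]) (auto elim: eventually_mono)
  qed simp
  have uB: "ultra B"
    unfolding ultra_def
  proof (intro conjI allI)
    show "B \<noteq> bot"
    proof
      assume "B = bot"
      then have "eventually (\<lambda>r. eventually (\<lambda>_. False) (V r)) U" using B[of "\<lambda>_. False"] by simp
      with U(2) have "eventually (\<lambda>r. False) U"
        by eventually_elim (use V in \<open>auto simp: ultra_def trivial_limit_def\<close>)
      with U(1) show False by (simp add: ultra_def)
    qed
    fix P
    show "eventually P B \<or> eventually (\<lambda>x. \<not> P x) B"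
    proof (cases "eventually (\<lambda>r. eventually P (V r)) U")
      case False
      then have "eventually (\<lambda>r. \<not> eventually P (V r)) U" using ultra_not[OF U(1)] by blast
      with U(2) have "eventually (\<lambda>r. eventually (\<lambda>x. \<not> P x) (V r)) U"
        by eventually_elim (use V ultra_not in blast)
      then show ?thesis by (simp add: B)
    qed (simp add: B)
  qed
  have SB: "eventually (\<lambda>t. t \<in> S) B" unfolding B using U(2) by eventually_elim (use V in blast)
  have dB: "eventually (\<lambda>t. mk d \<in> t) B" unfolding B using U(2) ev by eventually_elim (use V in blast)
  have 1: "M \<in> L B" if M: "M \<in> L U" for M
  proof -
    obtain d1 where d1: "d1 \<in> D" "R M d1" "mk d1 \<in> L U" using refine[OF L_in[OF U] M] by blast
    have "eventually (\<lambda>r. mk d1 \<in> r) U" by (rule L_sub[OF U d1(3)])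
    with U(2) ev have "eventually (\<lambda>r. eventually (\<lambda>t. mk d1 \<in> t) (V r)) U"
      by eventually_elim (use V L_sub in blast)
    then have "eventually (\<lambda>t. mk d1 \<in> t) B" by (simp add: B)
    then show ?thesis by (rule L_intro[OF uB SB d1(1,2)])
  qed
  have 2: "eventually (\<lambda>r. M \<in> r) U" if M: "M \<in> L B" for M
  proof -
    obtain d1 where d1: "d1 \<in> D" "R M d1" "mk d1 \<in> L B" using refine[OF L_in[OF uB SB] M] by blast
    have "eventually (\<lambda>t. mk d1 \<in> t) B" by (rule L_sub[OF uB SB d1(3)])
    then have "eventually (\<lambda>r. eventually (\<lambda>t. mk d1 \<in> t) (V r)) U" by (simp add: B)
    with U(2) ev show ?thesis
    proof eventually_elim
      case (elim r)
      then have V': "ultra (V r)" "eventually (\<lambda>t. t \<in> S) (V r)" "L (V r) = r" using V by blast+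
      show ?case using L_intro[OF V'(1,2) d1(1,2) elim(3)] V'(3) by simp
    qed
  qed
  \<comment> \<open>Each passage through a refinement turns membership in a limit into membership
    along the ultrafilter or back. The first refinement reaches most \<open>r\<close>, and the
    second returns from these \<open>r\<close> to \<open>L U\<close>.\<close>
  have 3: "M \<in> L U" if M: "M \<in> L B" for M
  proof -
    obtain d1 where d1: "d1 \<in> D" "R M d1" "mk d1 \<in> L B" using refine[OF L_in[OF uB SB] M] by blast
    show ?thesis by (rule L_intro[OF U d1(1,2) 2[OF d1(3)]])
  qed
  have "L U = L B" using 1 3 by blast
  then show ?thesis unfolding limits_def using uB SB dB by blast
qed

text \<open>Checked on the generating sets: membership sets by \<open>L_sub\<close>, complements of
  \<open>limits d\<close> by \<open>limits_closed\<close>.\<close>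

lemma tau_convergence:
  assumes U: "ultra U" "eventually (\<lambda>t. t \<in> S) U" and W: "openin \<tau> W" "L U \<in> W"
  shows "eventually (\<lambda>t. t \<in> W) U"
proof -
  have "generate_topology_on ({S} \<union> {{t \<in> S. M \<in> t} |M. True} \<union> {S - limits d |d. d \<in> D}) W"
    using W(1) unfolding \<tau>_def by (rule openin_topology_generated_by)
  then show ?thesis using W(2)
  proof (induction rule: generate_topology_on.induct)
    case Empty then show ?case by simp
  next
    case (Int A B)
    then show ?case by (auto intro: eventually_conj)
  next
    case (UN K)
    then obtain A where A: "A \<in> K" "L U \<in> A" by blast
    from UN.IH[OF A] show ?case by (rule eventually_mono) (use A(1) in blast)
  next
    case (Basis A)
    then consider "A = S" | M where "A = {t \<in> S. M \<in> t}" | d where "A = S - limits d" "d \<in> D" by blast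
    then show ?case
    proof cases
      case 1 then show ?thesis using U(2) by simp
    next
      case (2 M)
      then have "eventually (\<lambda>t. M \<in> t) U" using L_sub[OF U] Basis.prems by blast
      with U(2) show ?thesis unfolding 2 by eventually_elim simp
    next
      case (3 d)
      show ?thesis
      proof (cases "eventually (\<lambda>t. t \<in> limits d) U")
        case True
        from limits_closed[OF U 3(2) True] show ?thesis using Basis.prems 3(1) by simp
      next
        case False
        then have "eventually (\<lambda>t. t \<notin> limits d) U" using ultra_not[OF U(1)] by blast
        with U(2) show ?thesis unfolding 3(1) by eventually_elim simp
      qed
    qed
  qed
qed

lemma tau_compact: "compact_space \<tau>"
proof (rule compact_space_ultraI)
  fix U assume U: "ultra U" "eventually (\<lambda>x. x \<in> topspace \<tau>) U"
  then have U': "eventually (\<lambda>x. x \<in> S) U" by (simp add: topspace_tau)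
  show "\<exists>l\<in>topspace \<tau>. \<forall>W. openin \<tau> W \<longrightarrow> l \<in> W \<longrightarrow> eventually (\<lambda>x. x \<in> W) U"
    using L_in[OF U(1) U'] tau_convergence[OF U(1) U'] by (intro bexI[of _ "L U"]) (simp_all add: topspace_tau)
qed

lemma tau_Hausdorff: "Hausdorff_space \<tau>"
  unfolding Hausdorff_space_def topspace_tau
proof (intro allI impI)
  have sep: "\<exists>A B. openin \<tau> A \<and> openin \<tau> B \<and> t \<in> A \<and> s \<in> B \<and> disjnt A B"
    if ts: "t \<in> S" "s \<in> S" "M \<in> t" "M \<notin> s" for s t M
  proof -
    obtain d where d: "d \<in> D" "R M d" "mk d \<in> t" using refine[OF ts(1,3)] by blast
    have "s \<notin> limits d" using limits_imp[OF d(1,2)] ts(4) by blast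
    moreover have "{t \<in> S. mk d \<in> t} \<subseteq> limits d" using mem_limits by blast
    ultimately show ?thesis
      using ts d openin_member[of "mk d"] openin_limits[OF d(1)]
      by (intro exI[of _ "{t \<in> S. mk d \<in> t}"] exI[of _ "S - limits d"]) (auto simp: disjnt_def)
  qed
  fix x y assume xy: "x \<in> S \<and> y \<in> S \<and> x \<noteq> y"
  then obtain M where "M \<in> x \<and> M \<notin> y \<or> M \<in> y \<and> M \<notin> x" by blast
  then show "\<exists>U V. openin \<tau> U \<and> openin \<tau> V \<and> x \<in> U \<and> y \<in> V \<and> disjnt U V"
  proof
    assume "M \<in> x \<and> M \<notin> y"
    then show ?thesis using sep[of x y M] xy by blast
  next
    assume "M \<in> y \<and> M \<notin> x"
    then obtain A B where "openin \<tau> A" "openin \<tau> B" "y \<in> A" "x \<in> B" "disjnt A B" using sep[of y x M] xy by blast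
    then show ?thesis by (intro exI[of _ B] exI[of _ A]) (auto simp: disjnt_def)
  qed
qed

text \<open>For a code \<open>d'\<close> refining the structure of \<open>d\<close>, the closed set
  \<open>limits d'\<close> lies in the open set \<open>{t \<in> S. mk d \<in> t}\<close>. The
  Urysohn functions of these countably many pairs separate points, and a continuous injection of a
  compact space into a Hausdorff space is an embedding.\<close>

lemma tau_metrizable:
  assumes "countable D"
  shows "metrizable_space \<tau>"
proof -
  let ?J = "{(d, d') \<in> D \<times> D. R (mk d) d'}"
  have norm: "normal_space \<tau>"
    using tau_compact tau_Hausdorff compact_Hausdorff_or_regular_imp_normal_space by blast
  have "\<exists>f. continuous_map \<tau> euclideanreal f \<and> (\<forall>t\<in>limits (snd j). f t = 1) \<and> (\<forall>t\<in>S. mk (fst j) \<notin> t \<longrightarrow> f t = 0)"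
    if j: "j \<in> ?J" for j
  proof -
    obtain d d' where dd: "j = (d, d')" "d \<in> D" "d' \<in> D" "R (mk d) d'" using j by blast
    have 1: "closedin \<tau> (limits d')"
      using openin_limits[OF dd(3)] limits_subset by (simp add: closedin_def topspace_tau)
    have 2: "closedin \<tau> (S - {t \<in> S. mk d \<in> t})"
      using openin_member[of "mk d"] topspace_tau by (metis closedin_diff closedin_topspace)
    have "disjnt (limits d') (S - {t \<in> S. mk d \<in> t})"
      using limits_imp[OF dd(3,4)] by (auto simp: disjnt_def)
    then obtain f where "continuous_map \<tau> euclideanreal f" "f ` limits d' \<subseteq> {1}" "f ` (S - {t \<in> S. mk d \<in> t}) \<subseteq> {0}"
      using Urysohn_lemma_alt[OF norm 1 2, of 1 0] by blast
    then show ?thesis unfolding dd(1) by (intro exI[of _ f]) (auto simp: image_subset_iff)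
  qed
  then have "\<forall>j\<in>?J. \<exists>f. continuous_map \<tau> euclideanreal f \<and> (\<forall>t\<in>limits (snd j). f t = 1) \<and> (\<forall>t\<in>S. mk (fst j) \<notin> t \<longrightarrow> f t = 0)"
    by blast
  from bchoice[OF this] obtain f where f: "\<forall>j\<in>?J. continuous_map \<tau> euclideanreal (f j) \<and>
      (\<forall>t\<in>limits (snd j). f j t = 1) \<and> (\<forall>t\<in>S. mk (fst j) \<notin> t \<longrightarrow> f j t = 0)" by (elim exE)
  let ?P = "product_topology (\<lambda>_. euclideanreal) ?J" and ?\<Phi> = "\<lambda>t. \<lambda>j\<in>?J. f j t"
  have fc: "continuous_map \<tau> euclideanreal (f j)" if "j \<in> ?J" for j using f that by blast
  have cont: "continuous_map \<tau> ?P ?\<Phi>"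
    unfolding continuous_map_componentwise
  proof (intro conjI ballI)
    show "?\<Phi> ` topspace \<tau> \<subseteq> extensional ?J" by (rule image_subsetI) (rule restrict_extensional)
    show "continuous_map \<tau> euclideanreal (\<lambda>t. ?\<Phi> t j)" if "j \<in> ?J" for j
      using fc[OF that] that by (simp only: restrict_apply if_True)
  qed
  have sep: "?\<Phi> t \<noteq> ?\<Phi> s" if ts: "t \<in> S" "s \<in> S" "M \<in> t" "M \<notin> s" for t s M
  proof -
    \<comment> \<open>Two refinements are needed: \<open>mk d\<close> tells \<open>t\<close> from
      \<open>s\<close>, and \<open>d'\<close> provides a closed set around \<open>t\<close> inside
      the membership set of \<open>mk d\<close>.\<close>
    obtain d where d: "d \<in> D" "R M d" "mk d \<in> t" using refine[OF ts(1,3)] by blast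
    have ns: "mk d \<notin> s" using refine_converse[OF ts(2) d(1,2)] ts(4) by blast
    obtain d' where d': "d' \<in> D" "R (mk d) d'" "mk d' \<in> t" using refine[OF ts(1) d(3)] by blast
    have j: "(d, d') \<in> ?J" using d d' by blast
    have "f (d, d') t = 1" using bspec[OF f j] mem_limits[OF ts(1) d'(3)] by auto
    moreover have "f (d, d') s = 0" using bspec[OF f j] ns ts(2) by auto
    ultimately have "?\<Phi> t (d, d') \<noteq> ?\<Phi> s (d, d')" using j by simp
    then show ?thesis by metis
  qed
  have inj: "inj_on ?\<Phi> (topspace \<tau>)"
  proof (rule inj_onI, rule ccontr)
    fix t s assume "t \<in> topspace \<tau>" "s \<in> topspace \<tau>" and eq: "?\<Phi> t = ?\<Phi> s" and "t \<noteq> s"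
    then have ts: "t \<in> S" "s \<in> S" by (simp_all add: topspace_tau)
    obtain M where "M \<in> t \<and> M \<notin> s \<or> M \<in> s \<and> M \<notin> t" using \<open>t \<noteq> s\<close> by blast
    then show False using sep[OF ts, of M] sep[OF ts(2,1), of M] eq by (elim disjE conjE) simp_all
  qed
  have "countable ?J" by (rule countable_subset[of _ "D \<times> D"]) (use assms in auto)
  then have "metrizable_space ?P"
    using metrizable_space_product_topology[of "\<lambda>_. euclideanreal" ?J] metrizable_space_euclidean
    by (auto intro: countable_subset[rotated])
  moreover have "Hausdorff_space ?P" by (simp add: Hausdorff_space_product_topology)
  ultimately show ?thesis
    using embedding_map_imp_homeomorphic_space[OF continuous_imp_embedding_map[OF cont tau_compact _ inj]]
      homeomorphic_metrizable_space metrizable_space_subtopology by blast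
qed

end

section \<open>Weak types as a limit structure\<close>

context lrpc_setup
begin

lemma family_properties:
  fixes X :: "'i \<Rightarrow> ('g, 'x) gspace"
  assumes fam: "\<forall>i\<in>I. gflow (X i) \<and> zeta_Urysohn \<N> \<zeta> (X i)" and U: "\<U> \<in> ultrafilters I"
  shows "gflow (ultracoproduct I X \<U>)" "tp_G \<N> (ultracoproduct I X \<U>) \<in> WT \<N> \<zeta>"
    "M \<in> tp_G \<N> (ultracoproduct I X \<U>) \<Longrightarrow> eventually (\<lambda>i. M \<in> tp_G \<N> (X i)) \<U>"
    "good \<N> M \<Longrightarrow> W \<in> N_RPC \<N> \<Longrightarrow> prec M m W E \<Longrightarrow> eventually (\<lambda>i. mkstr m W E \<in> tp_G \<N> (X i)) \<U> \<Longrightarrow>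
      M \<in> tp_G \<N> (ultracoproduct I X \<U>)"
proof -
  have X: "\<And>i. i \<in> I \<Longrightarrow> gflow (X i)" "\<And>i. i \<in> I \<Longrightarrow> zeta_Urysohn \<N> \<zeta> (X i)" using fam by auto
  interpret lrpc_family \<N> \<N>\<^sub>0 G\<^sub>0 \<zeta> I X \<U>
    by unfold_locales (use X U in auto)
  show fl: "gflow (ultracoproduct I X \<U>)" by (rule ultracoproduct_gflow)
  have "zeta_Urysohn \<N> \<zeta> (ultracoproduct I X \<U>)"
    unfolding zeta_Urysohn_def
  proof
    fix A assume A: "A \<in> N_RPC \<N>"
    show "Urysohn (ultracoproduct I X \<U>) A (\<zeta> A)"
      by (rule ultracoproduct_Urysohn[OF A]) (use X(2) A in \<open>simp add: zeta_Urysohn_def\<close>)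
  qed
  then show "tp_G \<N> (ultracoproduct I X \<U>) \<in> WT \<N> \<zeta>" by (rule tp_G_in_WT[OF fl])
  show "M \<in> tp_G \<N> (ultracoproduct I X \<U>) \<Longrightarrow> eventually (\<lambda>i. M \<in> tp_G \<N> (X i)) \<U>"
    by (rule tp_ultracoproduct_imp)
  show "good \<N> M \<Longrightarrow> W \<in> N_RPC \<N> \<Longrightarrow> prec M m W E \<Longrightarrow> eventually (\<lambda>i. mkstr m W E \<in> tp_G \<N> (X i)) \<U> \<Longrightarrow>
      M \<in> tp_G \<N> (ultracoproduct I X \<U>)"
    by (rule tp_ultracoproduct_intro[OF X(2)])
qed

definition flow_of :: "'g wtype \<Rightarrow> ('g, 'g universe) gspace" where
  "flow_of t = (SOME X. gflow X \<and> zeta_Urysohn \<N> \<zeta> X \<and> tp_G \<N> X = t)"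

lemma flow_of:
  assumes "t \<in> WT \<N> \<zeta>"
  shows "gflow (flow_of t)" "zeta_Urysohn \<N> \<zeta> (flow_of t)" "tp_G \<N> (flow_of t) = t"
proof -
  have "\<exists>X :: ('g, 'g universe) gspace. gflow X \<and> zeta_Urysohn \<N> \<zeta> X \<and> tp_G \<N> X = t"
    using assms unfolding WT_def by blast
  from someI_ex[OF this] show "gflow (flow_of t)" "zeta_Urysohn \<N> \<zeta> (flow_of t)" "tp_G \<N> (flow_of t) = t"
    unfolding flow_of_def by blast+
qed

text \<open>The set of weak types indexes itself through representatives, so an ultrafilter on weak
  types directly yields an ultracoproduct.\<close>

definition wt_limit :: "'g wtype filter \<Rightarrow> 'g wtype" where
  "wt_limit U = tp_G \<N> (ultracoproduct (WT \<N> \<zeta>) flow_of U)"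

definition codes :: "(nat \<times> 'g set \<times> ('g \<times> nat \<times> nat) list) set" where
  "codes = {(m, W, E). W \<in> \<N>\<^sub>0 \<and> set E \<subseteq> G\<^sub>0 \<times> UNIV}"

abbreviation refines :: "('g, nat) relstr \<Rightarrow> nat \<times> 'g set \<times> ('g \<times> nat \<times> nat) list \<Rightarrow> bool" where
  "refines M d \<equiv> case d of (m, W, E) \<Rightarrow> good \<N> M \<and> prec M m W E"

abbreviation code_str :: "nat \<times> 'g set \<times> ('g \<times> nat \<times> nat) list \<Rightarrow> ('g, nat) relstr" where
  "code_str d \<equiv> case d of (m, W, E) \<Rightarrow> mkstr m W E"

lemma refinement:
  assumes "gflow X" "M \<in> tp_G \<N> X"
  shows "\<exists>d\<in>codes. refines M d \<and> code_str d \<in> tp_G \<N> X"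
proof -
  obtain m W E where "W \<in> \<N>\<^sub>0" "set E \<subseteq> G\<^sub>0 \<times> UNIV" "prec M m W E" "mkstr m W E \<in> tp_G \<N> X"
    using tp_refinement[OF assms] by blast
  then show ?thesis using tp_G_sdata(1)[OF assms]
    by (intro bexI[of _ "(m, W, E)"]) (auto simp: codes_def)
qed

lemma ultrafilters_iff: "U \<in> ultrafilters S \<longleftrightarrow> ultra U \<and> eventually (\<lambda>t. t \<in> S) U"
  by (auto simp: ultrafilters_def ultra_def)

lemma ev_flow_of:
  assumes "eventually (\<lambda>t. t \<in> WT \<N> \<zeta>) U"
  shows "eventually (\<lambda>t. P (tp_G \<N> (flow_of t))) U \<longleftrightarrow> eventually P U"
  by (rule eventually_cong[OF assms]) (simp add: flow_of(3))

sublocale limit_structure "WT \<N> \<zeta>" wt_limit refines code_str codes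
proof
  fix U :: "'g wtype filter" and M d
  assume U: "ultra U" "eventually (\<lambda>t. t \<in> WT \<N> \<zeta>) U"
  then have U': "U \<in> ultrafilters (WT \<N> \<zeta>)" by (simp add: ultrafilters_iff)
  have fam: "\<forall>t\<in>WT \<N> \<zeta>. gflow (flow_of t) \<and> zeta_Urysohn \<N> \<zeta> (flow_of t)" using flow_of by blast
  note fp = family_properties[OF fam U']
  show "wt_limit U \<in> WT \<N> \<zeta>" unfolding wt_limit_def by (rule fp(2))
  show "eventually (\<lambda>t. M \<in> t) U" if "M \<in> wt_limit U"
    using fp(3)[OF that[unfolded wt_limit_def]] unfolding ev_flow_of[OF U(2)] .
  show "M \<in> wt_limit U" if d: "d \<in> codes" "refines M d" and ev: "eventually (\<lambda>t. code_str d \<in> t) U"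
  proof -
    obtain m W E where mWE: "d = (m, W, E)" by (cases d)
    have "eventually (\<lambda>t. mkstr m W E \<in> tp_G \<N> (flow_of t)) U"
      unfolding ev_flow_of[OF U(2), of "\<lambda>t. mkstr m W E \<in> t"] using ev by (simp add: mWE)
    then show ?thesis
      unfolding wt_limit_def using d N0_D(1) by (intro fp(4)[of M W m E]) (auto simp: mWE codes_def)
  qed
next
  fix t M assume t: "t \<in> WT \<N> \<zeta>" and M: "M \<in> t"
  show "\<exists>d\<in>codes. refines M d \<and> code_str d \<in> t"
    using refinement[OF flow_of(1)[OF t], of M] M unfolding flow_of(3)[OF t] by blast
qed

text \<open>Both the given ultracoproduct and the one formed along the image ultrafilter contain
  \<open>M\<close> exactly if a code refining \<open>M\<close> belongs to most of the types. Hence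
  their weak types agree, and the convergence already known for \<open>wt_limit\<close>
  applies.\<close>

lemma ultralimit:
  fixes X :: "'i \<Rightarrow> ('g, 'x) gspace"
  assumes fam: "\<forall>i\<in>I. gflow (X i) \<and> zeta_Urysohn \<N> \<zeta> (X i)" and U: "\<U> \<in> ultrafilters I"
  shows "limitin \<tau> (\<lambda>i. tp_G \<N> (X i)) (tp_G \<N> (ultracoproduct I X \<U>)) \<U>"
proof -
  note fp = family_properties[OF fam U]
  let ?V = "filtermap (\<lambda>i. tp_G \<N> (X i)) \<U>" and ?t = "tp_G \<N> (ultracoproduct I X \<U>)"
  have U': "ultra \<U>" "eventually (\<lambda>i. i \<in> I) \<U>" using U by (simp_all add: ultrafilters_iff)
  have V: "ultra ?V" by (rule ultra_filtermap[OF U'(1)])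
  have VS: "eventually (\<lambda>t. t \<in> WT \<N> \<zeta>) ?V"
    unfolding eventually_filtermap using U'(2)
  proof eventually_elim
    case (elim i)
    then show ?case using fam tp_G_in_WT[of "X i"] by blast
  qed
  have "?t = wt_limit ?V"
  proof (intro set_eqI iffI)
    fix M assume "M \<in> ?t"
    then obtain d where d: "d \<in> codes" "refines M d" "code_str d \<in> ?t" using refinement[OF fp(1)] by blast
    have "eventually (\<lambda>t. code_str d \<in> t) ?V" unfolding eventually_filtermap by (rule fp(3)[OF d(3)])
    then show "M \<in> wt_limit ?V" by (rule L_intro[OF V VS d(1,2)])
  next
    fix M assume "M \<in> wt_limit ?V"
    then obtain d where d: "d \<in> codes" "refines M d" "code_str d \<in> wt_limit ?V" using refine[OF L_in[OF V VS]] by blast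
    obtain m W E where mWE: "d = (m, W, E)" by (cases d)
    have "eventually (\<lambda>t. code_str d \<in> t) ?V" by (rule L_sub[OF V VS d(3)])
    then have "eventually (\<lambda>i. mkstr m W E \<in> tp_G \<N> (X i)) \<U>" by (simp add: eventually_filtermap mWE)
    then show "M \<in> ?t" using d N0_D(1) by (intro fp(4)[of M W m E]) (auto simp: mWE codes_def)
  qed
  then show ?thesis
    using tau_convergence[OF V VS] fp(2) by (simp add: limitin_def topspace_tau eventually_filtermap)
qed

lemma tau_unique:
  assumes \<tau>': "compact_Hausdorff_on (WT \<N> \<zeta>) \<tau>'"
    and lim: "ultralimit_property TYPE('g wtype) TYPE('g universe) \<N> \<zeta> \<tau>'"
  shows "\<tau>' = \<tau>"
proof (cases "finite (WT \<N> \<zeta>)")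
  \<comment> \<open>The limit property concerns infinite index sets, so a finite set of weak types
    is settled directly: a finite Hausdorff space is discrete.\<close>
  case True
  have "\<tau>' = discrete_topology (WT \<N> \<zeta>)" "\<tau> = discrete_topology (WT \<N> \<zeta>)"
    using \<tau>' True tau_Hausdorff topspace_tau
    by (auto intro!: finite_topspace_imp_discrete_topology simp: compact_Hausdorff_on_def)
  then show ?thesis by simp
next
  case False
  have ts: "topspace \<tau>' = WT \<N> \<zeta>" "Hausdorff_space \<tau>'" using \<tau>' by (simp_all add: compact_Hausdorff_on_def)
  have conv': "eventually (\<lambda>t. t \<in> W) U"
    if U: "ultra U" "eventually (\<lambda>t. t \<in> WT \<N> \<zeta>) U" and W: "openin \<tau>' W" "wt_limit U \<in> W" for U W
  proof -
    have "U \<in> ultrafilters (WT \<N> \<zeta>)" using U by (simp add: ultrafilters_iff)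
    then have "limitin \<tau>' (\<lambda>t. tp_G \<N> (flow_of t)) (wt_limit U) U"
      using lim False flow_of(1,2) unfolding ultralimit_property_def wt_limit_def by blast
    then have "eventually (\<lambda>t. tp_G \<N> (flow_of t) \<in> W) U" using W by (simp add: limitin_def)
    then show ?thesis unfolding ev_flow_of[OF U(2), of "\<lambda>t. t \<in> W"] .
  qed
  have "closedin \<tau>' C \<longleftrightarrow> closedin \<tau> C" for C
    using closedin_of_ultralimits[OF ts(1) topspace_tau tau_Hausdorff, of wt_limit C, OF L_in conv' tau_convergence]
      closedin_of_ultralimits[OF topspace_tau ts(1) ts(2), of wt_limit C, OF L_in tau_convergence conv']
    by blast
  then have "closedin \<tau>' = closedin \<tau>" by blast
  then show ?thesis by (metis ts(1) topspace_tau topology_eq openin_closedin_eq)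
qed

end

text \<open>Subsets of a Roelcke precompact set are Roelcke precompact.\<close>

lemma N_RPC_base:
  fixes \<N> :: "'g::topological_group_add set set"
  assumes base: "symmetric_open_base \<N>" and "LRPC \<N>" and V: "open V" "0 \<in> V"
  shows "\<exists>W\<in>N_RPC \<N>. W \<subseteq> V"
proof -
  obtain U where U: "U \<in> \<N>" "RPC \<N> U" using assms(2) unfolding LRPC_def by blast
  have "open (U \<inter> V)" "0 \<in> U \<inter> V" using base U(1) V unfolding symmetric_open_base_def by auto
  then obtain W where W: "W \<in> \<N>" "W \<subseteq> U \<inter> V" using base unfolding symmetric_open_base_def by blast
  have "RPC \<N> W"
    unfolding RPC_def
  proof
    fix V assume "V \<in> \<N>"
    then obtain F where "finite F" "U \<subseteq> V + F + V" using U(2) unfolding RPC_def by blast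
    then show "\<exists>F. finite F \<and> W \<subseteq> V + F + V" using W(2) by (intro exI[of _ F]) auto
  qed
  then show ?thesis using W by (auto simp: N_RPC_def)
qed

lemma countable_setup:
  fixes \<N> :: "'g::topological_group_add set set"
  assumes base: "\<forall>V. open V \<longrightarrow> 0 \<in> V \<longrightarrow> (\<exists>W\<in>N_RPC \<N>. W \<subseteq> V)"
  shows "\<exists>\<N>\<^sub>0 (G\<^sub>0 :: 'g set). \<N>\<^sub>0 \<subseteq> N_RPC \<N> \<and> (\<forall>V. open V \<longrightarrow> 0 \<in> V \<longrightarrow> (\<exists>W\<in>\<N>\<^sub>0. W \<subseteq> V)) \<and>
    (\<forall>V. open V \<longrightarrow> V \<noteq> {} \<longrightarrow> (\<exists>g\<in>G\<^sub>0. g \<in> V)) \<and> 0 \<in> G\<^sub>0 \<and>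
    (separable_space (euclidean :: 'g topology) \<and> metrizable_space (euclidean :: 'g topology) \<longrightarrow>
      countable \<N>\<^sub>0 \<and> countable G\<^sub>0)"
proof (cases "separable_space (euclidean :: 'g topology) \<and> metrizable_space (euclidean :: 'g topology)")
  case False
  \<comment> \<open>Without countability there is nothing to choose; all Roelcke precompact members
    and the whole group serve.\<close>
  show ?thesis by (rule exI[of _ "N_RPC \<N>"], rule exI[of _ UNIV]) (use False base in auto)
next
  case True
  then obtain C :: "'g set" where C: "countable C" "euclidean closure_of C = topspace euclidean"
    unfolding separable_space_def by blast
  have dense: "\<exists>g\<in>insert 0 C. g \<in> V" if "open V" "V \<noteq> {}" for V
  proof -
    obtain x where x: "x \<in> V" using \<open>V \<noteq> {}\<close> by blast
    have "x \<in> euclidean closure_of C" using C(2) by simp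
    then show ?thesis using x \<open>open V\<close> unfolding in_closure_of by auto
  qed
  have "first_countable (euclidean :: 'g topology)" using True metrizable_imp_first_countable by blast
  then obtain \<B> :: "'g set set" where B: "countable \<B>" "\<forall>V\<in>\<B>. openin euclidean V"
      "\<forall>U. openin euclidean U \<and> 0 \<in> U \<longrightarrow> (\<exists>V\<in>\<B>. 0 \<in> V \<and> V \<subseteq> U)"
    unfolding first_countable_def by (metis UNIV_I topspace_euclidean)
  let ?B = "{V \<in> \<B>. 0 \<in> V}"
  have "\<forall>V\<in>?B. \<exists>W. W \<in> N_RPC \<N> \<and> W \<subseteq> V"
  proof
    fix V assume "V \<in> ?B"
    then have "open V" "0 \<in> V" using B(2) by auto
    with base show "\<exists>W. W \<in> N_RPC \<N> \<and> W \<subseteq> V" by blast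
  qed
  from bchoice[OF this] obtain h where h: "\<forall>V\<in>?B. h V \<in> N_RPC \<N> \<and> h V \<subseteq> V" by (elim exE)
  show ?thesis
  proof (rule exI[of _ "h ` ?B"], rule exI[of _ "insert 0 C"], intro conjI allI impI)
    show "h ` ?B \<subseteq> N_RPC \<N>" using h by auto
    fix V :: "'g set"
    show "\<exists>W\<in>h ` ?B. W \<subseteq> V" if V: "open V" "0 \<in> V"
    proof -
      have "\<exists>V'\<in>\<B>. 0 \<in> V' \<and> V' \<subseteq> V" using B(3) V by auto
      then obtain V' where "V' \<in> ?B" "V' \<subseteq> V" by blast
      then show ?thesis using h by blast
    qed
    show "countable (h ` ?B)" "countable (insert 0 C)" using B(1) C(1) by auto
  qed (use dense in auto)
qed

text \<open>The type variables \<open>'i\<close> and \<open>'x\<close> stand for arbitrary index and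
  carrier types of the limit property. Uniqueness uses it on fixed types: families indexed by weak
  types with flows on the universe type form enough ultracoproducts to determine the
  topology.\<close>

theorem theorem8p7:
  fixes \<N> :: "'g::{topological_group_add, t2_space} set set"
    and \<zeta> :: "'g set \<Rightarrow> 'g \<Rightarrow> real"
  assumes "symmetric_open_base \<N>"
    and "LRPC \<N>"
    and "\<zeta> \<in> N_RPC \<N> \<rightarrow> SN_RPC \<N>"
  shows "(\<forall>X :: ('g, 'x) gspace. gflow X \<and> zeta_Urysohn \<N> \<zeta> X \<longrightarrow> tp_G \<N> X \<in> WT \<N> \<zeta>) \<and>
    (\<exists>\<tau>. compact_Hausdorff_on (WT \<N> \<zeta>) \<tau> \<and>
       ultralimit_property TYPE('g wtype) TYPE('g universe) \<N> \<zeta> \<tau> \<and>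
       ultralimit_property TYPE('i) TYPE('x) \<N> \<zeta> \<tau> \<and>
       (\<forall>\<tau>'. compact_Hausdorff_on (WT \<N> \<zeta>) \<tau>' \<and>
             ultralimit_property TYPE('g wtype) TYPE('g universe) \<N> \<zeta> \<tau>' \<longrightarrow> \<tau>' = \<tau>) \<and>
       (separable_space (euclidean :: 'g topology) \<and> metrizable_space (euclidean :: 'g topology) \<longrightarrow>
          metrizable_space \<tau>))"
proof -
  have nb: "\<forall>V. open V \<longrightarrow> 0 \<in> V \<longrightarrow> (\<exists>W\<in>N_RPC \<N>. W \<subseteq> V)"
    using N_RPC_base[OF assms(1,2)] by blast
  obtain \<N>\<^sub>0 and G\<^sub>0 :: "'g set" where NG: "\<N>\<^sub>0 \<subseteq> N_RPC \<N>" "\<forall>V. open V \<longrightarrow> 0 \<in> V \<longrightarrow> (\<exists>W\<in>\<N>\<^sub>0. W \<subseteq> V)"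
    "\<forall>V. open V \<longrightarrow> V \<noteq> {} \<longrightarrow> (\<exists>g\<in>G\<^sub>0. g \<in> V)" "0 \<in> G\<^sub>0"
    and ct: "separable_space (euclidean :: 'g topology) \<and> metrizable_space (euclidean :: 'g topology) \<longrightarrow>
      countable \<N>\<^sub>0 \<and> countable G\<^sub>0"
    using countable_setup[OF nb] by (elim exE conjE)
  interpret lrpc_setup \<N> \<N>\<^sub>0 G\<^sub>0 \<zeta>
    by unfold_locales (use assms NG in auto)
  have "countable codes" if "countable \<N>\<^sub>0" "countable G\<^sub>0"
  proof -
    have "codes \<subseteq> UNIV \<times> \<N>\<^sub>0 \<times> lists (G\<^sub>0 \<times> UNIV)" by (auto simp: codes_def)
    moreover have "countable (UNIV \<times> \<N>\<^sub>0 \<times> lists (G\<^sub>0 \<times> (UNIV :: (nat \<times> nat) set)) :: (nat \<times> 'g set \<times> ('g \<times> nat \<times> nat) list) set)"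
      using that by (intro countable_SIGMA countable_lists) auto
    ultimately show ?thesis by (rule countable_subset)
  qed
  then have met: "separable_space (euclidean :: 'g topology) \<and> metrizable_space (euclidean :: 'g topology) \<longrightarrow> metrizable_space \<tau>"
    using tau_metrizable ct by blast
  have ul1: "ultralimit_property TYPE('g wtype) TYPE('g universe) \<N> \<zeta> \<tau>"
    unfolding ultralimit_property_def by (intro allI impI) (rule ultralimit)
  have ul2: "ultralimit_property TYPE('i) TYPE('x) \<N> \<zeta> \<tau>"
    unfolding ultralimit_property_def by (intro allI impI) (rule ultralimit)
  have "compact_Hausdorff_on (WT \<N> \<zeta>) \<tau>"
    using tau_compact tau_Hausdorff topspace_tau by (simp add: compact_Hausdorff_on_def)
  then have "\<exists>\<tau>. compact_Hausdorff_on (WT \<N> \<zeta>) \<tau> \<and>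
       ultralimit_property TYPE('g wtype) TYPE('g universe) \<N> \<zeta> \<tau> \<and>
       ultralimit_property TYPE('i) TYPE('x) \<N> \<zeta> \<tau> \<and>
       (\<forall>\<tau>'. compact_Hausdorff_on (WT \<N> \<zeta>) \<tau>' \<and>
             ultralimit_property TYPE('g wtype) TYPE('g universe) \<N> \<zeta> \<tau>' \<longrightarrow> \<tau>' = \<tau>) \<and>
       (separable_space (euclidean :: 'g topology) \<and> metrizable_space (euclidean :: 'g topology) \<longrightarrow>
          metrizable_space \<tau>)"
    by (intro exI[of _ \<tau>] conjI ul1 ul2 allI impI met[rule_format]) (blast intro: tau_unique)+
  moreover have "\<forall>X :: ('g, 'x) gspace. gflow X \<and> zeta_Urysohn \<N> \<zeta> X \<longrightarrow> tp_G \<N> X \<in> WT \<N> \<zeta>"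
    using tp_G_in_WT by blast
  ultimately show ?thesis by (rule conjI[rotated])
qed

end
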